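(* Let $d>4$. There exist $C,\lambda_0>0$ such that for every $\lambda\in[0,1]$ with $\lambda<\lambda_0$, every $0\le \beta\le\beta_c$, and every $x\in\mathbb Z^d$, $$G_\beta(0,x)\le \frac{C}{(1\vee|x|)^{d-2}}\exp(-|x|/L_\beta),$$ $$G_\beta^{\mathbb H}(0,x)\le \frac{C}{(1\vee|x_1|)^{d-1}}\exp(-|x_1|/L_\beta).$$
   Context: For $x\in\mathbb Z^d$, $x_j$ is the $j$-th coordinate and $|x|:=\max_j|x_j|$. $y\sim z$ means that $y,z$ are nearest neighbours in $\mathbb Z^d$. $\Lambda_n:=\{x\in\mathbb Z^d:|x|\le n\}$ and $\mathbb H:=\{0,1,\dots\}\times\mathbb Z^{d-1}$. $a\vee b:=\max(a,b)$. Weakly self-avoiding walk with parameter $\lambda\in[0,1]$ (the dependence on $\lambda$ is dropped from the notation): for a finite nearest-neighbour path $\gamma=(\gamma(0),\dots,\gamma(|\gamma|))$ in $\mathbb Z^d$ with $|\gamma|$ edges, $\rho(\gamma):=\prod_{0\le s<t\le|\gamma|}(1-\lambda\mathbf 1_{\gamma(s)=\gamma(t)})$. For $\Lambda\subset\mathbb Z^d$ and $\beta\ge0$, $G_\beta^\Lambda(x,y):=\sum_{\gamma:x\to y,\ \gamma\subset\Lambda}\beta^{|\gamma|}\rho(\gamma)$, the sum being over finite paths from $x$ to $y$ all of whose vertices lie in $\Lambda$ (the zero-length path is included if $x=y\in\Lambda$; the sum is $0$ if $x$ or $y$ is not in $\Lambda$). $G_\beta:=G_\beta^{\mathbb Z^d}$.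 $\chi(\beta):=\sum_{x\in\mathbb Z^d}G_\beta(0,x)$ and $\beta_c=\beta_c(\lambda):=\sup\{\beta\ge0:\chi(\beta)<\infty\}$. For $S\subset\mathbb Z^d$ with $0\in S$, $\varphi_\beta(S):=\sum_{y\in S,\ z\notin S,\ y\sim z}G_\beta^S(0,y)\,\beta$. The sharp length is $L_\beta:=\inf\{k\ge1:\varphi_\beta(\Lambda_k)\le e^{-2}\}$ ($k$ integer, $\inf\emptyset=\infty$, and $\exp(-r/\infty)=1$). $L_\beta$ is finite for $\beta<\beta_c$ and $L_{\beta_c}=\infty$. *)

theory Defs
  imports "HOL-Analysis.Analysis"
begin

text \<open>
  The lattice of dimension \<open>d = CARD('d)\<close> is \<^typ>\<open>int ^ 'd\<close>. Quantities which depend on the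
  dimension only through their value take it as a type token \<open>TYPE('d)\<close>.

  The parameters are meant to satisfy \<open>0 \<le> lam \<le> 1\<close> and \<open>0 \<le> \<beta>\<close>, so that all summands are
  nonnegative. Sums are taken in \<^typ>\<open>ennreal\<close>, where \<^const>\<open>infsum\<close> always is the
  supremum of the finite partial sums, so divergence shows up as the value \<open>\<infinity>\<close>.
\<close>

definition sup_norm :: "int ^ 'd::finite \<Rightarrow> int" where
  "sup_norm x = Max (range (\<lambda>j. \<bar>x $ j\<bar>))"

definition nn_adj :: "int ^ 'd::finite \<Rightarrow> int ^ 'd \<Rightarrow> bool" where
  "nn_adj y z \<longleftrightarrow> (\<Sum>j\<in>UNIV. \<bar>y $ j - z $ j\<bar>) = 1"

definition lattice_box :: "nat \<Rightarrow> (int ^ 'd::finite) set" where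
  "lattice_box n = {x. sup_norm x \<le> int n}"

text \<open>The index \<open>i\<close> names the coordinate which plays the role of the first one.\<close>

definition half_space :: "'d::finite \<Rightarrow> (int ^ 'd) set" where
  "half_space i = {x. 0 \<le> x $ i}"

text \<open>
  A path is the nonempty list of the vertices it visits; a path with \<open>n\<close> edges has length
  \<open>n + 1\<close> as a list.
\<close>

definition paths :: "(int ^ 'd::finite) set \<Rightarrow> int ^ 'd \<Rightarrow> int ^ 'd \<Rightarrow> (int ^ 'd) list set" where
  "paths \<Lambda> x y =
    {\<gamma>. \<gamma> \<noteq> [] \<and> hd \<gamma> = x \<and> last \<gamma> = y \<and> successively nn_adj \<gamma> \<and> set \<gamma> \<subseteq> \<Lambda>}"

definition num_edges :: "'a list \<Rightarrow> nat" where
  "num_edges \<gamma> = length \<gamma> - 1"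

definition path_weight :: "real \<Rightarrow> 'a list \<Rightarrow> real" where
  "path_weight lam \<gamma> =
    (\<Prod>(s, t)\<in>{(s, t). s < t \<and> t \<le> num_edges \<gamma>}. 1 - lam * of_bool (\<gamma> ! s = \<gamma> ! t))"

definition two_point ::
  "real \<Rightarrow> real \<Rightarrow> (int ^ 'd::finite) set \<Rightarrow> int ^ 'd \<Rightarrow> int ^ 'd \<Rightarrow> ennreal" where
  "two_point lam \<beta> \<Lambda> x y =
    (\<Sum>\<^sub>\<infinity>\<gamma>\<in>paths \<Lambda> x y. ennreal (\<beta> ^ num_edges \<gamma> * path_weight lam \<gamma>))"

definition susceptibility :: "'d::finite itself \<Rightarrow> real \<Rightarrow> real \<Rightarrow> ennreal" where
  "susceptibility _ lam \<beta> = (\<Sum>\<^sub>\<infinity>x::int ^ 'd. two_point lam \<beta> UNIV 0 x)"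

text \<open>
  The supremum is taken in \<^typ>\<open>ereal\<close>, where it is meaningful without first showing that
  the set is bounded.
\<close>

definition crit_beta :: "'d::finite itself \<Rightarrow> real \<Rightarrow> ereal" where
  "crit_beta D lam = Sup {ereal \<beta> | \<beta>. 0 \<le> \<beta> \<and> susceptibility D lam \<beta> < \<infinity>}"

definition phi :: "real \<Rightarrow> real \<Rightarrow> (int ^ 'd::finite) set \<Rightarrow> ennreal" where
  "phi lam \<beta> S =
    (\<Sum>\<^sub>\<infinity>(y, z)\<in>{(y, z). y \<in> S \<and> z \<notin> S \<and> nn_adj y z}. two_point lam \<beta> S 0 y * ennreal \<beta>)"

text \<open>The infimum of the empty set in \<^typ>\<open>enat\<close> is \<open>\<infinity>\<close>.\<close>

definition sharp_length :: "'d::finite itself \<Rightarrow> real \<Rightarrow> real \<Rightarrow> enat" where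
  "sharp_length _ lam \<beta> =
    Inf {enat k | k. 1 \<le> k \<and> phi lam \<beta> (lattice_box k :: (int ^ 'd) set) \<le> ennreal (exp (- 2))}"

text \<open>\<open>exp (- r / L)\<close> with the convention \<open>exp (- r / \<infinity>) = 1\<close>.\<close>

definition exp_decay :: "real \<Rightarrow> enat \<Rightarrow> real" where
  "exp_decay r L = (case L of enat k \<Rightarrow> exp (- r / real k) | \<infinity> \<Rightarrow> 1)"

end

(*
Everything is deduced from two bounds, uniform in the half-space and in \<beta>, on the two-point
function from x to the boundary of a half-space H at distance n from x: its sum over the boundary
is at most A, and each of its values is at most C / (n+1)^(d-1).  Splitting a path at a minimum of
a coordinate turns them into the bulk bound 2 A C / |x|^(d-2), and it bounds the sum over a level
at height k by A^2 (k+1).  The error in the reversed Simon-Lieb inequality for an intersection of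
half-spaces is then lam times a convergent series \<Sum> (k+1)^(3-d); this is where d > 4 enters.

For small lam the two bounds improve themselves, so that they propagate from \<beta> = 0 up to the
critical point by continuity in \<beta>.
- Sum: adding up the reversed inequality over all endpoints, and dividing by the finite
  susceptibility, shows that the exit mass of a half-space or a cube is at most 1 + O(lam).
- Pointwise: reflect across a hyperplane orthogonal to the boundary.  The values at a point and at its
  mirror image differ at most by the mass that reaches the bottom of a quarter-space before
  its side face.  Leaving cubes of doubling size, each of whose 2 d faces carries the same mass,
  the walk avoids that face with probability at most q < 1 at each scale.
  So the two-point function is almost constant at scale \<epsilon> n, and averaging over such a box
  gives a bound by the sum bound whose constant does not depend on C.

The exponential factor comes from iterating the Simon-Lieb inequality over cubes of radius L.
*)

theory Submission
  imports Defs
begin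

section \<open>Unconditional sums of extended nonnegative reals\<close>

text \<open>No bound is assumed for quarter-spaces or cubes: their two-point functions are at most
  those of the half-spaces that cut them out, and errors are estimated face by face. So the
  half-space bounds alone form a closed hypothesis. They are stated for all positions and both
  orientations, because splitting at a minimum moves the half-space.

  The order of the constants makes the bootstrap close: \<open>A\<close> and \<open>q\<close> depend
  only on the dimension, the number \<open>t\<close> of scales on \<open>q\<close>, \<open>C\<close>
  on \<open>A\<close> and \<open>t\<close>, and \<open>lam0\<close> comes last. The sum bound is
  recovered from an exit mass by dividing by \<beta>; for small \<beta> this is useless, and a
  direct bound on the susceptibility replaces it. The step length in \<beta> is controlled by the
  susceptibility at some larger \<beta>, so it is not uniform near the critical point; only the
  number of steps depends on it, never \<open>C\<close>. At the critical point the bounds are limits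
  from the left, since every finite sum of path weights is a polynomial in \<beta>.

  Losses are written as summands on the larger side of an inequality, since subtraction in
  \<open>ennreal\<close> is truncated.\<close>

lemma infsum_ennreal_eq_SUP:
  fixes f :: "'a \<Rightarrow> ennreal"
  shows "infsum f A = (SUP F\<in>{F. finite F \<and> F \<subseteq> A}. sum f F)"
  by (rule nonneg_infsum_complete) simp

text \<open>Passing to the integral over a count space makes monotone convergence and Tonelli
  available for \<open>infsum\<close>. Countability serves to exhaust \<open>A\<close> by finite
  sets, through the enumeration \<open>to_nat\<close>.\<close>

lemma infsum_eq_nn_integral:
  fixes f :: "'a::countable \<Rightarrow> ennreal"
  shows "infsum f A = (\<integral>\<^sup>+x. f x \<partial>count_space A)"
proof (rule antisym)
  show "infsum f A \<le> (\<integral>\<^sup>+x. f x \<partial>count_space A)"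
    unfolding infsum_ennreal_eq_SUP
  proof (rule SUP_least)
    fix F assume "F \<in> {F. finite F \<and> F \<subseteq> A}"
    then have F: "finite F" "F \<subseteq> A" by auto
    have "sum f F = (\<integral>\<^sup>+x. f x \<partial>count_space F)"
      using F by (simp add: nn_integral_count_space_finite)
    also have "\<dots> = (\<integral>\<^sup>+x. f x * indicator F x \<partial>count_space A)"
      using F by (auto simp: nn_integral_count_space_indicator[of F] nn_integral_count_space_indicator[of A]
          indicator_def intro!: nn_integral_cong)
    also have "\<dots> \<le> (\<integral>\<^sup>+x. f x \<partial>count_space A)"
      by (intro nn_integral_mono) (auto simp: indicator_def)
    finally show "sum f F \<le> (\<integral>\<^sup>+x. f x \<partial>count_space A)" .
  qed
  define F where "F n = {x\<in>A. to_nat x \<le> n}" for n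
  have finF: "finite (F n)" for n
    by (rule finite_subset[of _ "to_nat -` {..n}"]) (auto simp: F_def intro: finite_vimageI)
  have "(\<integral>\<^sup>+x. f x \<partial>count_space A) = (\<integral>\<^sup>+x. (SUP n. f x * indicator (F n) x) \<partial>count_space A)"
  proof (rule nn_integral_cong)
    fix x assume "x \<in> space (count_space A)"
    then have xA: "x \<in> A" by simp
    show "f x = (SUP n. f x * indicator (F n) x)"
    proof (rule antisym)
      have "f x = f x * indicator (F (to_nat x)) x" using xA by (simp add: F_def)
      also have "\<dots> \<le> (SUP n. f x * indicator (F n) x)" by (rule SUP_upper) simp
      finally show "f x \<le> (SUP n. f x * indicator (F n) x)" .
    qed (auto intro!: SUP_least simp: indicator_def)
  qed
  also have "\<dots> = (SUP n. (\<integral>\<^sup>+x. f x * indicator (F n) x \<partial>count_space A))"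
    by (rule nn_integral_monotone_convergence_SUP)
       (auto simp: incseq_def le_fun_def indicator_def F_def)
  also have "\<dots> \<le> infsum f A"
  proof (rule SUP_least)
    fix n
    have "(\<integral>\<^sup>+x. f x * indicator (F n) x \<partial>count_space A) = (\<integral>\<^sup>+x. f x \<partial>count_space (F n))"
      by (auto simp: nn_integral_count_space_indicator F_def indicator_def intro!: nn_integral_cong)
    also have "\<dots> = sum f (F n)" using finF by (simp add: nn_integral_count_space_finite)
    also have "\<dots> \<le> infsum f A" unfolding infsum_ennreal_eq_SUP
      by (rule SUP_upper) (auto simp: finF, auto simp: F_def)
    finally show "(\<integral>\<^sup>+x. f x * indicator (F n) x \<partial>count_space A) \<le> infsum f A" .
  qed
  finally show "(\<integral>\<^sup>+x. f x \<partial>count_space A) \<le> infsum f A" .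
qed

lemma infsum_ennreal_mono:
  fixes f :: "'a \<Rightarrow> ennreal"
  shows "(\<And>x. x \<in> A \<Longrightarrow> f x \<le> g x) \<Longrightarrow> infsum f A \<le> infsum g A"
  by (intro infsum_mono nonneg_summable_on_complete) auto

lemma infsum_ennreal_mono_set:
  fixes f :: "'a \<Rightarrow> ennreal"
  shows "A \<subseteq> B \<Longrightarrow> infsum f A \<le> infsum f B"
  unfolding infsum_ennreal_eq_SUP by (rule SUP_subset_mono) auto

lemma infsum_ennreal_member_le:
  fixes f :: "'a \<Rightarrow> ennreal"
  assumes "x \<in> A" shows "f x \<le> infsum f A"
  using infsum_ennreal_mono_set[of "{x}" A f] assms by simp

lemma infsum_ennreal_cmult:
  fixes f :: "'a::countable \<Rightarrow> ennreal"
  shows "(\<Sum>\<^sub>\<infinity>x\<in>A. c * f x) = c * infsum f A"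
  unfolding infsum_eq_nn_integral by (rule nn_integral_cmult) simp

lemma infsum_ennreal_multc:
  fixes f :: "'a::countable \<Rightarrow> ennreal"
  shows "(\<Sum>\<^sub>\<infinity>x\<in>A. f x * c) = infsum f A * c"
  using infsum_ennreal_cmult[of c f A] by (simp add: mult.commute)

lemma infsum_ennreal_indicator:
  fixes f :: "'a \<Rightarrow> ennreal"
  shows "infsum f A = (\<Sum>\<^sub>\<infinity>x. f x * indicator A x)"
  by (rule infsum_cong_neutral) (auto simp: indicator_def)

lemma infsum_ennreal_Sigma:
  fixes f :: "'a::countable \<Rightarrow> 'b::countable \<Rightarrow> ennreal"
  shows "(\<Sum>\<^sub>\<infinity>(x,y)\<in>Sigma A B. f x y) = (\<Sum>\<^sub>\<infinity>x\<in>A. \<Sum>\<^sub>\<infinity>y\<in>B x. f x y)"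
proof -
  have "(\<Sum>\<^sub>\<infinity>(x,y)\<in>Sigma A B. f x y) =
    (\<Sum>\<^sub>\<infinity>p. (\<lambda>(x,y). f x y * indicator (Sigma A B) (x,y)) p)"
    by (subst infsum_ennreal_indicator) (simp add: case_prod_unfold)
  also have "\<dots> = (\<Sum>\<^sub>\<infinity>x. \<Sum>\<^sub>\<infinity>y. f x y * indicator (Sigma A B) (x,y))"
    unfolding infsum_eq_nn_integral
    by (subst nn_integral_fst_count_space[symmetric]) simp
  also have "\<dots> = (\<Sum>\<^sub>\<infinity>x. (\<Sum>\<^sub>\<infinity>y\<in>B x. f x y) * indicator A x)"
  proof (rule infsum_cong)
    fix x
    have "(\<Sum>\<^sub>\<infinity>y. f x y * indicator (Sigma A B) (x,y)) =
      (\<Sum>\<^sub>\<infinity>y. indicator A x * (f x y * indicator (B x) y))"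
      by (rule infsum_cong) (auto simp: indicator_def)
    also have "\<dots> = indicator A x * (\<Sum>\<^sub>\<infinity>y. f x y * indicator (B x) y)"
      by (rule infsum_ennreal_cmult)
    also have "\<dots> = (\<Sum>\<^sub>\<infinity>y\<in>B x. f x y) * indicator A x"
      by (subst (2) infsum_ennreal_indicator) (simp add: mult.commute)
    finally show "(\<Sum>\<^sub>\<infinity>y. f x y * indicator (Sigma A B) (x,y)) =
      (\<Sum>\<^sub>\<infinity>y\<in>B x. f x y) * indicator A x" .
  qed
  also have "\<dots> = (\<Sum>\<^sub>\<infinity>x\<in>A. \<Sum>\<^sub>\<infinity>y\<in>B x. f x y)"
    by (subst (2) infsum_ennreal_indicator) simp
  finally show ?thesis .
qed

lemma infsum_ennreal_swap:
  fixes f :: "'a::countable \<Rightarrow> 'b::countable \<Rightarrow> ennreal"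
  shows "(\<Sum>\<^sub>\<infinity>x\<in>A. \<Sum>\<^sub>\<infinity>y\<in>B. f x y) = (\<Sum>\<^sub>\<infinity>y\<in>B. \<Sum>\<^sub>\<infinity>x\<in>A. f x y)"
proof -
  have "(\<Sum>\<^sub>\<infinity>x\<in>A. \<Sum>\<^sub>\<infinity>y\<in>B. f x y) = (\<Sum>\<^sub>\<infinity>(x,y)\<in>A \<times> B. f x y)"
    by (rule infsum_ennreal_Sigma[symmetric])
  also have "\<dots> = (\<Sum>\<^sub>\<infinity>p\<in>B \<times> A. (\<lambda>(x,y). f x y) (prod.swap p))"
    by (rule infsum_reindex_bij_betw[symmetric]) (rule bij_betwI[of _ _ _ prod.swap], auto)
  also have "\<dots> = (\<Sum>\<^sub>\<infinity>(y,x)\<in>B \<times> A. f x y)"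
    by (simp add: case_prod_unfold)
  also have "\<dots> = (\<Sum>\<^sub>\<infinity>y\<in>B. \<Sum>\<^sub>\<infinity>x\<in>A. f x y)"
    by (rule infsum_ennreal_Sigma)
  finally show ?thesis .
qed

lemma infsum_ennreal_times:
  fixes f :: "'a::countable \<Rightarrow> ennreal" and g :: "'b::countable \<Rightarrow> ennreal"
  shows "(\<Sum>\<^sub>\<infinity>(x,y)\<in>A \<times> B. f x * g y) = infsum f A * infsum g B"
  by (subst infsum_ennreal_Sigma) (simp add: infsum_ennreal_cmult infsum_ennreal_multc)

lemma infsum_ennreal_inj_le:
  fixes f :: "'a \<Rightarrow> ennreal" and g :: "'b \<Rightarrow> ennreal"
  assumes "inj_on h A" "h ` A \<subseteq> B" "\<And>x. x \<in> A \<Longrightarrow> f x \<le> g (h x)"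
  shows "infsum f A \<le> infsum g B"
proof -
  have "infsum f A \<le> infsum (g \<circ> h) A" using assms(3) by (intro infsum_ennreal_mono) simp
  also have "\<dots> = infsum g (h ` A)" using assms(1) by (rule infsum_reindex[symmetric])
  also have "\<dots> \<le> infsum g B" using assms(2) by (rule infsum_ennreal_mono_set)
  finally show ?thesis .
qed

text \<open>Choosing one index for each point of \<open>A\<close> embeds \<open>A\<close> into the
  disjoint union \<open>Sigma I B\<close>.\<close>

lemma infsum_ennreal_UN_le:
  fixes f :: "'a::countable \<Rightarrow> ennreal" and B :: "'i::countable \<Rightarrow> 'a set"
  assumes "A \<subseteq> (\<Union>i\<in>I. B i)"
  shows "infsum f A \<le> (\<Sum>\<^sub>\<infinity>i\<in>I. infsum f (B i))"
proof -
  define h where "h x = (SOME i. i \<in> I \<and> x \<in> B i)" for x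
  have h: "h x \<in> I \<and> x \<in> B (h x)" if "x \<in> A" for x
    unfolding h_def by (rule someI_ex) (use assms that in auto)
  have "infsum f A \<le> (\<Sum>\<^sub>\<infinity>(i,x)\<in>Sigma I B. f x)"
    by (rule infsum_ennreal_inj_le[where h = "\<lambda>x. (h x, x)"]) (use h in \<open>auto simp: inj_on_def\<close>)
  then show ?thesis by (subst (asm) infsum_ennreal_Sigma) simp
qed

lemma infsum_ennreal_leI:
  fixes f :: "'a \<Rightarrow> ennreal"
  assumes "\<And>F. finite F \<Longrightarrow> F \<subseteq> A \<Longrightarrow> sum f F \<le> c"
  shows "infsum f A \<le> c"
  unfolding infsum_ennreal_eq_SUP using assms by (intro SUP_least) auto

section \<open>Decompositions of weighted paths\<close>

lemma path_weight_Nil [simp]: "path_weight lam [] = 1"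
  unfolding path_weight_def num_edges_def by (rule prod.neutral) auto

text \<open>The pairs of times are split into those with \<open>s = 0\<close>, which compare
  \<open>x\<close> with each later vertex, and the shifted remaining ones. With this recursion the
  weight can be treated by list induction, without index sets.\<close>

lemma path_weight_Cons:
  "path_weight lam (x # xs) = (1 - lam) ^ count_list xs x * path_weight lam xs"
proof (cases "xs = []")
  case True
  have "path_weight lam [x] = 1"
    unfolding path_weight_def num_edges_def by (rule prod.neutral) auto
  then show ?thesis using True by simp
next
  case False
  let ?P = "\<lambda>n::nat. {(s, t). s < t \<and> t \<le> n}"
  obtain n where n: "length xs = Suc n" using False by (cases xs) auto
  have fin: "finite (?P n)" by (rule finite_subset[of _ "{..n} \<times> {..n}"]) auto
  have split: "?P (Suc n) = (\<lambda>t. (0, Suc t)) ` {..<length xs} \<union> map_prod Suc Suc ` ?P n"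
    (is "_ = ?A \<union> ?B")
  proof (intro equalityI subsetI)
    fix p assume "p \<in> ?P (Suc n)"
    then obtain s t where p: "p = (s, t)" "s < t" "t \<le> Suc n" by auto
    then obtain t' where t': "t = Suc t'" by (cases t) auto
    show "p \<in> ?A \<union> ?B"
    proof (cases s)
      case 0 then show ?thesis using p t' n by auto
    next
      case (Suc s')
      then have "p = map_prod Suc Suc (s', t')" "(s', t') \<in> ?P n" using p t' by auto
      then show ?thesis by blast
    qed
  qed (use n in auto)
  have count: "(\<Prod>t<length ys. 1 - lam * of_bool (x = ys ! t)) = (1 - lam) ^ count_list ys x" for ys
    by (induction ys) (simp_all add: prod.lessThan_Suc_shift del: prod.lessThan_Suc)
  have "path_weight lam (x # xs) =
    (\<Prod>(s, t)\<in>?P (Suc n). 1 - lam * of_bool ((x # xs) ! s = (x # xs) ! t))"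
    using n by (simp add: path_weight_def num_edges_def)
  also have "\<dots> = (\<Prod>(s, t)\<in>?A. 1 - lam * of_bool ((x # xs) ! s = (x # xs) ! t)) *
      (\<Prod>(s, t)\<in>?B. 1 - lam * of_bool ((x # xs) ! s = (x # xs) ! t))"
    unfolding split using fin by (intro prod.union_disjoint) auto
  also have "(\<Prod>(s, t)\<in>?A. 1 - lam * of_bool ((x # xs) ! s = (x # xs) ! t)) =
      (\<Prod>t<length xs. 1 - lam * of_bool (x = xs ! t))"
    by (subst prod.reindex) (auto simp: inj_on_def)
  also have "\<dots> = (1 - lam) ^ count_list xs x" by (rule count)
  also have "(\<Prod>(s, t)\<in>?B. 1 - lam * of_bool ((x # xs) ! s = (x # xs) ! t)) = path_weight lam xs"
    using n by (subst prod.reindex)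
      (auto simp: inj_on_def path_weight_def num_edges_def case_prod_unfold)
  finally show ?thesis .
qed

lemma path_weight_nonneg: "0 \<le> lam \<Longrightarrow> lam \<le> 1 \<Longrightarrow> 0 \<le> path_weight lam \<gamma>"
  by (induction \<gamma>) (auto simp: path_weight_Cons)

text \<open>The number of pairs of times, one in each list, at which the two lists agree: the
  exponent of the repulsion between consecutive pieces of a path.\<close>

definition crossings :: "'a list \<Rightarrow> 'a list \<Rightarrow> nat" where
  "crossings xs ys = (\<Sum>x\<leftarrow>xs. count_list ys x)"

lemma path_weight_append:
  "path_weight lam (xs @ ys) = path_weight lam xs * path_weight lam ys * (1 - lam) ^ crossings xs ys"
  by (induction xs) (simp_all add: crossings_def path_weight_Cons power_add)

lemma path_weight_rev: "path_weight lam (rev xs) = path_weight lam xs"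
proof (induction xs)
  case (Cons x xs)
  have "(\<Sum>y\<leftarrow>zs. count_list [x] y) = count_list zs x" for zs :: "'a list"
    by (induction zs) auto
  then have "crossings (rev xs) [x] = count_list xs x"
    unfolding crossings_def by (metis rev_map sum_list_rev)
  then show ?case
    using Cons by (simp add: path_weight_append path_weight_Cons)
qed simp

lemma path_weight_map:
  assumes "inj T" shows "path_weight lam (map T xs) = path_weight lam xs"
proof (induction xs)
  case (Cons x xs)
  have "count_list (map T xs) (T x) = count_list xs x"
    using assms by (induction xs) (auto simp: inj_def)
  then show ?case using Cons by (simp add: path_weight_Cons)
qed simp

text \<open>Visit counts at a fixed vertex factor over the two pieces, so after exchanging sums the
  interaction can be estimated vertex by vertex. Any \<open>S\<close> containing the first piece
  will do, since the other terms vanish.\<close>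

lemma crossings_eq_infsum:
  assumes "set xs \<subseteq> S"
  shows "of_nat (crossings xs ys) =
    (\<Sum>\<^sub>\<infinity>v\<in>S. of_nat (count_list xs v) * of_nat (count_list ys v) :: ennreal)"
proof -
  have "crossings xs ys = (\<Sum>v\<in>set xs. count_list xs v * count_list ys v)"
    unfolding crossings_def
    by (rule sum_list_map_eq_sum_count)
  then have "(of_nat (crossings xs ys) :: ennreal) =
      (\<Sum>\<^sub>\<infinity>v\<in>set xs. of_nat (count_list xs v) * of_nat (count_list ys v))"
    by simp
  also have "\<dots> = (\<Sum>\<^sub>\<infinity>v\<in>S. of_nat (count_list xs v) * of_nat (count_list ys v))"
    using assms by (intro infsum_cong_neutral) (auto simp: count_notin)
  finally show ?thesis .
qed

lemma num_edges_append:
  "xs \<noteq> [] \<Longrightarrow> ys \<noteq> [] \<Longrightarrow> num_edges (xs @ ys) = Suc (num_edges xs + num_edges ys)"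
  by (cases xs; cases ys) (auto simp: num_edges_def)

lemma paths_empty: "x \<notin> \<Lambda> \<or> y \<notin> \<Lambda> \<Longrightarrow> paths \<Lambda> x y = {}"
  by (auto simp: paths_def) (meson hd_in_set last_in_set subsetD)+

lemma two_point_outside: "x \<notin> \<Lambda> \<or> y \<notin> \<Lambda> \<Longrightarrow> two_point lam \<beta> \<Lambda> x y = 0"
  by (simp add: two_point_def paths_empty)

lemma two_point_mono_set: "\<Lambda> \<subseteq> \<Lambda>' \<Longrightarrow> two_point lam \<beta> \<Lambda> x y \<le> two_point lam \<beta> \<Lambda>' x y"
  unfolding two_point_def by (rule infsum_ennreal_mono_set) (auto simp: paths_def)

lemma nn_adj_sym: "nn_adj y z \<longleftrightarrow> nn_adj z y"
  by (simp add: nn_adj_def abs_minus_commute)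

text \<open>Coincidences within a path, its length and its steps are preserved, and the domain is
  transported along with the path. Translations, reflections and permutations of coordinates all
  enter through this lemma.\<close>

lemma two_point_image:
  assumes "inj T" and adj: "\<And>y z. nn_adj (T y) (T z) \<longleftrightarrow> nn_adj y z"
  shows "two_point lam \<beta> (T ` \<Lambda>) (T x) (T y) = two_point lam \<beta> \<Lambda> x y"
proof -
  have succ: "successively nn_adj (map T \<gamma>) = successively nn_adj \<gamma>" for \<gamma>
    by (simp add: successively_map adj)
  have "paths (T ` \<Lambda>) (T x) (T y) = map T ` paths \<Lambda> x y"
  proof (intro equalityI subsetI)
    fix \<gamma> assume \<gamma>: "\<gamma> \<in> paths (T ` \<Lambda>) (T x) (T y)"
    then have "\<gamma> \<in> lists (T ` \<Lambda>)" by (auto simp: paths_def)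
    then obtain \<delta> where \<delta>: "\<gamma> = map T \<delta>" "set \<delta> \<subseteq> \<Lambda>"
      by (auto simp: lists_image)
    with \<gamma> have "\<delta> \<in> paths \<Lambda> x y"
      using assms(1) by (auto simp: paths_def succ hd_map last_map inj_def)
    then show "\<gamma> \<in> map T ` paths \<Lambda> x y" using \<delta> by auto
  qed (auto simp: paths_def succ hd_map last_map intro!: imageI)
  moreover have "inj_on (map T) A" for A
    using assms(1) by (meson inj_mapI inj_on_subset subset_UNIV)
  ultimately show ?thesis
    unfolding two_point_def
    by (simp add: infsum_reindex o_def path_weight_map[OF assms(1)] num_edges_def)
qed

lemma two_point_sym: "two_point lam \<beta> \<Lambda> x y = two_point lam \<beta> \<Lambda> y x"
proof -
  have adj: "(\<lambda>x y. nn_adj y x) = (nn_adj :: int ^ 'a \<Rightarrow> _)"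
    by (intro ext) (rule nn_adj_sym)
  have "rev \<gamma> \<in> paths \<Lambda> y x" if "\<gamma> \<in> paths \<Lambda> x y" for \<gamma> x y
    using that unfolding paths_def by (simp add: hd_rev last_rev) (simp only: adj)
  then show ?thesis unfolding two_point_def
    by (intro infsum_reindex_bij_witness[where i = rev and j = rev])
       (auto simp: path_weight_rev num_edges_def)
qed

section \<open>Cutting and gluing weighted paths\<close>

definition out_edges :: "(int ^ 'd::finite) set \<Rightarrow> ((int ^ 'd) \<times> (int ^ 'd)) set" where
  "out_edges S = {(y, z). y \<in> S \<and> z \<notin> S \<and> nn_adj y z}"

lemma paths_vertex_split:
  assumes "\<gamma> \<in> paths \<Lambda> x y" "i < length \<gamma>"
  shows "take (Suc i) \<gamma> \<in> paths \<Lambda> x (\<gamma> ! i)" "drop i \<gamma> \<in> paths \<Lambda> (\<gamma> ! i) y"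
proof -
  have \<gamma>: "\<gamma> = take i \<gamma> @ \<gamma> ! i # drop (Suc i) \<gamma>" using assms(2) by (rule id_take_nth_drop)
  have a: "successively nn_adj (take i \<gamma> @ \<gamma> ! i # drop (Suc i) \<gamma>)"
    using assms(1) \<gamma> by (simp add: paths_def)
  have t: "take (Suc i) \<gamma> = take i \<gamma> @ [\<gamma> ! i]" using assms(2) by (rule take_Suc_conv_app_nth)
  have d: "drop i \<gamma> = \<gamma> ! i # drop (Suc i) \<gamma>" using assms(2) by (rule Cons_nth_drop_Suc[symmetric])
  have s1: "successively nn_adj (take (Suc i) \<gamma>)"
    using a unfolding t by (auto simp: successively_append_iff)
  have s2: "successively nn_adj (drop i \<gamma>)"
    using a unfolding d by (auto simp: successively_append_iff)
  have ne: "\<gamma> \<noteq> []" using assms(2) by auto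
  show "take (Suc i) \<gamma> \<in> paths \<Lambda> x (\<gamma> ! i)"
  proof -
    have "hd (take (Suc i) \<gamma>) = hd \<gamma>" by (rule hd_take) simp
    moreover have "last (take (Suc i) \<gamma>) = \<gamma> ! i" unfolding t by simp
    moreover have "take (Suc i) \<gamma> \<noteq> []" unfolding t by simp
    ultimately show ?thesis using assms(1) s1 set_take_subset[of "Suc i" \<gamma>] by (auto simp: paths_def)
  qed
  show "drop i \<gamma> \<in> paths \<Lambda> (\<gamma> ! i) y"
    using assms s2 ne set_drop_subset[of i \<gamma>] by (auto simp: paths_def hd_drop_conv_nth)
qed

locale wsaw =
  fixes lam \<beta> :: real
  assumes lam: "0 \<le> lam" "lam \<le> 1" and beta: "0 \<le> \<beta>"
begin

definition weight :: "'a list \<Rightarrow> ennreal" where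
  "weight \<gamma> = ennreal (\<beta> ^ num_edges \<gamma> * path_weight lam \<gamma>)"

abbreviation G :: "(int ^ 'd::finite) set \<Rightarrow> int ^ 'd \<Rightarrow> int ^ 'd \<Rightarrow> ennreal" where
  "G \<equiv> two_point lam \<beta>"

abbreviation b :: ennreal where "b \<equiv> ennreal \<beta>"

lemma G_def: "G \<Lambda> x y = infsum weight (paths \<Lambda> x y)"
  by (simp add: two_point_def weight_def[abs_def])

lemmas pw_nonneg = path_weight_nonneg[OF lam]

lemma weight_append:
  assumes "xs \<noteq> []" "ys \<noteq> []"
  shows "weight (xs @ ys) = weight xs * b * weight ys * ennreal ((1 - lam) ^ crossings xs ys)"
  unfolding weight_def using beta lam pw_nonneg[of xs] pw_nonneg[of ys]
  by (simp add: num_edges_append[OF assms] path_weight_append ennreal_mult[symmetric] power_add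
      mult_ac del: ennreal_power)

lemma weight_append_le:
  assumes "xs \<noteq> []" "ys \<noteq> []" shows "weight (xs @ ys) \<le> weight xs * b * weight ys"
proof -
  have "ennreal ((1 - lam) ^ crossings xs ys) \<le> 1"
    using lam by (simp add: power_le_one flip: ennreal_1)
  from mult_left_mono[OF this, of "weight xs * b * weight ys"]
  show ?thesis unfolding weight_append[OF assms] by simp
qed

text \<open>Bernoulli's inequality for \<open>(1 - lam) ^ crossings xs ys\<close>: the relative loss
  in gluing is at most \<open>lam\<close> for each coincidence between the pieces.\<close>

lemma weight_append_ge:
  assumes "xs \<noteq> []" "ys \<noteq> []"
  shows "weight xs * b * weight ys \<le>
    weight (xs @ ys) + ennreal lam * (of_nat (crossings xs ys) * (weight xs * b * weight ys))"
proof -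
  have "1 + real (crossings xs ys) * (- lam) \<le> (1 + (- lam)) ^ crossings xs ys"
    using lam by (intro Bernoulli_inequality) auto
  then have "1 \<le> (1 - lam) ^ crossings xs ys + lam * real (crossings xs ys)" by (simp add: mult.commute)
  then have "1 \<le> ennreal ((1 - lam) ^ crossings xs ys + lam * real (crossings xs ys))"
    by (simp flip: ennreal_1 add: ennreal_leI)
  also have "\<dots> = ennreal ((1 - lam) ^ crossings xs ys) + ennreal lam * of_nat (crossings xs ys)"
    using lam by (simp add: ennreal_plus[symmetric] ennreal_mult ennreal_of_nat_eq_real_of_nat)
  finally have "1 \<le> ennreal ((1 - lam) ^ crossings xs ys) + ennreal lam * of_nat (crossings xs ys)" .
  from mult_left_mono[OF this, of "weight xs * b * weight ys"]
  show ?thesis unfolding weight_append[OF assms] by (simp add: distrib_left mult_ac)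
qed

text \<open>Both pieces contain the cut vertex, and the pairs of times inside the prefix and inside
  the suffix are disjoint, so only factors at most 1 are lost. Unlike a cut at an edge, this leaves
  no factor \<open>b\<close>.\<close>

lemma weight_vertex_split:
  assumes "i < length \<gamma>"
  shows "weight \<gamma> \<le> weight (take (Suc i) \<gamma>) * weight (drop i \<gamma>)"
proof -
  have c: "count_list (xs @ v # ys) x \<ge> count_list (xs @ [v]) x" for xs ys v and x :: 'a by simp
  have pw: "path_weight lam (xs @ v # ys) \<le> path_weight lam (xs @ [v]) * path_weight lam (v # ys)"
    for xs ys and v :: 'a
  proof (induction xs)
    case Nil then show ?case by (simp add: path_weight_Cons)
  next
    case (Cons x xs)
    have "(1 - lam) ^ count_list (xs @ v # ys) x \<le> (1 - lam) ^ count_list (xs @ [v]) x"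
      using lam c by (intro power_decreasing) auto
    then have "(1 - lam) ^ count_list (xs @ v # ys) x * path_weight lam (xs @ v # ys) \<le>
       (1 - lam) ^ count_list (xs @ [v]) x * (path_weight lam (xs @ [v]) * path_weight lam (v # ys))"
      using Cons lam by (intro mult_mono) (auto simp: pw_nonneg)
    then show ?case by (simp add: path_weight_Cons mult_ac)
  qed
  have \<gamma>: "\<gamma> = take i \<gamma> @ \<gamma> ! i # drop (Suc i) \<gamma>" using assms by (rule id_take_nth_drop)
  have t: "take (Suc i) \<gamma> = take i \<gamma> @ [\<gamma> ! i]" using assms by (rule take_Suc_conv_app_nth)
  have d: "drop i \<gamma> = \<gamma> ! i # drop (Suc i) \<gamma>" using assms by (rule Cons_nth_drop_Suc[symmetric])
  have "path_weight lam \<gamma> \<le> path_weight lam (take (Suc i) \<gamma>) * path_weight lam (drop i \<gamma>)"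
    using pw[of "take i \<gamma>" "\<gamma> ! i" "drop (Suc i) \<gamma>"] \<gamma> t d by simp
  moreover have "num_edges \<gamma> = num_edges (take (Suc i) \<gamma>) + num_edges (drop i \<gamma>)"
    using assms by (simp add: num_edges_def)
  ultimately have *: "\<beta> ^ num_edges \<gamma> * path_weight lam \<gamma> \<le>
      (\<beta> ^ num_edges (take (Suc i) \<gamma>) * path_weight lam (take (Suc i) \<gamma>)) *
      (\<beta> ^ num_edges (drop i \<gamma>) * path_weight lam (drop i \<gamma>))"
    using mult_left_mono[of "path_weight lam \<gamma>"
        "path_weight lam (take (Suc i) \<gamma>) * path_weight lam (drop i \<gamma>)" "\<beta> ^ num_edges \<gamma>"] beta
    by (simp add: power_add mult.assoc mult.commute mult.left_commute)
  from * show ?thesis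
    unfolding weight_def using beta
    by (subst ennreal_mult[symmetric]) (auto simp: pw_nonneg intro!: ennreal_leI)
qed

lemma G_refl_ge: "x \<in> \<Lambda> \<Longrightarrow> 1 \<le> G \<Lambda> x x"
  unfolding G_def using infsum_ennreal_member_le[of "[x]" "paths \<Lambda> x x" weight]
  by (auto simp: weight_def paths_def num_edges_def path_weight_Cons)

lemma G_singleton: "G {x} x x = 1"
proof -
  have "\<gamma> = [x]" if g: "\<gamma> \<in> paths {x} x x" for \<gamma>
  proof (cases \<gamma>)
    case (Cons a l)
    show ?thesis
    proof (cases l)
      case (Cons c m)
      with \<open>\<gamma> = a # l\<close> g show ?thesis by (auto simp: paths_def nn_adj_def)
    qed (use \<open>\<gamma> = a # l\<close> g in \<open>auto simp: paths_def\<close>)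
  qed (use g in \<open>auto simp: paths_def\<close>)
  moreover have "[x] \<in> paths {x} x x" by (simp add: paths_def)
  ultimately have "paths {x} x x = {[x]}" by blast
  then show ?thesis by (simp add: G_def weight_def num_edges_def path_weight_Cons)
qed

text \<open>The Simon-Lieb inequality: a path that does not stay in \<open>S\<close> is cut at its
  first edge leaving \<open>S\<close>, and the repulsion between the two pieces is dropped. The
  hypothesis on \<open>x\<close> makes the first piece nonempty.\<close>

lemma G_first_exit:
  fixes x y :: "int ^ 'd::finite"
  assumes "x \<in> S"
  shows "G \<Lambda> x y \<le> G S x y + (\<Sum>\<^sub>\<infinity>(u, z)\<in>out_edges S. G S x u * b * G \<Lambda> z y)"
proof -
  let ?P = "paths \<Lambda> x y" and ?A = "paths S x y"
  let ?Q = "Sigma (out_edges S) (\<lambda>(u, z). paths S x u \<times> paths \<Lambda> z y)"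
  let ?tw = "takeWhile (\<lambda>v. v \<in> S)" and ?dw = "dropWhile (\<lambda>v. v \<in> S)"
  have in_Q: "?dw \<gamma> \<noteq> [] \<and> ?tw \<gamma> \<noteq> [] \<and> ((last (?tw \<gamma>), hd (?dw \<gamma>)), (?tw \<gamma>, ?dw \<gamma>)) \<in> ?Q"
    if g: "\<gamma> \<in> ?P - ?A" for \<gamma>
  proof -
    have ne: "\<gamma> \<noteq> []" "hd \<gamma> = x" "last \<gamma> = y" "successively nn_adj \<gamma>" "set \<gamma> \<subseteq> \<Lambda>"
      and "\<not> set \<gamma> \<subseteq> S" using g by (auto simp: paths_def)
    then have dw: "?dw \<gamma> \<noteq> []" by auto
    have tw: "?tw \<gamma> \<noteq> []" using ne assms by (cases \<gamma>) auto
    have succ: "successively nn_adj (?tw \<gamma> @ ?dw \<gamma>)" using ne by simp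
    have sub: "set (?tw \<gamma>) \<subseteq> S" by (auto dest: set_takeWhileD)
    have hd: "hd (?tw \<gamma>) = x" using ne tw by (cases \<gamma>) (auto split: if_splits)
    have last: "last (?dw \<gamma>) = y"
      using ne dw by (metis last_appendR takeWhile_dropWhile_id)
    have subL: "set (?dw \<gamma>) \<subseteq> \<Lambda>" using ne by (meson set_dropWhileD subset_iff)
    have "hd (?dw \<gamma>) \<notin> S" using dw hd_dropWhile by blast
    moreover have "last (?tw \<gamma>) \<in> S" using sub tw by auto
    moreover have "successively nn_adj (?tw \<gamma>)" "successively nn_adj (?dw \<gamma>)"
      "nn_adj (last (?tw \<gamma>)) (hd (?dw \<gamma>))"
      using succ dw tw unfolding successively_append_iff by blast+
    ultimately show ?thesis using dw tw sub hd last subL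
      by (simp add: out_edges_def paths_def)
  qed
  have "infsum weight (?P - ?A) \<le> (\<Sum>\<^sub>\<infinity>(e, g)\<in>?Q. weight (fst g) * b * weight (snd g))"
  proof (rule infsum_ennreal_inj_le[where h = "\<lambda>\<gamma>. ((last (?tw \<gamma>), hd (?dw \<gamma>)), (?tw \<gamma>, ?dw \<gamma>))"])
    show "inj_on (\<lambda>\<gamma>. ((last (?tw \<gamma>), hd (?dw \<gamma>)), (?tw \<gamma>, ?dw \<gamma>))) (?P - ?A)"
      by (rule inj_onI) (metis prod.inject takeWhile_dropWhile_id)
    show "weight \<gamma> \<le> (case ((last (?tw \<gamma>), hd (?dw \<gamma>)), (?tw \<gamma>, ?dw \<gamma>)) of
        (e, g) \<Rightarrow> weight (fst g) * b * weight (snd g))" if "\<gamma> \<in> ?P - ?A" for \<gamma>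
      using weight_append_le[of "?tw \<gamma>" "?dw \<gamma>"] in_Q[OF that] by simp
  qed (use in_Q in blast)
  also have "\<dots> = (\<Sum>\<^sub>\<infinity>e\<in>out_edges S.
      \<Sum>\<^sub>\<infinity>g\<in>(case e of (u, z) \<Rightarrow> paths S x u \<times> paths \<Lambda> z y). weight (fst g) * b * weight (snd g))"
    by (rule infsum_ennreal_Sigma)
  also have "\<dots> = (\<Sum>\<^sub>\<infinity>(u, z)\<in>out_edges S. G S x u * b * G \<Lambda> z y)"
  proof (rule infsum_cong, clarify)
    fix u z
    have "(\<Sum>\<^sub>\<infinity>g\<in>paths S x u \<times> paths \<Lambda> z y. weight (fst g) * b * weight (snd g)) =
       (\<Sum>\<^sub>\<infinity>(g, h)\<in>paths S x u \<times> paths \<Lambda> z y. (weight g * b) * weight h)"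
      by (simp add: case_prod_unfold)
    also have "\<dots> = (\<Sum>\<^sub>\<infinity>g\<in>paths S x u. weight g * b) * G \<Lambda> z y"
      by (subst infsum_ennreal_times) (simp add: G_def)
    also have "(\<Sum>\<^sub>\<infinity>g\<in>paths S x u. weight g * b) = G S x u * b"
      by (subst infsum_ennreal_multc) (simp add: G_def)
    finally show "(\<Sum>\<^sub>\<infinity>g\<in>paths S x u \<times> paths \<Lambda> z y. weight (fst g) * b * weight (snd g)) =
        G S x u * b * G \<Lambda> z y" .
  qed
  finally have 1: "infsum weight (?P - ?A) \<le> (\<Sum>\<^sub>\<infinity>(u, z)\<in>out_edges S. G S x u * b * G \<Lambda> z y)" .
  have "G \<Lambda> x y \<le> infsum weight (?A \<union> (?P - ?A))"
    unfolding G_def by (rule infsum_ennreal_mono_set) auto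
  also have "\<dots> = G S x y + infsum weight (?P - ?A)"
    unfolding G_def by (rule infsum_Un_disjoint) (auto intro: nonneg_summable_on_complete)
  finally show ?thesis using 1 by (meson add_left_mono order_trans)
qed

text \<open>A path together with one of its visits to \<open>v\<close> is determined by the prefix
  and the suffix at that visit; the left side counts a path once for each visit.\<close>

lemma G_visits_le:
  "(\<Sum>\<^sub>\<infinity>\<gamma>\<in>paths \<Lambda> x y. of_nat (count_list \<gamma> v) * weight \<gamma>) \<le> G \<Lambda> x v * G \<Lambda> v y"
proof -
  let ?I = "\<lambda>\<gamma>. {i. i < length \<gamma> \<and> v = \<gamma> ! i}"
  have count: "of_nat (count_list \<gamma> v) * weight \<gamma> = (\<Sum>\<^sub>\<infinity>i\<in>?I \<gamma>. weight \<gamma>)" for \<gamma>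
  proof -
    have "(\<Sum>\<^sub>\<infinity>i\<in>?I \<gamma>. weight \<gamma>) = of_nat (card (?I \<gamma>)) * weight \<gamma>" by simp
    then show ?thesis by (simp add: count_list_eq_length_filter length_filter_conv_card)
  qed
  have "(\<Sum>\<^sub>\<infinity>\<gamma>\<in>paths \<Lambda> x y. of_nat (count_list \<gamma> v) * weight \<gamma>) =
      (\<Sum>\<^sub>\<infinity>(\<gamma>, i)\<in>Sigma (paths \<Lambda> x y) ?I. weight \<gamma>)"
    by (subst infsum_ennreal_Sigma) (simp only: count)
  also have "\<dots> \<le> (\<Sum>\<^sub>\<infinity>(g, h)\<in>paths \<Lambda> x v \<times> paths \<Lambda> v y. weight g * weight h)"
  proof (rule infsum_ennreal_inj_le[where h = "\<lambda>(\<gamma>, i). (take (Suc i) \<gamma>, drop i \<gamma>)"])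
    show "inj_on (\<lambda>(\<gamma>, i). (take (Suc i) \<gamma>, drop i \<gamma>)) (Sigma (paths \<Lambda> x y) ?I)"
    proof (rule inj_onI, clarify)
      fix \<gamma> i \<delta> j
      assume "i < length \<gamma>" "j < length \<delta>"
        and eq: "take (Suc i) \<gamma> = take (Suc j) \<delta>" "drop i \<gamma> = drop j \<delta>"
      then have ij: "i = j" by (metis length_take min.absorb2 Suc_leI Suc_inject)
      then have "take i \<gamma> = take i \<delta>" using eq(1)
        by (metis le_add2 min.absorb1 plus_1_eq_Suc take_take)
      then show "\<gamma> = \<delta> \<and> i = j" using eq(2) ij by (metis append_take_drop_id)
    qed
  qed (use paths_vertex_split in \<open>auto intro!: weight_vertex_split\<close>)
  also have "\<dots> = G \<Lambda> x v * G \<Lambda> v y"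
    unfolding G_def by (rule infsum_ennreal_times)
  finally show ?thesis .
qed

text \<open>At a minimum of \<open>f\<close> both halves of the path stay above the level of the
  cutting point \<open>w\<close>. A path may attain its minimum several times; any choice works,
  because the two halves determine the path and only an upper bound is claimed.\<close>

lemma G_min_level:
  fixes f :: "int ^ 'd::finite \<Rightarrow> int"
  shows "G \<Lambda> x y \<le> (\<Sum>\<^sub>\<infinity>w\<in>{w\<in>\<Lambda>. f w \<le> f x \<and> f w \<le> f y}.
    G {v. f w \<le> f v} x w * G {v. f w \<le> f v} w y)"
proof -
  define k where "k \<gamma> = (SOME i. i < length \<gamma> \<and> (\<forall>v\<in>set \<gamma>. f (\<gamma> ! i) \<le> f v))" for \<gamma>
  have k: "k \<gamma> < length \<gamma>" "\<And>v. v \<in> set \<gamma> \<Longrightarrow> f (\<gamma> ! k \<gamma>) \<le> f v" if "\<gamma> \<noteq> []" for \<gamma>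
  proof -
    have "\<exists>v\<in>set \<gamma>. \<forall>w\<in>set \<gamma>. f v \<le> f w"
      using that arg_min_if_finite(1)[of "set \<gamma>" f] arg_min_least[of "set \<gamma>" _ f] by blast
    then have "\<exists>i. i < length \<gamma> \<and> (\<forall>v\<in>set \<gamma>. f (\<gamma> ! i) \<le> f v)" by (metis in_set_conv_nth)
    then have "k \<gamma> < length \<gamma> \<and> (\<forall>v\<in>set \<gamma>. f (\<gamma> ! k \<gamma>) \<le> f v)"
      unfolding k_def by (rule someI_ex)
    then show "k \<gamma> < length \<gamma>" "\<And>v. v \<in> set \<gamma> \<Longrightarrow> f (\<gamma> ! k \<gamma>) \<le> f v" by auto
  qed
  let ?W = "{w\<in>\<Lambda>. f w \<le> f x \<and> f w \<le> f y}"
  let ?H = "\<lambda>w. {v. f w \<le> f v}"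
  have sub: "\<gamma> \<in> paths (?H (\<gamma> ! k \<gamma>)) x y \<and> \<gamma> ! k \<gamma> \<in> ?W" if "\<gamma> \<in> paths \<Lambda> x y" for \<gamma>
  proof -
    have "\<gamma> \<noteq> []" using that by (auto simp: paths_def)
    with that k[of \<gamma>] show ?thesis
      by (auto simp: paths_def hd_in_set last_in_set subset_iff)
  qed
  have split: "take (Suc (k \<gamma>)) \<gamma> \<in> paths (?H (\<gamma> ! k \<gamma>)) x (\<gamma> ! k \<gamma>)"
    "drop (k \<gamma>) \<gamma> \<in> paths (?H (\<gamma> ! k \<gamma>)) (\<gamma> ! k \<gamma>) y" "k \<gamma> < length \<gamma>"
    if "\<gamma> \<in> paths \<Lambda> x y" for \<gamma>
  proof -
    have "\<gamma> \<noteq> []" using that by (auto simp: paths_def)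
    then show "k \<gamma> < length \<gamma>" by (rule k)
    then show "take (Suc (k \<gamma>)) \<gamma> \<in> paths (?H (\<gamma> ! k \<gamma>)) x (\<gamma> ! k \<gamma>)"
      "drop (k \<gamma>) \<gamma> \<in> paths (?H (\<gamma> ! k \<gamma>)) (\<gamma> ! k \<gamma>) y"
      using sub[OF that] paths_vertex_split by blast+
  qed
  have "G \<Lambda> x y \<le> (\<Sum>\<^sub>\<infinity>(w, g)\<in>Sigma ?W (\<lambda>w. paths (?H w) x w \<times> paths (?H w) w y).
      weight (fst g) * weight (snd g))"
    unfolding G_def
  proof (rule infsum_ennreal_inj_le
      [where h = "\<lambda>\<gamma>. (\<gamma> ! k \<gamma>, (take (Suc (k \<gamma>)) \<gamma>, drop (k \<gamma>) \<gamma>))"])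
    show "inj_on (\<lambda>\<gamma>. (\<gamma> ! k \<gamma>, take (Suc (k \<gamma>)) \<gamma>, drop (k \<gamma>) \<gamma>)) (paths \<Lambda> x y)"
    proof (rule inj_onI, clarify)
      fix \<gamma> \<delta> assume g: "\<gamma> \<in> paths \<Lambda> x y" "\<delta> \<in> paths \<Lambda> x y"
        and eq: "take (Suc (k \<gamma>)) \<gamma> = take (Suc (k \<delta>)) \<delta>" "drop (k \<gamma>) \<gamma> = drop (k \<delta>) \<delta>"
      have "k \<gamma> < length \<gamma>" "k \<delta> < length \<delta>" using split g by auto
      then have ij: "k \<gamma> = k \<delta>" using eq(1) by (metis length_take min.absorb2 Suc_leI Suc_inject)
      then have "take (k \<gamma>) \<gamma> = take (k \<gamma>) \<delta>" using eq(1)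
        by (metis le_add2 min.absorb1 plus_1_eq_Suc take_take)
      then show "\<gamma> = \<delta>" using eq(2) ij by (metis append_take_drop_id)
    qed
  qed (use split sub in \<open>auto intro!: weight_vertex_split\<close>)
  also have "\<dots> = (\<Sum>\<^sub>\<infinity>w\<in>?W. \<Sum>\<^sub>\<infinity>(g, h)\<in>paths (?H w) x w \<times> paths (?H w) w y. weight g * weight h)"
    by (subst infsum_ennreal_Sigma) (simp add: case_prod_unfold)
  also have "\<dots> = (\<Sum>\<^sub>\<infinity>w\<in>?W. G (?H w) x w * G (?H w) w y)"
    by (simp only: infsum_ennreal_times G_def)
  finally show ?thesis .
qed

text \<open>The converse of the Simon-Lieb inequality: a path in \<open>S\<close> ending at
  \<open>u\<close> and a path starting at \<open>z \<notin> S\<close> are glued, and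
  \<open>takeWhile\<close> recovers the pieces, so no path is produced twice. The gluing defect
  counts coincidences \<open>v\<close>; cutting both pieces at \<open>v\<close> leaves a walk from
  \<open>x\<close> to \<open>v\<close>, a loop at \<open>v\<close> through the edge
  \<open>(u, z)\<close>, and a walk from \<open>v\<close> to \<open>y\<close>.\<close>

lemma G_first_exit_reversed:
  fixes x y :: "int ^ 'd::finite"
  assumes "S \<subseteq> \<Lambda>"
  shows "(\<Sum>\<^sub>\<infinity>(u, z)\<in>out_edges S. G S x u * b * G \<Lambda> z y) \<le>
    G \<Lambda> x y + ennreal lam * (\<Sum>\<^sub>\<infinity>v\<in>S. G S x v *
      (\<Sum>\<^sub>\<infinity>(u, z)\<in>out_edges S. G S v u * b * G \<Lambda> z v) * G \<Lambda> v y)"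
proof -
  let ?P = "\<lambda>(u, z). paths S x u \<times> paths \<Lambda> z y"
  let ?Q = "Sigma (out_edges S) ?P"
  let ?w = "\<lambda>g. weight (fst g) * b * weight (snd g) :: ennreal"
  let ?c = "\<lambda>v g. of_nat (count_list g v) :: ennreal"
  have prod_sum: "(\<Sum>\<^sub>\<infinity>g\<in>A \<times> B. f (fst g) * b * h (snd g)) = infsum f A * b * infsum h B"
    for f h :: "(int ^ 'd) list \<Rightarrow> ennreal" and A B
  proof -
    have "(\<Sum>\<^sub>\<infinity>g\<in>A \<times> B. f (fst g) * b * h (snd g)) = (\<Sum>\<^sub>\<infinity>(g, g')\<in>A \<times> B. (f g * b) * h g')"
      by (simp add: case_prod_unfold)
    then show ?thesis by (simp only: infsum_ennreal_times infsum_ennreal_multc)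
  qed
  have in_Q: "fst g \<noteq> [] \<and> snd g \<noteq> [] \<and> fst g @ snd g \<in> paths \<Lambda> x y \<and> set (fst g) \<subseteq> S \<and>
      takeWhile (\<lambda>v. v \<in> S) (fst g @ snd g) = fst g \<and>
      last (fst g) = fst e \<and> hd (snd g) = snd e"
    if "(e, g) \<in> ?Q" for e g
  proof -
    obtain u z where e: "e = (u, z)" by (cases e)
    have g: "fst g \<in> paths S x u" "snd g \<in> paths \<Lambda> z y" "(u, z) \<in> out_edges S"
      using that e by (auto simp: mem_Times_iff)
    have "takeWhile (\<lambda>v. v \<in> S) (fst g @ snd g) = fst g @ takeWhile (\<lambda>v. v \<in> S) (snd g)"
      using g by (intro takeWhile_append2) (auto simp: paths_def)
    moreover have "takeWhile (\<lambda>v. v \<in> S) (snd g) = []"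
      using g by (cases "snd g") (auto simp: paths_def out_edges_def)
    ultimately show ?thesis using g e assms
      by (auto simp: paths_def out_edges_def successively_append_iff)
  qed
  have "(\<Sum>\<^sub>\<infinity>(u, z)\<in>out_edges S. G S x u * b * G \<Lambda> z y) = (\<Sum>\<^sub>\<infinity>e\<in>out_edges S. \<Sum>\<^sub>\<infinity>g\<in>?P e. ?w g)"
    by (rule infsum_cong) (auto simp: prod_sum G_def)
  also have "\<dots> = (\<Sum>\<^sub>\<infinity>(e, g)\<in>?Q. ?w g)" by (rule infsum_ennreal_Sigma[symmetric])
  also have "\<dots> \<le> (\<Sum>\<^sub>\<infinity>p\<in>?Q. weight (fst (snd p) @ snd (snd p)) +
      ennreal lam * (of_nat (crossings (fst (snd p)) (snd (snd p))) * ?w (snd p)))"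
    unfolding case_prod_unfold
    by (rule infsum_ennreal_mono, rule weight_append_ge) (use in_Q in fastforce)+
  also have "\<dots> = (\<Sum>\<^sub>\<infinity>p\<in>?Q. weight (fst (snd p) @ snd (snd p))) +
      (\<Sum>\<^sub>\<infinity>p\<in>?Q. ennreal lam * (of_nat (crossings (fst (snd p)) (snd (snd p))) * ?w (snd p)))"
    by (rule infsum_add) (auto intro: nonneg_summable_on_complete)
  also have "(\<Sum>\<^sub>\<infinity>p\<in>?Q. ennreal lam * (of_nat (crossings (fst (snd p)) (snd (snd p))) * ?w (snd p))) =
      ennreal lam * (\<Sum>\<^sub>\<infinity>p\<in>?Q. of_nat (crossings (fst (snd p)) (snd (snd p))) * ?w (snd p))"
    by (rule infsum_ennreal_cmult)
  finally have main: "(\<Sum>\<^sub>\<infinity>(u, z)\<in>out_edges S. G S x u * b * G \<Lambda> z y) \<le>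
      (\<Sum>\<^sub>\<infinity>p\<in>?Q. weight (fst (snd p) @ snd (snd p))) +
      ennreal lam * (\<Sum>\<^sub>\<infinity>p\<in>?Q. of_nat (crossings (fst (snd p)) (snd (snd p))) * ?w (snd p))" .
  have glue: "(\<Sum>\<^sub>\<infinity>p\<in>?Q. weight (fst (snd p) @ snd (snd p))) \<le> G \<Lambda> x y"
    unfolding G_def
  proof (rule infsum_ennreal_inj_le[where h = "\<lambda>p. fst (snd p) @ snd (snd p)"])
    show "inj_on (\<lambda>p. fst (snd p) @ snd (snd p)) ?Q"
    proof (rule inj_onI)
      fix p q assume p: "p \<in> ?Q" and q: "q \<in> ?Q"
        and eq: "fst (snd p) @ snd (snd p) = fst (snd q) @ snd (snd q)"
      have p': "(fst p, snd p) \<in> ?Q" and q': "(fst q, snd q) \<in> ?Q" using p q by simp_all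
      have 1: "fst (snd p) = fst (snd q)" using in_Q[OF p'] in_Q[OF q'] eq by metis
      then have 2: "snd (snd p) = snd (snd q)" using eq by simp
      have "fst p = fst q" using in_Q[OF p'] in_Q[OF q'] 1 2 by (metis prod_eqI)
      then show "p = q" using 1 2 by (simp add: prod_eq_iff)
    qed
  qed (use in_Q in fastforce)+
  have "(\<Sum>\<^sub>\<infinity>p\<in>?Q. of_nat (crossings (fst (snd p)) (snd (snd p))) * ?w (snd p)) =
      (\<Sum>\<^sub>\<infinity>p\<in>?Q. \<Sum>\<^sub>\<infinity>v\<in>S. ?c v (fst (snd p)) * ?c v (snd (snd p)) * ?w (snd p))"
  proof (rule infsum_cong)
    fix p assume p: "p \<in> ?Q"
    then have p': "(fst p, snd p) \<in> ?Q" by simp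
    have "set (fst (snd p)) \<subseteq> S" using in_Q[OF p'] by simp
    then show "of_nat (crossings (fst (snd p)) (snd (snd p))) * ?w (snd p) =
       (\<Sum>\<^sub>\<infinity>v\<in>S. ?c v (fst (snd p)) * ?c v (snd (snd p)) * ?w (snd p))"
      by (subst crossings_eq_infsum, assumption) (rule infsum_ennreal_multc[symmetric])
  qed
  also have "\<dots> = (\<Sum>\<^sub>\<infinity>v\<in>S. \<Sum>\<^sub>\<infinity>p\<in>?Q. ?c v (fst (snd p)) * ?c v (snd (snd p)) * ?w (snd p))"
    by (rule infsum_ennreal_swap)
  also have "\<dots> = (\<Sum>\<^sub>\<infinity>v\<in>S. \<Sum>\<^sub>\<infinity>(e, g)\<in>?Q. ?c v (fst g) * ?c v (snd g) * ?w g)"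
    by (simp add: case_prod_unfold)
  also have "\<dots> = (\<Sum>\<^sub>\<infinity>v\<in>S. \<Sum>\<^sub>\<infinity>e\<in>out_edges S. \<Sum>\<^sub>\<infinity>g\<in>?P e. ?c v (fst g) * ?c v (snd g) * ?w g)"
    by (simp only: infsum_ennreal_Sigma)
  also have "\<dots> \<le> (\<Sum>\<^sub>\<infinity>v\<in>S. G S x v * (\<Sum>\<^sub>\<infinity>(u, z)\<in>out_edges S. G S v u * b * G \<Lambda> z v) * G \<Lambda> v y)"
  proof (rule infsum_ennreal_mono)
    fix v
    have "(\<Sum>\<^sub>\<infinity>e\<in>out_edges S. \<Sum>\<^sub>\<infinity>g\<in>?P e. ?c v (fst g) * ?c v (snd g) * ?w g) \<le>
        (\<Sum>\<^sub>\<infinity>e\<in>out_edges S. (case e of (u, z) \<Rightarrow> G S v u * b * G \<Lambda> z v) * (G S x v * G \<Lambda> v y))"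
    proof (rule infsum_ennreal_mono, clarify)
      fix u z assume "(u, z) \<in> out_edges S"
      have "(\<Sum>\<^sub>\<infinity>g\<in>paths S x u \<times> paths \<Lambda> z y. ?c v (fst g) * ?c v (snd g) * ?w g) =
        (\<Sum>\<^sub>\<infinity>g\<in>paths S x u \<times> paths \<Lambda> z y. (?c v (fst g) * weight (fst g)) * b * (?c v (snd g) * weight (snd g)))"
        by (simp add: mult_ac)
      also have "\<dots> = (\<Sum>\<^sub>\<infinity>g\<in>paths S x u. ?c v g * weight g) * b *
          (\<Sum>\<^sub>\<infinity>g\<in>paths \<Lambda> z y. ?c v g * weight g)"
        by (rule prod_sum)
      also have "\<dots> \<le> (G S x v * G S v u) * b * (G \<Lambda> z v * G \<Lambda> v y)"
        by (intro mult_mono G_visits_le) auto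
      also have "\<dots> = G S v u * b * G \<Lambda> z v * (G S x v * G \<Lambda> v y)" by (simp add: mult_ac)
      finally show "(\<Sum>\<^sub>\<infinity>g\<in>paths S x u \<times> paths \<Lambda> z y. ?c v (fst g) * ?c v (snd g) * ?w g) \<le>
        G S v u * b * G \<Lambda> z v * (G S x v * G \<Lambda> v y)" .
    qed
    also have "\<dots> = G S x v * (\<Sum>\<^sub>\<infinity>(u, z)\<in>out_edges S. G S v u * b * G \<Lambda> z v) * G \<Lambda> v y"
      by (subst infsum_ennreal_multc) (simp add: mult_ac)
    finally show "(\<Sum>\<^sub>\<infinity>e\<in>out_edges S. \<Sum>\<^sub>\<infinity>g\<in>?P e. ?c v (fst g) * ?c v (snd g) * ?w g) \<le>
       G S x v * (\<Sum>\<^sub>\<infinity>(u, z)\<in>out_edges S. G S v u * b * G \<Lambda> z v) * G \<Lambda> v y" .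
  qed
  finally show ?thesis
    using main glue by (meson add_mono mult_left_mono order_trans zero_le)
qed

end

section \<open>Half-spaces\<close>

lemma nn_adj_iff: "nn_adj y z \<longleftrightarrow> (\<exists>j s. \<bar>s\<bar> = 1 \<and> z = y + axis j s)"
proof
  assume "nn_adj y z"
  then have sum: "(\<Sum>j\<in>UNIV. \<bar>z $ j - y $ j\<bar>) = 1" by (simp add: nn_adj_def abs_minus_commute)
  then obtain j where j: "z $ j - y $ j \<noteq> 0"
    by (metis (no_types, lifting) abs_0 sum.neutral zero_neq_one)
  have split: "(\<Sum>k\<in>UNIV. \<bar>z $ k - y $ k\<bar>) = \<bar>z $ j - y $ j\<bar> + (\<Sum>k\<in>UNIV - {j}. \<bar>z $ k - y $ k\<bar>)"
    by (rule sum.remove) auto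
  have nonneg: "0 \<le> (\<Sum>k\<in>UNIV - {j}. \<bar>z $ k - y $ k\<bar>)" by (rule sum_nonneg) simp
  have a: "\<bar>z $ j - y $ j\<bar> = 1" and "(\<Sum>k\<in>UNIV - {j}. \<bar>z $ k - y $ k\<bar>) = 0"
    using sum split nonneg j by linarith+
  then have "\<forall>k\<in>UNIV - {j}. \<bar>z $ k - y $ k\<bar> = 0"
    by (subst (asm) sum_nonneg_eq_0_iff) auto
  then have "z = y + axis j (z $ j - y $ j)"
    by (auto simp: vec_eq_iff axis_def)
  then show "\<exists>j s. \<bar>s\<bar> = 1 \<and> z = y + axis j s" using a by blast
next
  assume "\<exists>j s. \<bar>s\<bar> = 1 \<and> z = y + axis j s"
  then obtain j s where js: "\<bar>s\<bar> = 1" "z = y + axis j s" by blast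
  have "(\<Sum>k\<in>UNIV. \<bar>y $ k - z $ k\<bar>) = (\<Sum>k\<in>UNIV. if k = j then 1 else 0)"
    using js by (intro sum.cong) (auto simp: axis_def)
  then show "nn_adj y z" by (simp add: nn_adj_def)
qed

lemma nn_adj_level: "nn_adj y z \<Longrightarrow> \<bar>y $ i - z $ i\<bar> \<le> 1"
  by (auto simp: nn_adj_iff axis_def)

lemma abs_one_cases: "\<bar>s::int\<bar> = 1 \<longleftrightarrow> s = 1 \<or> s = -1" by auto

text \<open>For signs \<open>e k\<close> and a bijection \<open>p\<close> these are the
  automorphisms of the nearest-neighbour graph: a signed permutation followed by a
  translation.\<close>

definition lattice_sym :: "('d \<Rightarrow> int) \<Rightarrow> ('d \<Rightarrow> 'd) \<Rightarrow> int ^ 'd \<Rightarrow> int ^ 'd \<Rightarrow> int ^ 'd::finite" where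
  "lattice_sym e p t y = (\<chi> k. e k * y $ p k + t $ k)"

lemma lattice_sym:
  assumes e: "\<And>k. \<bar>e k\<bar> = 1" and p: "bij p"
  shows "inj (lattice_sym e p t)" "nn_adj (lattice_sym e p t y) (lattice_sym e p t z) \<longleftrightarrow> nn_adj y z"
proof -
  have e0: "e k \<noteq> 0" for k using e[of k] by auto
  show "inj (lattice_sym e p t)"
  proof (rule injI)
    fix y z assume "lattice_sym e p t y = lattice_sym e p t z"
    then have eq: "y $ p k = z $ p k" for k using e0 by (auto simp: lattice_sym_def vec_eq_iff)
    show "y = z"
      unfolding vec_eq_iff
    proof
      fix k show "y $ k = z $ k" using eq[of "inv p k"] p by (simp add: bij_def surj_f_inv_f)
    qed
  qed
  have "(\<Sum>k\<in>UNIV. \<bar>lattice_sym e p t y $ k - lattice_sym e p t z $ k\<bar>) =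
     (\<Sum>k\<in>UNIV. \<bar>y $ p k - z $ p k\<bar>)"
  proof (rule sum.cong[OF refl])
    fix k
    have "lattice_sym e p t y $ k - lattice_sym e p t z $ k = e k * (y $ p k - z $ p k)"
      by (simp add: lattice_sym_def algebra_simps)
    then show "\<bar>lattice_sym e p t y $ k - lattice_sym e p t z $ k\<bar> = \<bar>y $ p k - z $ p k\<bar>"
      using e[of k] by (simp add: abs_mult)
  qed
  also have "\<dots> = (\<Sum>k\<in>UNIV. \<bar>y $ k - z $ k\<bar>)"
    using p by (rule sum.reindex_bij_betw)
  finally show "nn_adj (lattice_sym e p t y) (lattice_sym e p t z) \<longleftrightarrow> nn_adj y z"
    by (simp add: nn_adj_def)
qed

lemma two_point_translate:
  "two_point lam \<beta> ((+) t ` \<Lambda>) (t + x) (t + y) = two_point lam \<beta> \<Lambda> x y"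
  by (rule two_point_image) (auto simp: nn_adj_def)

text \<open>For \<open>s = -1\<close> this is an upper bound on the coordinate. With both signs and
  every integer \<open>c\<close> the family is closed under translations, and its intersections
  include quarter-spaces and cubes. The boundary layer \<open>s * y $ i = c\<close> lies
  inside.\<close>

definition hs :: "'d \<Rightarrow> int \<Rightarrow> int \<Rightarrow> (int ^ 'd::finite) set" where
  "hs i s c = {y. c \<le> s * y $ i}"

lemma two_point_hs_translate:
  "two_point lam \<beta> (hs i s (c + s * t $ i)) (t + x) (t + y) = two_point lam \<beta> (hs i s c) x y"
proof -
  have "hs i s (c + s * t $ i) = (+) t ` hs i s c"
  proof (intro equalityI subsetI)
    fix y assume "y \<in> hs i s (c + s * t $ i)"
    then have "y - t \<in> hs i s c" by (simp add: hs_def algebra_simps)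
    then show "y \<in> (+) t ` hs i s c" by (metis add_diff_cancel_left' add.commute diff_add_cancel imageI)
  qed (auto simp: hs_def algebra_simps)
  then show ?thesis by (simp add: two_point_translate)
qed

lemma two_point_UNIV_translate:
  "two_point lam \<beta> UNIV (t + x) (t + y) = two_point lam \<beta> UNIV x y"
  using two_point_translate[of lam \<beta> t UNIV x y] by (simp add: surj_plus)

section \<open>Sums of inverse powers\<close>

lemma sum_inverse_squares:
  fixes m :: real assumes "1 \<le> m"
  shows "(\<Sum>k<N. 1 / (m + real k) ^ 2) \<le> 2 / m"
proof -
  \<comment> \<open>Telescoping against \<open>1 / (a - 1 / 2) - 1 / (a + 1 / 2)\<close>; the
    initial value \<open>1 / (m - 1 / 2)\<close> is at most \<open>2 / m\<close> because
    \<open>1 \<le> m\<close>.\<close>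
  have "(\<Sum>k<N. 1 / (m + real k) ^ 2) \<le> 2 / m - 1 / (m + real N - 1 / 2)"
  proof (induction N)
    case 0 show ?case using assms by (simp add: field_simps)
  next
    case (Suc N)
    define a where "a = m + real N"
    have a: "1 \<le> a" using assms by (simp add: a_def)
    have "(a - 1 / 2) * (a + 1 / 2) \<le> a ^ 2" by (simp add: power2_eq_square algebra_simps)
    moreover have "0 < (a - 1 / 2) * (a + 1 / 2)" using a by (intro mult_pos_pos) auto
    ultimately have "1 / a ^ 2 \<le> 1 / ((a - 1 / 2) * (a + 1 / 2))"
      by (intro divide_left_mono mult_pos_pos) (use a in auto)
    also have "\<dots> = 1 / (a - 1 / 2) - 1 / (a + 1 / 2)"
      using a by (simp add: field_simps)
    finally show ?case using Suc by (simp add: a_def algebra_simps)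
  qed
  moreover have "0 \<le> 1 / (m + real N - 1 / 2)" using assms by simp
  ultimately show ?thesis by linarith
qed

text \<open>All but two powers are taken out at their smallest value \<open>m ^ (p - 2)\<close>.
  Summation costs one power: this is how the boundary exponent \<open>CARD('d) - 1\<close> becomes
  the bulk exponent \<open>CARD('d) - 2\<close>.\<close>

lemma infsum_inverse_powers:
  fixes m :: real
  assumes m: "1 \<le> m" and p: "2 \<le> p"
  shows "(\<Sum>\<^sub>\<infinity>k. ennreal (1 / (m + real k) ^ p)) \<le> ennreal (2 / m ^ (p - 1))"
proof (rule infsum_ennreal_leI)
  fix F :: "nat set" assume "finite F"
  then obtain N where N: "F \<subseteq> {..<N}" by (meson finite_nat_iff_bounded)
  have pw: "1 / (m + real k) ^ p \<le> (1 / m ^ (p - 2)) * (1 / (m + real k) ^ 2)" for k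
  proof -
    have "(m + real k) ^ p = (m + real k) ^ (p - 2) * (m + real k) ^ 2"
      using p by (metis le_add_diff_inverse2 power_add)
    moreover have "m ^ (p - 2) \<le> (m + real k) ^ (p - 2)" using m by (intro power_mono) auto
    ultimately show ?thesis using m
      by (simp add: divide_simps mult_right_mono)
  qed
  have "(\<Sum>k\<in>F. ennreal (1 / (m + real k) ^ p)) \<le> (\<Sum>k<N. ennreal (1 / (m + real k) ^ p))"
    using N by (intro sum_mono2) auto
  also have "\<dots> = ennreal (\<Sum>k<N. 1 / (m + real k) ^ p)" using m by (intro sum_ennreal) auto
  also have "\<dots> \<le> ennreal (2 / m ^ (p - 1))"
  proof (rule ennreal_leI)
    have "(\<Sum>k<N. 1 / (m + real k) ^ p) \<le> (\<Sum>k<N. (1 / m ^ (p - 2)) * (1 / (m + real k) ^ 2))"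
      by (rule sum_mono) (rule pw)
    also have "\<dots> = (1 / m ^ (p - 2)) * (\<Sum>k<N. 1 / (m + real k) ^ 2)"
      by (simp add: sum_distrib_left)
    also have "\<dots> \<le> (1 / m ^ (p - 2)) * (2 / m)"
      using m by (intro mult_left_mono sum_inverse_squares) auto
    also have "\<dots> = 2 / m ^ (p - 1)"
    proof -
      have "p - 1 = Suc (p - 2)" using p by simp
      then show ?thesis by simp
    qed
    finally show "(\<Sum>k<N. 1 / (m + real k) ^ p) \<le> 2 / m ^ (p - 1)" .
  qed
  finally show "(\<Sum>k\<in>F. ennreal (1 / (m + real k) ^ p)) \<le> ennreal (2 / m ^ (p - 1))" .
qed

section \<open>Consequences of the half-space bounds in the bulk and on levels\<close>

context wsaw begin

text \<open>The hypothesis that is propagated in \<beta>. The second part is restricted to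
  \<open>x\<close> inside the half-space, where the base of the power is at least 1; in the first
  part a starting point outside contributes 0.\<close>

definition half_space_bounds :: "'d::finite itself \<Rightarrow> real \<Rightarrow> real \<Rightarrow> bool" where
  "half_space_bounds _ A C \<longleftrightarrow> (\<forall>(i::'d) s c x. \<bar>s\<bar> = 1 \<longrightarrow>
     (\<Sum>\<^sub>\<infinity>y\<in>{y. s * y $ i = c}. G (hs i s c) x y) \<le> ennreal A \<and>
     (\<forall>y. s * y $ i = c \<and> c \<le> s * x $ i \<longrightarrow>
        G (hs i s c) x y \<le> ennreal (C / (real_of_int (s * x $ i - c) + 1) ^ (CARD('d) - 1))))"

end

locale bounded_wsaw = wsaw +
  fixes A C :: real and D :: "'d::finite itself"
  assumes AC: "0 \<le> A" "0 \<le> C"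
    and bounds: "half_space_bounds D A C"
    and dim: "CARD('d) > 4"
begin

lemma boundary_sum_le:
  fixes i :: 'd
  shows "\<bar>s\<bar> = 1 \<Longrightarrow> (\<Sum>\<^sub>\<infinity>y\<in>{y. s * y $ i = c}. G (hs i s c) x y) \<le> ennreal A"
  using bounds by (auto simp: half_space_bounds_def)

lemma boundary_point_le:
  fixes i :: 'd
  shows "\<bar>s\<bar> = 1 \<Longrightarrow> s * y $ i = c \<Longrightarrow> c \<le> s * x $ i \<Longrightarrow>
    G (hs i s c) x y \<le> ennreal (C / (real_of_int (s * x $ i - c) + 1) ^ (CARD('d) - 1))"
  using bounds by (auto simp: half_space_bounds_def)

text \<open>Translating along the boundary by \<open>u0 - u\<close> and reversing paths turns a sum
  over endpoints on the level \<open>c'\<close>, started at the boundary, into a sum over boundary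
  endpoints from the fixed point \<open>u0\<close> of that level.\<close>

lemma level_sum_from_boundary_le:
  fixes i :: 'd
  assumes s: "\<bar>s\<bar> = 1" and w: "s * w $ i = c"
  shows "(\<Sum>\<^sub>\<infinity>u\<in>{u. s * u $ i = c'}. G (hs i s c) w u) \<le> ennreal A"
proof -
  define u0 where "u0 = w + axis i (s * (c' - c))"
  have u0: "s * u0 $ i = c'"
    using w s by (auto simp: u0_def axis_def abs_one_cases)
  have "(\<Sum>\<^sub>\<infinity>u\<in>{u. s * u $ i = c'}. G (hs i s c) w u) \<le>
      (\<Sum>\<^sub>\<infinity>y\<in>{y. s * y $ i = c}. G (hs i s c) u0 y)"
  proof (rule infsum_ennreal_inj_le[where h = "\<lambda>u. w + (u0 - u)"])
    fix u :: "int ^ 'd" assume "u \<in> {u. s * u $ i = c'}"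
    then have u: "s * (u0 - u) $ i = 0" using u0 by (simp add: right_diff_distrib)
    have "G (hs i s c) w u = G (hs i s (c + s * (u0 - u) $ i)) ((u0 - u) + w) ((u0 - u) + u)"
      by (rule two_point_hs_translate[symmetric])
    also have "\<dots> = G (hs i s c) (w + (u0 - u)) u0" by (simp only: u) (simp add: add.commute)
    also have "\<dots> = G (hs i s c) u0 (w + (u0 - u))" by (rule two_point_sym)
    finally show "G (hs i s c) w u \<le> G (hs i s c) u0 (w + (u0 - u))" by simp
  next
    show "(\<lambda>u. w + (u0 - u)) ` {u. s * u $ i = c'} \<subseteq> {y. s * y $ i = c}"
    proof clarify
      fix u assume "c' = s * u $ i"
      then show "s * (w + (u0 - u)) $ i = c" using u0 w by (simp add: algebra_simps)
    qed
  qed (auto simp: inj_on_def)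
  also have "\<dots> \<le> ennreal A" by (rule boundary_sum_le[OF s])
  finally show ?thesis .
qed

lemma bulk_le:
  fixes x y :: "int ^ 'd"
  shows "G UNIV x y \<le> ennreal (2 * A * C / (real_of_int \<bar>x $ i - y $ i\<bar> + 1) ^ (CARD('d) - 2))"
proof -
  \<comment> \<open>Oriented so that \<open>x\<close> is the higher point, hence at distance at
    least \<open>n\<close> from the level of the minimum.\<close>
  define s :: int where "s = (if y $ i \<le> x $ i then 1 else -1)"
  have s: "\<bar>s\<bar> = 1" by (simp add: s_def)
  define f where "f v = s * v $ i" for v :: "int ^ 'd"
  define n where "n = real_of_int \<bar>x $ i - y $ i\<bar>"
  have n: "real_of_int (f x - f y) = n" "f y \<le> f x" by (auto simp: f_def s_def n_def)
  let ?H = "\<lambda>w. hs i s (f w)"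
  have H: "{v. f w \<le> f v} = ?H w" for w by (auto simp: hs_def f_def)
  have "G UNIV x y \<le> (\<Sum>\<^sub>\<infinity>w\<in>{w. f w \<le> f x \<and> f w \<le> f y}. G (?H w) x w * G (?H w) w y)"
    using G_min_level[of UNIV x y f] by (simp add: H)
  also have "\<dots> \<le> (\<Sum>\<^sub>\<infinity>k. \<Sum>\<^sub>\<infinity>w\<in>{w. f w = f y - int k}. G (?H w) x w * G (?H w) w y)"
  proof (rule infsum_ennreal_UN_le, clarify)
    fix w assume "f w \<le> f y"
    then show "w \<in> (\<Union>k. {w. f w = f y - int k})"
      by (auto intro!: exI[of _ "nat (f y - f w)"])
  qed
  also have "\<dots> \<le> (\<Sum>\<^sub>\<infinity>k. ennreal (1 / (n + 1 + real k) ^ (CARD('d) - 1)) * ennreal (A * C))"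
  proof (rule infsum_ennreal_mono)
    fix k :: nat
    let ?q = "ennreal (C * (1 / (n + 1 + real k) ^ (CARD('d) - 1)))"
    have "(\<Sum>\<^sub>\<infinity>w\<in>{w. f w = f y - int k}. G (?H w) x w * G (?H w) w y) \<le>
        (\<Sum>\<^sub>\<infinity>w\<in>{w. f w = f y - int k}. ?q * G (hs i s (f y - int k)) y w)"
    proof (rule infsum_ennreal_mono)
      fix w assume "w \<in> {w. f w = f y - int k}"
      then have w: "f w = f y - int k" by simp
      have "G (?H w) x w \<le> ennreal (C / (real_of_int (s * x $ i - f w) + 1) ^ (CARD('d) - 1))"
        using w n(2) by (intro boundary_point_le[OF s]) (auto simp: f_def)
      also have "real_of_int (s * x $ i - f w) + 1 = n + 1 + real k"
        using w n(1) by (simp add: f_def)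
      finally have "G (?H w) x w \<le> ?q" by simp
      then show "G (?H w) x w * G (?H w) w y \<le> ?q * G (hs i s (f y - int k)) y w"
        using w by (subst (2) two_point_sym) (simp add: mult_right_mono)
    qed
    also have "\<dots> = ?q * (\<Sum>\<^sub>\<infinity>w\<in>{w. f w = f y - int k}. G (hs i s (f y - int k)) y w)"
      by (rule infsum_ennreal_cmult)
    also have "\<dots> \<le> ?q * ennreal A"
      unfolding f_def by (intro mult_left_mono boundary_sum_le[OF s]) simp
    also have "\<dots> = ennreal (1 / (n + 1 + real k) ^ (CARD('d) - 1)) * ennreal (A * C)"
      using AC by (simp add: ennreal_mult[symmetric] n_def mult_ac)
    finally show "(\<Sum>\<^sub>\<infinity>w\<in>{w. f w = f y - int k}. G (?H w) x w * G (?H w) w y) \<le>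
       ennreal (1 / (n + 1 + real k) ^ (CARD('d) - 1)) * ennreal (A * C)" .
  qed
  also have "\<dots> = (\<Sum>\<^sub>\<infinity>k. ennreal (1 / (n + 1 + real k) ^ (CARD('d) - 1))) * ennreal (A * C)"
    by (rule infsum_ennreal_multc)
  also have "\<dots> \<le> ennreal (2 / (n + 1) ^ (CARD('d) - 1 - 1)) * ennreal (A * C)"
    using dim by (intro mult_right_mono infsum_inverse_powers) (auto simp: n_def)
  also have "\<dots> = ennreal (2 * A * C / (n + 1) ^ (CARD('d) - 2))"
    using AC by (simp add: ennreal_mult[symmetric] n_def mult_ac numeral_2_eq_2)
  finally show ?thesis by (simp add: n_def)
qed

text \<open>For a minimum \<open>w\<close> on a given level the sum over endpoints costs one factor
  \<open>A\<close> by \<open>level_sum_from_boundary_le\<close>, and the sum over \<open>w\<close> a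
  second one; there are \<open>k + 1\<close> levels between the boundary and the endpoints.\<close>

lemma level_sum_le:
  fixes i :: 'd
  assumes s: "\<bar>s\<bar> = 1"
  shows "(\<Sum>\<^sub>\<infinity>u\<in>{u. s * u $ i = c + int k}. G (hs i s c) x u) \<le> ennreal (A ^ 2 * real (k + 1))"
proof -
  define f where "f v = s * v $ i" for v :: "int ^ 'd"
  let ?H = "\<lambda>w. hs i s (f w)"
  let ?U = "{u. f u = c + int k}"
  have H: "{v. f w \<le> f v} = ?H w" for w by (auto simp: hs_def f_def)
  have "(\<Sum>\<^sub>\<infinity>u\<in>?U. G (hs i s c) x u) \<le>
     (\<Sum>\<^sub>\<infinity>u\<in>?U. \<Sum>\<^sub>\<infinity>w\<in>{w. c \<le> f w \<and> f w \<le> c + int k}. G (?H w) x w * G (?H w) w u)"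
  proof (rule infsum_ennreal_mono)
    fix u assume "u \<in> ?U"
    then have u: "f u = c + int k" by simp
    have "G (hs i s c) x u \<le> (\<Sum>\<^sub>\<infinity>w\<in>{w\<in>hs i s c. f w \<le> f x \<and> f w \<le> f u}. G (?H w) x w * G (?H w) w u)"
      using G_min_level[of "hs i s c" x u f] by (simp add: H)
    also have "\<dots> \<le> (\<Sum>\<^sub>\<infinity>w\<in>{w. c \<le> f w \<and> f w \<le> c + int k}. G (?H w) x w * G (?H w) w u)"
      by (rule infsum_ennreal_mono_set) (auto simp: hs_def u, auto simp: f_def)
    finally show "G (hs i s c) x u \<le>
      (\<Sum>\<^sub>\<infinity>w\<in>{w. c \<le> f w \<and> f w \<le> c + int k}. G (?H w) x w * G (?H w) w u)" .
  qed
  also have "\<dots> = (\<Sum>\<^sub>\<infinity>w\<in>{w. c \<le> f w \<and> f w \<le> c + int k}. \<Sum>\<^sub>\<infinity>u\<in>?U. G (?H w) x w * G (?H w) w u)"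
    by (rule infsum_ennreal_swap)
  also have "\<dots> = (\<Sum>\<^sub>\<infinity>w\<in>{w. c \<le> f w \<and> f w \<le> c + int k}. G (?H w) x w * (\<Sum>\<^sub>\<infinity>u\<in>?U. G (?H w) w u))"
    by (simp only: infsum_ennreal_cmult)
  also have "\<dots> \<le> (\<Sum>\<^sub>\<infinity>w\<in>{w. c \<le> f w \<and> f w \<le> c + int k}. G (?H w) x w * ennreal A)"
    by (intro infsum_ennreal_mono mult_left_mono)
       (auto simp: f_def intro!: level_sum_from_boundary_le[OF s])
  also have "\<dots> = (\<Sum>\<^sub>\<infinity>w\<in>{w. c \<le> f w \<and> f w \<le> c + int k}. G (?H w) x w) * ennreal A"
    by (rule infsum_ennreal_multc)
  also have "(\<Sum>\<^sub>\<infinity>w\<in>{w. c \<le> f w \<and> f w \<le> c + int k}. G (?H w) x w) \<le>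
      (\<Sum>\<^sub>\<infinity>j\<in>{..k}. \<Sum>\<^sub>\<infinity>w\<in>{w. f w = c + int j}. G (?H w) x w)"
  proof (rule infsum_ennreal_UN_le, clarify)
    fix w assume "c \<le> f w" "f w \<le> c + int k"
    then show "w \<in> (\<Union>j\<in>{..k}. {w. f w = c + int j})"
      by (auto intro!: bexI[of _ "nat (f w - c)"])
  qed
  also have "\<dots> \<le> (\<Sum>\<^sub>\<infinity>j\<in>{..k}. ennreal A)"
  proof (rule infsum_ennreal_mono)
    fix j
    have "(\<Sum>\<^sub>\<infinity>w\<in>{w. f w = c + int j}. G (?H w) x w) =
      (\<Sum>\<^sub>\<infinity>w\<in>{w. f w = c + int j}. G (hs i s (c + int j)) x w)"
      by (rule infsum_cong) simp
    also have "\<dots> \<le> ennreal A" unfolding f_def by (rule boundary_sum_le[OF s])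
    finally show "(\<Sum>\<^sub>\<infinity>w\<in>{w. f w = c + int j}. G (?H w) x w) \<le> ennreal A" .
  qed
  also have "(\<Sum>\<^sub>\<infinity>j\<in>{..k}. ennreal A) = ennreal (A * real (k + 1))"
    using AC by (simp add: ennreal_mult ennreal_of_nat_eq_real_of_nat mult.commute)
  finally show ?thesis unfolding f_def
    using AC by (simp add: ennreal_mult[symmetric] power2_eq_square mult_ac mult_right_mono)
qed

end

section \<open>Exit masses and the error in the reversed Simon-Lieb inequality\<close>

text \<open>Errors are bounded in terms of the number of defining half-spaces, so the family
  \<open>F\<close> is kept as the datum and not only its intersection.\<close>

definition hs_Inter :: "('d \<times> int \<times> int) set \<Rightarrow> (int ^ 'd::finite) set" where
  "hs_Inter F = (\<Inter>(i, s, c)\<in>F. hs i s c)"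

lemma hs_Inter_subset_hs: "(i, s, c) \<in> F \<Longrightarrow> hs_Inter F \<subseteq> hs i s c"
  by (auto simp: hs_Inter_def)

context wsaw begin

text \<open>The unnormalised expectation of \<open>g\<close> at the first vertex outside
  \<open>S\<close>. For \<open>x = 0\<close> and the constant function 1 it is
  \<open>phi\<close>.\<close>

definition exit_sum :: "(int ^ 'd::finite) set \<Rightarrow> int ^ 'd \<Rightarrow> (int ^ 'd \<Rightarrow> ennreal) \<Rightarrow> ennreal" where
  "exit_sum S x g = (\<Sum>\<^sub>\<infinity>(u, z)\<in>out_edges S. G S x u * b * g z)"

lemma exit_sum_mono:
  assumes "\<And>z. z \<notin> S \<Longrightarrow> g z \<le> h z"
  shows "exit_sum S x g \<le> exit_sum S x h"
  unfolding exit_sum_def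
  by (rule infsum_ennreal_mono) (auto simp: out_edges_def intro!: mult_left_mono assms)

lemma exit_sum_add: "exit_sum S x (\<lambda>z. g z + h z) = exit_sum S x g + exit_sum S x h"
proof -
  have "exit_sum S x (\<lambda>z. g z + h z) =
     (\<Sum>\<^sub>\<infinity>e\<in>out_edges S. G S x (fst e) * b * g (snd e) + G S x (fst e) * b * h (snd e))"
    by (simp add: exit_sum_def case_prod_unfold distrib_left)
  also have "\<dots> = exit_sum S x g + exit_sum S x h"
    unfolding exit_sum_def case_prod_unfold
    by (rule infsum_add) (auto intro: nonneg_summable_on_complete)
  finally show ?thesis .
qed

lemma exit_sum_multc: "exit_sum S x (\<lambda>z. g z * c) = exit_sum S x g * c"
proof -
  have "exit_sum S x (\<lambda>z. g z * c) = (\<Sum>\<^sub>\<infinity>e\<in>out_edges S. G S x (fst e) * b * g (snd e) * c)"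
    by (simp add: exit_sum_def case_prod_unfold mult.assoc)
  then show ?thesis
    unfolding exit_sum_def case_prod_unfold by (simp only: infsum_ennreal_multc)
qed

lemma exit_sum_infsum:
  fixes g :: "'a::countable \<Rightarrow> int ^ 'd::finite \<Rightarrow> ennreal"
  shows "(\<Sum>\<^sub>\<infinity>y\<in>Y. exit_sum S x (g y)) = exit_sum S x (\<lambda>z. \<Sum>\<^sub>\<infinity>y\<in>Y. g y z)"
proof -
  have "(\<Sum>\<^sub>\<infinity>y\<in>Y. exit_sum S x (g y)) =
      (\<Sum>\<^sub>\<infinity>e\<in>out_edges S. \<Sum>\<^sub>\<infinity>y\<in>Y. G S x (fst e) * b * g y (snd e))"
    unfolding exit_sum_def case_prod_unfold by (rule infsum_ennreal_swap)
  then show ?thesis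
    unfolding exit_sum_def case_prod_unfold by (simp only: infsum_ennreal_cmult)
qed

lemma first_exit: "x \<in> S \<Longrightarrow> G \<Lambda> x y \<le> G S x y + exit_sum S x (\<lambda>z. G \<Lambda> z y)"
  unfolding exit_sum_def by (rule G_first_exit)

lemma first_exit_outside: "x \<in> S \<Longrightarrow> y \<notin> S \<Longrightarrow> G \<Lambda> x y \<le> exit_sum S x (\<lambda>z. G \<Lambda> z y)"
  using first_exit[of x S \<Lambda> y] by (simp add: two_point_outside)

text \<open>The total weight of a walk from \<open>x\<close> to \<open>v\<close> followed by a loop
  at \<open>v\<close> that leaves \<open>S\<close>. The return ranges over the whole lattice, so the
  same quantity serves for every domain containing \<open>S\<close>.\<close>

definition loop_error :: "(int ^ 'd::finite) set \<Rightarrow> int ^ 'd \<Rightarrow> ennreal" where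
  "loop_error S x = (\<Sum>\<^sub>\<infinity>v\<in>S. G S x v * exit_sum S v (\<lambda>z. G UNIV z v))"

text \<open>In the error only the last factor involves \<open>y\<close>; a uniform bound
  \<open>m\<close> on it separates the geometry of \<open>S\<close> from the size of the two-point
  function.\<close>

lemma first_exit_reversed:
  assumes "S \<subseteq> \<Lambda>" "\<And>v. v \<in> S \<Longrightarrow> G \<Lambda> v y \<le> m"
  shows "exit_sum S x (\<lambda>z. G \<Lambda> z y) \<le> G \<Lambda> x y + ennreal lam * loop_error S x * m"
proof -
  have "exit_sum S x (\<lambda>z. G \<Lambda> z y) \<le> G \<Lambda> x y + ennreal lam *
     (\<Sum>\<^sub>\<infinity>v\<in>S. G S x v * exit_sum S v (\<lambda>z. G \<Lambda> z v) * G \<Lambda> v y)"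
    using G_first_exit_reversed[OF assms(1)] by (simp add: exit_sum_def)
  also have "(\<Sum>\<^sub>\<infinity>v\<in>S. G S x v * exit_sum S v (\<lambda>z. G \<Lambda> z v) * G \<Lambda> v y) \<le>
     (\<Sum>\<^sub>\<infinity>v\<in>S. G S x v * exit_sum S v (\<lambda>z. G UNIV z v) * m)"
    by (intro infsum_ennreal_mono mult_mono exit_sum_mono two_point_mono_set assms) auto
  also have "\<dots> = loop_error S x * m" unfolding loop_error_def by (rule infsum_ennreal_multc)
  finally show ?thesis by (simp add: add_left_mono mult_left_mono mult.assoc)
qed

lemma susceptibility_from: "(\<Sum>\<^sub>\<infinity>y. G UNIV x y) = susceptibility TYPE('d::finite) lam \<beta>"
  for x :: "int ^ 'd"
proof -
  have "(\<Sum>\<^sub>\<infinity>y. G UNIV x y) = (\<Sum>\<^sub>\<infinity>y. G UNIV x (x + y))"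
    by (rule infsum_reindex_bij_witness[where i = "\<lambda>y. x + y" and j = "\<lambda>y. y - x"]) auto
  also have "\<dots> = (\<Sum>\<^sub>\<infinity>y::int ^ 'd. G UNIV 0 y)"
    using two_point_UNIV_translate[of lam \<beta> x 0] by simp
  finally show ?thesis by (simp add: susceptibility_def)
qed

text \<open>By translation invariance each exit point \<open>z\<close> and each loop vertex
  \<open>v\<close> contributes the same factor \<open>chi\<close> once \<open>y\<close> is summed
  over. The zero-length path gives \<open>chi \<noteq> 0\<close>, so a finite \<open>chi\<close>
  cancels.\<close>

lemma exit_mass_le_loop_error:
  fixes x :: "int ^ 'd::finite"
  assumes fin: "susceptibility TYPE('d) lam \<beta> < \<infinity>"
  shows "exit_sum S x (\<lambda>_. 1) \<le> 1 + ennreal lam * loop_error S x"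
proof -
  define chi where "chi = susceptibility TYPE('d) lam \<beta>"
  have "1 \<le> G UNIV x x" by (rule G_refl_ge) simp
  also have "\<dots> \<le> chi"
    unfolding chi_def susceptibility_from[of x, symmetric] by (rule infsum_ennreal_member_le) simp
  finally have "chi \<noteq> 0" by auto
  have "exit_sum S x (\<lambda>_. 1) * chi = exit_sum S x (\<lambda>z. 1 * chi)"
    by (rule exit_sum_multc[symmetric])
  also have "\<dots> = exit_sum S x (\<lambda>z. \<Sum>\<^sub>\<infinity>y. G UNIV z y)"
    by (simp add: susceptibility_from chi_def)
  also have "\<dots> = (\<Sum>\<^sub>\<infinity>y. exit_sum S x (\<lambda>z. G UNIV z y))"
    by (rule exit_sum_infsum[symmetric])
  also have "\<dots> \<le> (\<Sum>\<^sub>\<infinity>y. G UNIV x y + ennreal lam *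
     (\<Sum>\<^sub>\<infinity>v\<in>S. G S x v * exit_sum S v (\<lambda>z. G UNIV z v) * G UNIV v y))"
    using G_first_exit_reversed[of S UNIV x] by (intro infsum_ennreal_mono) (simp add: exit_sum_def)
  also have "\<dots> = (\<Sum>\<^sub>\<infinity>y. G UNIV x y) + (\<Sum>\<^sub>\<infinity>y. ennreal lam *
     (\<Sum>\<^sub>\<infinity>v\<in>S. G S x v * exit_sum S v (\<lambda>z. G UNIV z v) * G UNIV v y))"
    by (rule infsum_add) (auto intro: nonneg_summable_on_complete)
  also have "(\<Sum>\<^sub>\<infinity>y. ennreal lam *
     (\<Sum>\<^sub>\<infinity>v\<in>S. G S x v * exit_sum S v (\<lambda>z. G UNIV z v) * G UNIV v y)) =
     ennreal lam * (\<Sum>\<^sub>\<infinity>y. \<Sum>\<^sub>\<infinity>v\<in>S. G S x v * exit_sum S v (\<lambda>z. G UNIV z v) * G UNIV v y)"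
    by (rule infsum_ennreal_cmult)
  also have "(\<Sum>\<^sub>\<infinity>y. \<Sum>\<^sub>\<infinity>v\<in>S. G S x v * exit_sum S v (\<lambda>z. G UNIV z v) * G UNIV v y) =
     (\<Sum>\<^sub>\<infinity>v\<in>S. \<Sum>\<^sub>\<infinity>y. G S x v * exit_sum S v (\<lambda>z. G UNIV z v) * G UNIV v y)"
    by (rule infsum_ennreal_swap)
  also have "\<dots> = loop_error S x * chi"
    by (simp only: infsum_ennreal_cmult infsum_ennreal_multc loop_error_def susceptibility_from chi_def)
  finally have "exit_sum S x (\<lambda>_. 1) * chi \<le> (1 + ennreal lam * loop_error S x) * chi"
    by (simp add: susceptibility_from chi_def distrib_right mult.assoc)
  moreover have "0 < chi" "chi < top" using \<open>chi \<noteq> 0\<close> fin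
    by (auto simp: chi_def zero_less_iff_neq_zero)
  ultimately show ?thesis
    using ennreal_mult_le_mult_iff[of chi] by (simp add: mult.commute less_top)
qed

end

section \<open>The loop error of an intersection of half-spaces\<close>

context bounded_wsaw begin

text \<open>One step parallel to the boundary is itself a path counted in a boundary sum. This
  removes \<beta> from the error constant, which is to depend on \<open>A\<close> and
  \<open>C\<close> alone.\<close>

lemma beta_le_A: "\<beta> \<le> A"
proof -
  obtain i :: 'd where True by simp
  have "\<exists>j. j \<noteq> i"
  proof (rule ccontr)
    assume "\<not> ?thesis"
    then have "UNIV = {i}" by auto
    then have "CARD('d) = 1" by (metis card_1_singleton_iff One_nat_def)
    then show False using dim by simp
  qed
  then obtain j where j: "j \<noteq> i" by blast
  have adj: "nn_adj 0 (axis j 1 :: int ^ 'd)"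
    unfolding nn_adj_iff by (intro exI[of _ j] exI[of _ 1]) auto
  have "[0, axis j 1] \<in> paths (hs i 1 0) 0 (axis j 1 :: int ^ 'd)"
    using adj j by (auto simp: paths_def hs_def axis_def)
  moreover have "weight [0, axis j 1 :: int ^ 'd] = b"
    by (auto simp: weight_def num_edges_def path_weight_Cons axis_def vec_eq_iff)
  ultimately have "b \<le> G (hs i 1 0) 0 (axis j 1)"
    unfolding G_def using infsum_ennreal_member_le by metis
  also have "\<dots> \<le> (\<Sum>\<^sub>\<infinity>y\<in>{y. 1 * y $ i = 0}. G (hs i 1 0) 0 y)"
    using j by (intro infsum_ennreal_member_le) (auto simp: axis_def)
  also have "\<dots> \<le> ennreal A" by (rule boundary_sum_le) simp
  finally show ?thesis using AC by simp
qed

text \<open>Loops through one face cost at most \<open>2 * A ^ 3 * C\<close> times the bulk decay: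
  the boundary sum and the edge each give \<open>A\<close>, the return \<open>2 * A * C\<close>. The
  level sum adds \<open>A ^ 2\<close>, and the series over the levels is at most 2.\<close>

definition err :: real where "err = 4 * A ^ 5 * C"

lemma err_nonneg: "0 \<le> err" using AC by (simp add: err_def)

text \<open>Each exit edge violates some constraint \<open>(i, s, c)\<close> of the family, and its
  loops are bounded inside the single half-space \<open>hs i s c\<close>. At height \<open>k\<close>
  above that face the loops are of order \<open>(k + 1) ^ (2 - d)\<close>, with \<open>d\<close> the
  dimension, and the level has mass of order \<open>k + 1\<close>.\<close>

lemma loop_error_le:
  fixes x :: "int ^ 'd"
  assumes F: "finite F" "\<And>i s c. (i, s, c) \<in> F \<Longrightarrow> \<bar>s\<bar> = 1"
  shows "loop_error (hs_Inter F) x \<le> ennreal (real (card F) * err)"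
proof -
  define S where "S = hs_Inter F"
  let ?p = "CARD('d) - 2"
  define t where "t = (\<lambda>(i, s, c) (v :: int ^ 'd). ennreal (2 * A ^ 3 * C / (real_of_int (s * v $ i - c) + 1) ^ ?p))"
  define E where "E f = {e \<in> out_edges S. case f of (i, s, c) \<Rightarrow> s * snd e $ i < c}"
    for f :: "'d \<times> int \<times> int"
  have E: "s * u $ i = c \<and> s * z $ i = c - 1 \<and> z = u - axis i s \<and> u \<in> S"
    if "(i, s, c) \<in> F" "(u, z) \<in> E (i, s, c)" for i s c u z
  proof -
    have s: "\<bar>s\<bar> = 1" using F that by blast
    have u: "u \<in> S" "c \<le> s * u $ i" using that hs_Inter_subset_hs[OF that(1)]
      by (auto simp: E_def out_edges_def S_def hs_def)
    have "nn_adj u z" using that by (simp add: E_def out_edges_def)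
    then obtain j r where jr: "\<bar>r\<bar> = 1" "z = u + axis j r"
      unfolding nn_adj_iff by blast
    have z: "s * z $ i < c" using that by (simp add: E_def)
    have "j = i" using jr u z by (auto simp: axis_def split: if_splits)
    then show ?thesis using jr u z s by (auto simp: abs_one_cases axis_def vec_eq_iff)
  qed
  have edge: "(\<Sum>\<^sub>\<infinity>(u, z)\<in>E f. G S v u * b * G UNIV z v) \<le> t f v"
    if f: "f \<in> F" and v: "v \<in> S" for f v
  proof -
    obtain i s c where isc: "f = (i, s, c)" by (cases f) auto
    have F': "(i, s, c) \<in> F" using f isc by simp
    have s: "\<bar>s\<bar> = 1" using F F' by blast
    have vc: "c \<le> s * v $ i" using v hs_Inter_subset_hs[OF F'] by (auto simp: S_def hs_def)
    let ?q = "ennreal (2 * A * C / (real_of_int (s * v $ i - c) + 1) ^ ?p)"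
    have "(\<Sum>\<^sub>\<infinity>(u, z)\<in>E f. G S v u * b * G UNIV z v) \<le>
        (\<Sum>\<^sub>\<infinity>u\<in>{u. s * u $ i = c}. G (hs i s c) v u * (b * ?q))"
    \<comment> \<open>An edge through a given face is determined by its inner endpoint, so the edge
      sum embeds in a boundary sum.\<close>
    proof (rule infsum_ennreal_inj_le[where h = fst])
      show "inj_on fst (E f)"
      proof (rule inj_onI)
        fix e e' assume e: "e \<in> E f" "e' \<in> E f" "fst e = fst e'"
        have "snd e = fst e - axis i s" if "e \<in> E f" for e
          using E[OF F', of "fst e" "snd e"] that isc by simp
        then have "snd e = fst e - axis i s" "snd e' = fst e' - axis i s" using e by blast+
        then show "e = e'" using e by (simp add: prod_eq_iff)
      qed
      show "fst ` E f \<subseteq> {u. s * u $ i = c}" using E[OF F'] isc by auto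
      fix e assume e: "e \<in> E f"
      obtain u z where uz: "e = (u, z)" by (cases e)
      have uz': "s * u $ i = c" "s * z $ i = c - 1" using E[OF F', of u z] e uz isc by auto
      have "\<bar>z $ i - v $ i\<bar> = \<bar>s * z $ i - s * v $ i\<bar>"
        using s by (simp add: right_diff_distrib[symmetric] abs_mult)
      then have dist: "real_of_int \<bar>z $ i - v $ i\<bar> = real_of_int (s * v $ i - c) + 1"
        using uz' vc by simp
      have "G UNIV z v \<le> ennreal (2 * A * C / (real_of_int \<bar>z $ i - v $ i\<bar> + 1) ^ ?p)"
        by (rule bulk_le)
      also have "\<dots> \<le> ?q"
      proof -
        define r where "r = real_of_int (s * v $ i - c)"
        have "0 \<le> r" unfolding r_def using vc by (subst of_int_0_le_iff) simp
        then have "2 * A * C / (r + 1 + 1) ^ ?p \<le> 2 * A * C / (r + 1) ^ ?p"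
          using AC by (intro divide_left_mono power_mono mult_nonneg_nonneg mult_pos_pos zero_less_power) auto
        then show ?thesis unfolding dist r_def by (rule ennreal_leI)
      qed
      finally have "G UNIV z v \<le> ?q" .
      then show "(case e of (u, z) \<Rightarrow> G S v u * b * G UNIV z v) \<le> G (hs i s c) v (fst e) * (b * ?q)"
        unfolding uz using hs_Inter_subset_hs[OF F']
        by (simp add: mult.assoc) (intro mult_mono two_point_mono_set, auto simp: S_def)
    qed
    also have "\<dots> = (\<Sum>\<^sub>\<infinity>u\<in>{u. s * u $ i = c}. G (hs i s c) v u) * (b * ?q)"
      by (rule infsum_ennreal_multc)
    also have "\<dots> \<le> ennreal A * (ennreal A * ?q)"
      using beta_le_A by (intro mult_mono boundary_sum_le[OF s]) (auto intro: ennreal_leI)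
    also have "\<dots> = t f v"
    proof -
      define r where "r = real_of_int (s * v $ i - c)"
      have "0 \<le> r" unfolding r_def using vc by (subst of_int_0_le_iff) simp
      then have "0 \<le> 2 * A * C / (r + 1) ^ ?p" using AC by simp
      then have "ennreal A * (ennreal A * ennreal (2 * A * C / (r + 1) ^ ?p)) =
          ennreal (A * (A * (2 * A * C / (r + 1) ^ ?p)))"
        using AC(1) by (simp only: ennreal_mult mult_nonneg_nonneg)
      then show ?thesis by (simp add: t_def isc r_def power3_eq_cube mult_ac)
    qed
    finally show ?thesis .
  qed
  have es: "exit_sum S v (\<lambda>z. G UNIV z v) \<le> (\<Sum>f\<in>F. t f v)" if v: "v \<in> S" for v
  proof -
    have "out_edges S \<subseteq> (\<Union>f\<in>F. E f)"
    proof
      fix e assume e: "e \<in> out_edges S"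
      then have "snd e \<notin> S" by (auto simp: out_edges_def)
      then obtain f where "f \<in> F" "snd e \<notin> (case f of (i, s, c) \<Rightarrow> hs i s c)"
        by (auto simp: S_def hs_Inter_def)
      moreover obtain i s c where "f = (i, s, c)" by (cases f) auto
      ultimately have "(i, s, c) \<in> F" "s * snd e $ i < c" by (simp_all add: hs_def not_le)
      then show "e \<in> (\<Union>f\<in>F. E f)" using e by (force simp: E_def)
    qed
    then have "exit_sum S v (\<lambda>z. G UNIV z v) \<le>
        (\<Sum>\<^sub>\<infinity>f\<in>F. \<Sum>\<^sub>\<infinity>(u, z)\<in>E f. G S v u * b * G UNIV z v)"
      unfolding exit_sum_def by (rule infsum_ennreal_UN_le)
    also have "\<dots> \<le> (\<Sum>\<^sub>\<infinity>f\<in>F. t f v)"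
      using v by (intro infsum_ennreal_mono edge)
    finally show ?thesis using F by simp
  qed
  have "loop_error S x \<le> (\<Sum>\<^sub>\<infinity>v\<in>S. \<Sum>f\<in>F. G S x v * t f v)"
    unfolding loop_error_def
    by (rule infsum_ennreal_mono) (simp add: sum_distrib_left[symmetric] mult_left_mono es)
  also have "\<dots> = (\<Sum>\<^sub>\<infinity>v\<in>S. \<Sum>\<^sub>\<infinity>f\<in>F. G S x v * t f v)" using F by simp
  also have "\<dots> = (\<Sum>\<^sub>\<infinity>f\<in>F. \<Sum>\<^sub>\<infinity>v\<in>S. G S x v * t f v)" by (rule infsum_ennreal_swap)
  also have "\<dots> \<le> (\<Sum>\<^sub>\<infinity>f\<in>F. ennreal err)"
  proof (rule infsum_ennreal_mono)
    fix f assume "f \<in> F"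
    moreover obtain i s c where isc: "f = (i, s, c)" by (cases f) auto
    ultimately have F': "(i, s, c) \<in> F" by simp
    have s: "\<bar>s\<bar> = 1" using F F' by blast
    have sub: "S \<subseteq> hs i s c" using hs_Inter_subset_hs[OF F'] by (simp add: S_def)
    have "(\<Sum>\<^sub>\<infinity>v\<in>S. G S x v * t f v) \<le> (\<Sum>\<^sub>\<infinity>v\<in>S. G (hs i s c) x v * t f v)"
      using sub by (intro infsum_ennreal_mono mult_right_mono two_point_mono_set) auto
    also have "\<dots> \<le> (\<Sum>\<^sub>\<infinity>k. \<Sum>\<^sub>\<infinity>v\<in>{v. s * v $ i = c + int k}. G (hs i s c) x v * t f v)"
    proof (rule infsum_ennreal_UN_le)
      show "S \<subseteq> (\<Union>k. {v. s * v $ i = c + int k})"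
      proof
        fix v assume "v \<in> S"
        then have "c \<le> s * v $ i" using sub by (auto simp: hs_def)
        then show "v \<in> (\<Union>k. {v. s * v $ i = c + int k})"
          by (auto intro!: exI[of _ "nat (s * v $ i - c)"])
      qed
    qed
    also have "\<dots> \<le> (\<Sum>\<^sub>\<infinity>k. ennreal (1 / (1 + real k) ^ (CARD('d) - 3)) * ennreal (2 * A ^ 5 * C))"
    proof (rule infsum_ennreal_mono)
      fix k :: nat
      let ?q = "ennreal (2 * A ^ 3 * C / (real k + 1) ^ ?p)"
      have "(\<Sum>\<^sub>\<infinity>v\<in>{v. s * v $ i = c + int k}. G (hs i s c) x v * t f v) =
         (\<Sum>\<^sub>\<infinity>v\<in>{v. s * v $ i = c + int k}. G (hs i s c) x v * ?q)"
      proof (rule infsum_cong, clarify)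
        fix v assume "s * v $ i = c + int k"
        then have "s * v $ i - c = int k" by simp
        then show "G (hs i s c) x v * t f v = G (hs i s c) x v * ?q"
          by (simp only: t_def isc prod.case of_int_of_nat_eq)
      qed
      also have "\<dots> = (\<Sum>\<^sub>\<infinity>v\<in>{v. s * v $ i = c + int k}. G (hs i s c) x v) * ?q"
        by (rule infsum_ennreal_multc)
      also have "\<dots> \<le> ennreal (A ^ 2 * real (k + 1)) * ?q"
        by (intro mult_right_mono level_sum_le[OF s]) simp
      also have "\<dots> = ennreal (A ^ 2 * real (k + 1) * (2 * A ^ 3 * C / (real k + 1) ^ ?p))"
        using AC by (intro ennreal_mult[symmetric]) auto
      also have "A ^ 2 * real (k + 1) * (2 * A ^ 3 * C / (real k + 1) ^ ?p) =
          (1 / (1 + real k) ^ (CARD('d) - 3)) * (2 * A ^ 5 * C)"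
      proof -
        have "?p = Suc (CARD('d) - 3)" using dim by simp
        then have pw: "(real k + 1) ^ ?p = (1 + real k) * (1 + real k) ^ (CARD('d) - 3)"
          by (simp only: power_Suc add.commute)
        have "A ^ 2 * r * (2 * A ^ 3 * C / (r * P)) = (1 / P) * (2 * A ^ 5 * C)"
          if "0 < r" "0 < P" for r P :: real
          using that by (simp add: power_numeral_reduce)
        from this[of "1 + real k" "(1 + real k) ^ (CARD('d) - 3)"] show ?thesis
          unfolding pw by simp
      qed
      also have "ennreal \<dots> = ennreal (1 / (1 + real k) ^ (CARD('d) - 3)) * ennreal (2 * A ^ 5 * C)"
        using AC by (intro ennreal_mult) auto
      finally show "(\<Sum>\<^sub>\<infinity>v\<in>{v. s * v $ i = c + int k}. G (hs i s c) x v * t f v) \<le>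
         ennreal (1 / (1 + real k) ^ (CARD('d) - 3)) * ennreal (2 * A ^ 5 * C)" .
    qed
    also have "\<dots> = (\<Sum>\<^sub>\<infinity>k. ennreal (1 / (1 + real k) ^ (CARD('d) - 3))) * ennreal (2 * A ^ 5 * C)"
      by (rule infsum_ennreal_multc)
    also have "\<dots> \<le> ennreal (2 / 1 ^ (CARD('d) - 3 - 1)) * ennreal (2 * A ^ 5 * C)"
      using dim by (intro mult_right_mono infsum_inverse_powers) auto
    also have "\<dots> = ennreal err"
      using AC by (subst ennreal_mult[symmetric]) (auto simp: err_def)
    finally show "(\<Sum>\<^sub>\<infinity>v\<in>S. G S x v * t f v) \<le> ennreal err" .
  qed
  also have "\<dots> = ennreal (real (card F) * err)"
    using F err_nonneg by (simp add: ennreal_mult ennreal_of_nat_eq_real_of_nat)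
  finally show ?thesis by (simp add: S_def)
qed

lemma exit_mass_le:
  fixes x :: "int ^ 'd"
  assumes F: "finite F" "\<And>i s c. (i, s, c) \<in> F \<Longrightarrow> \<bar>s\<bar> = 1"
    and fin: "susceptibility TYPE('d) lam \<beta> < \<infinity>"
  shows "exit_sum (hs_Inter F) x (\<lambda>_. 1) \<le> ennreal (1 + lam * real (card F) * err)"
proof -
  have "exit_sum (hs_Inter F) x (\<lambda>_. 1) \<le> 1 + ennreal lam * loop_error (hs_Inter F) x"
    by (rule exit_mass_le_loop_error[OF fin])
  also have "\<dots> \<le> 1 + ennreal lam * ennreal (real (card F) * err)"
    by (intro add_left_mono mult_left_mono loop_error_le[OF F]) auto
  also have "\<dots> = ennreal (1 + lam * real (card F) * err)"
  proof -
    have "0 \<le> lam * (real (card F) * err)" using lam err_nonneg by simp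
    then have "ennreal (1 + lam * (real (card F) * err)) = ennreal 1 + ennreal (lam * (real (card F) * err))"
      by (intro ennreal_plus) auto
    also have "ennreal (lam * (real (card F) * err)) = ennreal lam * ennreal (real (card F) * err)"
      using lam err_nonneg by (intro ennreal_mult) auto
    finally show ?thesis by (simp add: mult.assoc)
  qed
  finally show ?thesis .
qed

end

section \<open>Exits through the faces of cubes\<close>

definition cube :: "int ^ 'd::finite \<Rightarrow> nat \<Rightarrow> (int ^ 'd) set" where
  "cube u k = {y. \<forall>j. \<bar>y $ j - u $ j\<bar> \<le> int k}"

text \<open>Two half-spaces for each coordinate; hence the factor \<open>2 * CARD('d)\<close> in the
  estimates for cubes.\<close>

lemma cube_eq_hs_Inter:
  "cube u k = hs_Inter ((\<lambda>(j, s). (j, s, s * u $ j - int k)) ` (UNIV \<times> {1, -1}))"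
proof -
  have "(y \<in> hs_Inter ((\<lambda>(j, s). (j, s, s * u $ j - int k)) ` (UNIV \<times> {1, -1}))) \<longleftrightarrow>
      (\<forall>j. u $ j - int k \<le> y $ j \<and> - (u $ j) - int k \<le> - (y $ j))" for y
    unfolding hs_Inter_def hs_def by simp
  moreover have "\<bar>y $ j - u $ j\<bar> \<le> int k \<longleftrightarrow>
      u $ j - int k \<le> y $ j \<and> - (u $ j) - int k \<le> - (y $ j)" for y j
    by linarith
  ultimately show ?thesis by (simp only: cube_def set_eq_iff mem_Collect_eq simp_thms)
qed

lemma bij_lattice_sym:
  assumes e: "\<And>k. \<bar>e k\<bar> = 1" and p: "bij p"
  shows "bij (lattice_sym e p t)"
proof (rule bijI)
  show "inj (lattice_sym e p t)" using lattice_sym(1)[OF assms] by simp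
  show "surj (lattice_sym e p t)"
  proof (rule surjI)
    fix w
    have ee: "e k * (e k * z) = z" for k z using e[of k] by (auto simp: abs_one_cases)
    show "lattice_sym e p t (\<chi> m. e (inv p m) * (w $ inv p m - t $ inv p m)) = w"
      using p by (simp add: lattice_sym_def vec_eq_iff bij_def inv_f_f ee)
  qed
qed

text \<open>Marks the layer just beyond the face with outward direction \<open>snd f\<close> in
  coordinate \<open>fst f\<close>. As a step changes only one coordinate, every exit edge crosses
  exactly one of the \<open>2 * CARD('d)\<close> faces.\<close>

definition face_ind :: "int ^ 'd::finite \<Rightarrow> nat \<Rightarrow> 'd \<times> int \<Rightarrow> int ^ 'd \<Rightarrow> ennreal" where
  "face_ind u k f z = (if snd f * (z $ fst f - u $ fst f) = int k + 1 then 1 else 0)"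

lemma out_edge_cube:
  assumes "(y, z) \<in> out_edges (cube u k)"
  obtains j s where "\<bar>s\<bar> = 1" "s * (z $ j - u $ j) = int k + 1"
    "\<And>j'. j' \<noteq> j \<Longrightarrow> \<bar>z $ j' - u $ j'\<bar> \<le> int k"
proof -
  have "nn_adj y z" and y: "y \<in> cube u k" and z: "z \<notin> cube u k"
    using assms by (auto simp: out_edges_def)
  then obtain j s where js: "\<bar>s\<bar> = 1" "z = y + axis j s" unfolding nn_adj_iff by blast
  have other: "\<bar>z $ j' - u $ j'\<bar> \<le> int k" if "j' \<noteq> j" for j'
    using js y that by (auto simp: cube_def axis_def)
  have "\<not> \<bar>z $ j - u $ j\<bar> \<le> int k" 
  proof
    assume "\<bar>z $ j - u $ j\<bar> \<le> int k"
    then have "\<bar>z $ j' - u $ j'\<bar> \<le> int k" for j' using other by (cases "j' = j") auto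
    then show False using z by (simp add: cube_def)
  qed
  moreover have "\<bar>y $ j - u $ j\<bar> \<le> int k" using y by (auto simp: cube_def)
  moreover have "z $ j = y $ j + s" using js by (simp add: axis_def)
  ultimately have "s * (z $ j - u $ j) = int k + 1" using js(1) by (auto simp: abs_one_cases)
  then show ?thesis using that js(1) other by blast
qed

lemma sum_face_ind:
  assumes e: "(y, z) \<in> out_edges (cube u k)"
    and that: "f \<in> UNIV \<times> {1, -1}" "face_ind u k f z = 1"
  shows "(\<Sum>f\<in>UNIV \<times> {1, -1}. face_ind u k f z * w f) = w f"
proof -
  obtain j s where js: "\<bar>s\<bar> = 1" "s * (z $ j - u $ j) = int k + 1"
    "\<And>j'. j' \<noteq> j \<Longrightarrow> \<bar>z $ j' - u $ j'\<bar> \<le> int k" using out_edge_cube[OF e] by blast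
  have eq: "face_ind u k g z = (if g = (j, s) then 1 else 0)" if "g \<in> UNIV \<times> {1, -1}" for g
  proof (cases "fst g = j")
    case True
    then show ?thesis using that js(1,2) by (cases g) (auto simp: face_ind_def abs_one_cases)
  next
    case False
    then have "\<bar>z $ fst g - u $ fst g\<bar> \<le> int k" by (rule js(3))
    then show ?thesis using that False by (cases g) (auto simp: face_ind_def)
  qed
  have f: "f = (j, s)" using eq[of f] that by (simp split: if_splits)
  have "(\<Sum>f\<in>UNIV \<times> {1, -1}. face_ind u k f z * w f) =
      (\<Sum>g\<in>UNIV \<times> {1, -1}. if g = (j, s) then w g else 0)"
    by (rule sum.cong) (auto simp: eq)
  also have "\<dots> = w (j, s)" using js(1) by (subst sum.delta) (auto simp: abs_one_cases)
  finally show ?thesis by (simp add: f)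
qed

lemma ex_face_ind:
  assumes "(y, z) \<in> out_edges (cube u k)"
  obtains f where "f \<in> UNIV \<times> {1, -1}" "face_ind u k f z = 1"
proof -
  obtain j s where "\<bar>s\<bar> = 1" "s * (z $ j - u $ j) = int k + 1"
    using out_edge_cube[OF assms] by blast
  then show ?thesis by (intro that[of "(j, s)"]) (auto simp: face_ind_def abs_one_cases)
qed

context wsaw begin

lemma exit_sum_mono_edges:
  assumes "\<And>y z. (y, z) \<in> out_edges S \<Longrightarrow> g z \<le> h z"
  shows "exit_sum S x g \<le> exit_sum S x h"
  unfolding exit_sum_def
  by (rule infsum_ennreal_mono) (auto intro!: mult_left_mono assms)

lemma exit_sum_sum:
  "finite I \<Longrightarrow> exit_sum S x (\<lambda>z. \<Sum>i\<in>I. g i z) = (\<Sum>i\<in>I. exit_sum S x (g i))"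
  by (induction I rule: finite_induct) (simp_all add: exit_sum_add, simp add: exit_sum_def case_prod_unfold)

lemma exit_sum_image:
  assumes "bij T" and adj: "\<And>y z. nn_adj (T y) (T z) \<longleftrightarrow> nn_adj y z"
  shows "exit_sum (T ` S) (T x) g = exit_sum S x (\<lambda>z. g (T z))"
proof -
  have inj: "inj T" and surj: "surj T" using assms(1) by (auto simp: bij_def)
  have mem: "T y \<in> T ` S \<longleftrightarrow> y \<in> S" for y using inj by (auto simp: inj_def)
  have "exit_sum S x (\<lambda>z. g (T z)) = (\<Sum>\<^sub>\<infinity>e\<in>out_edges S. (\<lambda>(u, z). G (T ` S) (T x) u * b * g z) (map_prod T T e))"
    unfolding exit_sum_def using two_point_image[OF inj adj]
    by (intro infsum_cong) auto
  also have "\<dots> = infsum (\<lambda>(u, z). G (T ` S) (T x) u * b * g z) (map_prod T T ` out_edges S)"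
    by (subst infsum_reindex) (auto simp: o_def inj_on_def dest: injD[OF inj])
  also have "map_prod T T ` out_edges S = out_edges (T ` S)"
  proof (intro equalityI subsetI)
    fix e assume e: "e \<in> out_edges (T ` S)"
    obtain y z where yz: "e = (T y, T z)" using surj by (metis surj_def surj_pair)
    then have "(y, z) \<in> out_edges S" using e by (auto simp: out_edges_def mem adj)
    then show "e \<in> map_prod T T ` out_edges S" using yz by force
  next
    fix e assume "e \<in> map_prod T T ` out_edges S"
    then obtain y z where "e = (T y, T z)" "(y, z) \<in> out_edges S" by auto
    then show "e \<in> out_edges (T ` S)" by (simp add: out_edges_def mem adj)
  qed
  finally show ?thesis by (simp add: exit_sum_def)
qed

definition face_mass :: "int ^ 'd::finite \<Rightarrow> nat \<Rightarrow> 'd \<times> int \<Rightarrow> ennreal" where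
  "face_mass u k f = exit_sum (cube u k) u (face_ind u k f)"

text \<open>A signed swap of the coordinates \<open>j\<close> and \<open>j'\<close>, followed by the
  translation taking \<open>u'\<close> to \<open>u\<close>, carries one cube onto the other and one
  face onto the other.\<close>

lemma face_mass_eq:
  fixes u u' :: "int ^ 'd::finite"
  assumes "f \<in> UNIV \<times> {1, -1}" "f' \<in> UNIV \<times> {1, -1}"
  shows "face_mass u k f = face_mass u' k f'"
proof -
  obtain j s j' s' where f: "f = (j, s)" "f' = (j', s')" "\<bar>s\<bar> = 1" "\<bar>s'\<bar> = 1"
    using assms by (cases f; cases f') auto
  define p where "p = Fun.swap j j' (id :: 'd \<Rightarrow> 'd)"
  have p: "bij p" "p j = j'" by (auto simp: p_def)
  define e where "e m = (if m = j then s * s' else 1)" for m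
  have e: "\<bar>e m\<bar> = 1" for m using f by (simp add: e_def abs_mult)
  define T where "T = lattice_sym e p (\<chi> m. u $ m - e m * u' $ p m)"
  have T: "(T y - u) $ m = e m * (y - u') $ p m" for y m
    by (simp add: T_def lattice_sym_def algebra_simps)
  have bij: "bij T" unfolding T_def by (rule bij_lattice_sym[OF e p(1)])
  have adj: "nn_adj (T y) (T z) \<longleftrightarrow> nn_adj y z" for y z
    unfolding T_def by (rule lattice_sym(2)[OF e p(1)])
  have Tu: "T u' = u" using T[of u'] by (simp add: vec_eq_iff)
  have cube: "T y \<in> cube u k \<longleftrightarrow> y \<in> cube u' k" for y
  proof -
    have "T y \<in> cube u k \<longleftrightarrow> (\<forall>m. \<bar>(T y - u) $ m\<bar> \<le> int k)" by (simp add: cube_def)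
    also have "\<dots> \<longleftrightarrow> (\<forall>m. \<bar>(y - u') $ p m\<bar> \<le> int k)" unfolding T abs_mult e by simp
    also have "\<dots> \<longleftrightarrow> (\<forall>m. \<bar>(y - u') $ m\<bar> \<le> int k)"
      using p(1) by (metis bij_pointE)
    finally show ?thesis by (simp add: cube_def)
  qed
  have "T ` cube u' k = cube u k"
    using bij cube by (metis (no_types, lifting) bij_is_surj image_subset_iff subsetI subset_antisym surj_f_inv_f imageI)
  moreover have "face_ind u k f (T z) = face_ind u' k f' z" for z
  proof -
    have "s * (T z $ j - u $ j) = s * s * s' * (z $ j' - u' $ j')"
      using T[of z j] p(2) by (simp add: e_def mult.assoc)
    also have "s * s = 1" using f by (auto simp: abs_one_cases)
    finally show ?thesis by (simp add: face_ind_def f)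
  qed
  ultimately show ?thesis
    unfolding face_mass_def using exit_sum_image[OF bij adj, of "cube u' k" u' "face_ind u k f"] Tu by simp
qed

lemma exit_sum_cube_faces:
  "exit_sum (cube u k) u (\<lambda>z. \<Sum>f\<in>UNIV \<times> {1, -1}. face_ind u k f z * w f) =
    (\<Sum>f\<in>UNIV \<times> {1, -1}. face_mass u k f * w f)"
  by (subst exit_sum_sum) (simp_all add: exit_sum_multc face_mass_def)

lemma card_faces: "card ((UNIV :: 'd::finite set) \<times> {1, -1::int}) = 2 * CARD('d)"
  by (simp add: card_cartesian_product)

lemma face_mass_total:
  fixes u :: "int ^ 'd::finite"
  assumes "f \<in> UNIV \<times> {1, -1}"
  shows "of_nat (2 * CARD('d)) * face_mass u k f = exit_sum (cube u k) u (\<lambda>_. 1)"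
proof -
  have "exit_sum (cube u k) u (\<lambda>_. 1) =
      exit_sum (cube u k) u (\<lambda>z. \<Sum>f\<in>UNIV \<times> {1, -1}. face_ind u k f z * 1)"
  proof -
    have "(\<Sum>f\<in>UNIV \<times> {1, -1}. face_ind u k f z * 1) = 1" if "(y, z) \<in> out_edges (cube u k)" for y z
      using ex_face_ind[OF that] sum_face_ind[OF that, where w = "\<lambda>_. 1"] by blast
    then show ?thesis by (intro antisym exit_sum_mono_edges) simp_all
  qed
  also have "\<dots> = (\<Sum>g\<in>UNIV \<times> {1, -1}. face_mass u k g * 1)" by (rule exit_sum_cube_faces)
  also have "\<dots> = (\<Sum>g\<in>(UNIV :: 'd set) \<times> {1, -1::int}. face_mass u k f)"
    using assms by (intro sum.cong) (auto intro!: face_mass_eq)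
  also have "\<dots> = of_nat (2 * CARD('d)) * face_mass u k f"
    by (simp only: sum_constant card_faces)
  finally show ?thesis by simp
qed

text \<open>Singles out the face \<open>f\<close>; by symmetry the other
  \<open>2 * CARD('d) - 1\<close> faces have the same mass as \<open>f\<close>. In the applications
  an exit through \<open>f\<close> either contributes 0 or leads one step closer to the target than
  the others.\<close>

lemma exit_sum_cube_le:
  fixes u :: "int ^ 'd::finite"
  assumes f: "f \<in> UNIV \<times> {1, -1}"
    and g1: "\<And>z. face_ind u k f z = 1 \<Longrightarrow> g z \<le> a1"
    and g2: "\<And>y z. (y, z) \<in> out_edges (cube u k) \<Longrightarrow> face_ind u k f z \<noteq> 1 \<Longrightarrow> g z \<le> a2"
  shows "exit_sum (cube u k) u g \<le> face_mass u k f * a1 + of_nat (2 * CARD('d) - 1) * face_mass u k f * a2"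
proof -
  let ?w = "\<lambda>h. if h = f then a1 else a2"
  let ?F = "(UNIV :: 'd set) \<times> {1, -1::int}"
  have "exit_sum (cube u k) u g \<le> exit_sum (cube u k) u (\<lambda>z. \<Sum>h\<in>?F. face_ind u k h z * ?w h)"
  proof (rule exit_sum_mono_edges)
    fix y z assume e: "(y, z) \<in> out_edges (cube u k)"
    obtain h where h: "h \<in> ?F" "face_ind u k h z = 1" using ex_face_ind[OF e] by blast
    have "g z \<le> ?w h"
    proof (cases "h = f")
      case True then show ?thesis using h g1 by simp
    next
      case False
      have "face_ind u k f z \<noteq> 1"
      proof
        assume "face_ind u k f z = 1"
        then have "(1::ennreal) = 0"
          using False sum_face_ind[OF e h, of "\<lambda>h. if h = f then 1 else 0"]
            sum_face_ind[OF e f, of "\<lambda>h. if h = f then 1 else 0"] by simp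
        then show False by simp
      qed
      then show ?thesis using False g2[OF e] by simp
    qed
    then show "g z \<le> (\<Sum>h\<in>?F. face_ind u k h z * ?w h)"
      using sum_face_ind[OF e h, of ?w] by simp
  qed
  also have "\<dots> = (\<Sum>h\<in>?F. face_mass u k h * ?w h)" by (rule exit_sum_cube_faces)
  also have "\<dots> = (\<Sum>h\<in>?F. face_mass u k f * ?w h)"
  proof (rule sum.cong[OF refl])
    fix h assume "h \<in> ?F"
    then have "face_mass u k h = face_mass u k f" using f by (rule face_mass_eq)
    then show "face_mass u k h * ?w h = face_mass u k f * ?w h" by simp
  qed
  also have "\<dots> = face_mass u k f * a1 + (\<Sum>h\<in>?F - {f}. face_mass u k f * ?w h)"
    using f by (subst sum.remove[of _ f]) auto
  also have "(\<Sum>h\<in>?F - {f}. face_mass u k f * ?w h) = (\<Sum>h\<in>?F - {f}. face_mass u k f * a2)"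
    by (rule sum.cong) auto
  also have "\<dots> = of_nat (2 * CARD('d) - 1) * face_mass u k f * a2"
    using f by (simp add: card_Diff_singleton card_faces mult.assoc del: One_nat_def)
  finally show ?thesis .
qed

end

text \<open>The threshold \<open>1 / (4 * d)\<close>, with \<open>d\<close> the dimension, is half
  the share of one face of a cube. So the excess of the exit mass over 1 does not make up for the
  loss of one face: \<open>(1 - 1 / (2 * d)) * (1 + 1 / (4 * d))\<close> is at most
  \<open>1 - 1 / (4 * d)\<close>, which becomes \<open>q\<close>.\<close>

locale small_wsaw = bounded_wsaw lam \<beta> A C D for lam \<beta> A C and D :: "'d::finite itself" +
  assumes fin: "susceptibility TYPE('d) lam \<beta> < \<infinity>"
    and small: "lam * real (2 * CARD('d)) * err \<le> 1 / real (4 * CARD('d))"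
begin

lemma exit_mass_hs_Inter:
  fixes x :: "int ^ 'd"
  assumes F: "finite F" "\<And>i s c. (i, s, c) \<in> F \<Longrightarrow> \<bar>s\<bar> = 1" "card F \<le> 2 * CARD('d)"
  shows "exit_sum (hs_Inter F) x (\<lambda>_. 1) \<le> ennreal (1 + 1 / real (4 * CARD('d)))"
proof -
  have "exit_sum (hs_Inter F) x (\<lambda>_. 1) \<le> ennreal (1 + lam * real (card F) * err)"
    by (rule exit_mass_le[OF F(1,2) fin])
  also have "lam * real (card F) * err \<le> lam * real (2 * CARD('d)) * err"
    using lam err_nonneg F(3) by (intro mult_right_mono mult_left_mono) auto
  finally show ?thesis using small by (smt (verit) ennreal_leI order_trans)
qed

definition q :: real where "q = 1 - 1 / real (4 * CARD('d))"

lemma q: "0 \<le> q" "q < 1"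
proof -
  have "1 / real (4 * CARD('d)) \<le> 1 / 1" using dim by (intro divide_left_mono) auto
  then show "0 \<le> q" "q < 1" by (auto simp: q_def)
qed

lemma face_mass_le:
  fixes u :: "int ^ 'd"
  assumes "f \<in> UNIV \<times> {1, -1}"
  shows "of_nat (2 * CARD('d) - 1) * face_mass u k f \<le> ennreal q"
proof -
  let ?d = "real CARD('d)"
  have d: "0 < ?d" by simp
  have "card ((\<lambda>(j, s). (j, s, s * u $ j - int k)) ` (UNIV \<times> {1, -1})) \<le> card ((UNIV :: 'd set) \<times> {1, -1::int})"
    by (rule card_image_le) simp
  then have "exit_sum (cube u k) u (\<lambda>_. 1) \<le> ennreal (1 + 1 / (4 * ?d))"
    unfolding cube_eq_hs_Inter card_faces
    by (intro order_trans[OF exit_mass_hs_Inter]) auto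
  then have "ennreal (2 * ?d) * face_mass u k f \<le> ennreal (1 + 1 / (4 * ?d))"
    unfolding face_mass_total[OF assms, symmetric] by (simp add: ennreal_of_nat_eq_real_of_nat)
  then have "ennreal ((2 * ?d - 1) / (2 * ?d)) * (ennreal (2 * ?d) * face_mass u k f) \<le>
      ennreal ((2 * ?d - 1) / (2 * ?d)) * ennreal (1 + 1 / (4 * ?d))"
    by (rule mult_left_mono) simp
  moreover have "1 \<le> ?d" using d by simp
  moreover have "ennreal ((2 * ?d - 1) / (2 * ?d)) * (ennreal (2 * ?d) * face_mass u k f) =
      of_nat (2 * CARD('d) - 1) * face_mass u k f"
  proof -
    have "ennreal ((2 * ?d - 1) / (2 * ?d)) * ennreal (2 * ?d) = ennreal (2 * ?d - 1)"
    proof -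
      have "0 \<le> (2 * ?d - 1) / (2 * ?d)" using \<open>1 \<le> ?d\<close> by (intro divide_nonneg_nonneg) linarith+
      then show ?thesis by (subst ennreal_mult[symmetric]) auto
    qed
    also have "\<dots> = of_nat (2 * CARD('d) - 1)"
      using \<open>1 \<le> ?d\<close> by (simp add: ennreal_of_nat_eq_real_of_nat of_nat_diff)
    finally show ?thesis by (simp only: mult.assoc[symmetric])
  qed
  moreover have "ennreal ((2 * ?d - 1) / (2 * ?d)) * ennreal (1 + 1 / (4 * ?d)) \<le> ennreal q"
    using d \<open>1 \<le> ?d\<close> 
  proof -
    have "0 \<le> (2 * ?d - 1) / (2 * ?d)" using \<open>1 \<le> ?d\<close> by (intro divide_nonneg_nonneg) linarith+
    then have "ennreal ((2 * ?d - 1) / (2 * ?d)) * ennreal (1 + 1 / (4 * ?d)) =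
        ennreal ((2 * ?d - 1) / (2 * ?d) * (1 + 1 / (4 * ?d)))"
      by (intro ennreal_mult[symmetric]) auto
    also have "(2 * ?d - 1) / (2 * ?d) * (1 + 1 / (4 * ?d)) \<le> q"
      using d by (simp add: q_def field_simps)
    finally show ?thesis by (simp add: ennreal_leI)
  qed
  ultimately show ?thesis by simp
qed

end

section \<open>Regularity by reflection\<close>

context small_wsaw begin

text \<open>The quarter-space has the bottom layer \<open>s * z $ i = c\<close> and the side layer
  \<open>r * z $ j = a\<close>. The largest cube around \<open>u\<close> that stays clear of
  crossing the side has one face leading out through it, and the bottom cannot be left from inside
  this cube; so reaching the bottom costs a factor \<open>q\<close>. Leaving through another face at
  most doubles the distance to the side, and \<open>2 ^ n - 1\<close> is the height, in units of
  that distance, needed for \<open>n\<close> repetitions. The leading 2 bounds the total exit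
  mass.\<close>

lemma bottom_exit_le:
  fixes i j :: 'd and u :: "int ^ 'd"
  assumes ij: "i \<noteq> j" and s: "\<bar>s\<bar> = 1" and r: "\<bar>r\<bar> = 1"
    and u: "a \<le> r * u $ j" "(2 ^ n - 1) * (r * u $ j - a + 1) \<le> s * u $ i - c"
  defines "S \<equiv> hs_Inter {(i, s, c), (j, r, a)}"
  shows "exit_sum S u (\<lambda>z. if s * z $ i < c then 1 else 0) \<le> ennreal (2 * q ^ n)"
  using u
proof (induction n arbitrary: u)
  case 0
  have "exit_sum S u (\<lambda>z. if s * z $ i < c then 1 else 0) \<le> exit_sum S u (\<lambda>_. 1)"
    by (rule exit_sum_mono) auto
  also have "\<dots> \<le> ennreal (1 + 1 / real (4 * CARD('d)))"
    unfolding S_def using s r dim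
    by (intro exit_mass_hs_Inter) (auto simp: card_insert_if)
  also have "\<dots> \<le> ennreal (2 * q ^ 0)" using dim by (intro ennreal_leI) (simp add: field_simps)
  finally show ?case .
next
  case (Suc n)
  let ?B = "\<lambda>v. exit_sum S v (\<lambda>z. if s * z $ i < c then 1 else 0)"
  define rho where "rho v = r * v $ j - a + 1" for v :: "int ^ 'd"
  define h where "h v = s * v $ i - c" for v :: "int ^ 'd"
  have S: "v \<in> S \<longleftrightarrow> 0 \<le> h v \<and> 1 \<le> rho v" for v
    by (auto simp: S_def hs_Inter_def hs_def h_def rho_def)
  have rho1: "1 \<le> rho u" using Suc.prems by (simp add: rho_def)
  have hu: "(2 * 2 ^ n - 1) * rho u \<le> h u" using Suc.prems(2) by (simp add: rho_def h_def)
  have pow1: "(1::int) \<le> 2 ^ n" by simp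
  have "1 * rho u \<le> (2 * 2 ^ n - 1) * rho u" using rho1 pow1 by (intro mult_right_mono) linarith+
  then have hrho: "rho u \<le> h u" using hu by linarith
  \<comment> \<open>\<open>rho\<close> is 1 on the side layer, so a cube of radius
    \<open>rho u - 1\<close> touches that layer, and the layer beyond its face has
    \<open>rho z = 0\<close>, outside \<open>S\<close>.\<close>
  define k where "k = nat (rho u - 1)"
  have k: "int k = rho u - 1" using rho1 by (simp add: k_def)
  have lev: "\<bar>s * z $ i - s * u $ i\<bar> = \<bar>z $ i - u $ i\<bar>" "\<bar>r * z $ j - r * u $ j\<bar> = \<bar>z $ j - u $ j\<bar>" for z
    using s r by (simp_all add: right_diff_distrib[symmetric] abs_mult)
  have cube: "\<bar>h z - h u\<bar> \<le> int k \<and> \<bar>rho z - rho u\<bar> \<le> int k" if "z \<in> cube u k" for z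
    using that lev[of z] by (simp add: cube_def h_def rho_def)
  have cubeS: "cube u k \<subseteq> S"
  proof
    fix z assume "z \<in> cube u k"
    then show "z \<in> S" using cube[of z] k hrho by (auto simp: S)
  qed
  have uc: "u \<in> cube u k" by (simp add: cube_def)
  let ?f = "(j, - r)"
  have f: "?f \<in> UNIV \<times> {1, -1}" using r by auto
  have face: "face_ind u k ?f z = 1 \<longleftrightarrow> rho z = rho u - int k - 1" for z
    by (auto simp: face_ind_def rho_def algebra_simps)
  \<comment> \<open>The Simon-Lieb inequality at the cube, applied to each \<open>y\<close> on the
    bottom layer; such \<open>y\<close> lie outside the cube.\<close>
  have "?B u \<le> (\<Sum>\<^sub>\<infinity>(y, z)\<in>out_edges S.
      exit_sum (cube u k) u (\<lambda>v. G S v y) * (b * (if s * z $ i < c then 1 else 0)))"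
    unfolding exit_sum_def[of S]
  proof (rule infsum_ennreal_mono, clarify)
    fix y z assume yz: "(y, z) \<in> out_edges S"
    show "G S u y * b * (if s * z $ i < c then 1 else 0) \<le>
      exit_sum (cube u k) u (\<lambda>v. G S v y) * (b * (if s * z $ i < c then 1 else 0))"
    proof (cases "s * z $ i < c")
      case True
      have "nn_adj y z" using yz by (simp add: out_edges_def)
      then have "\<bar>y $ i - z $ i\<bar> \<le> 1" by (rule nn_adj_level)
      then have "\<bar>s * y $ i - s * z $ i\<bar> \<le> 1" using s by (simp add: right_diff_distrib[symmetric] abs_mult)
      then have "h y \<le> 0" using True by (simp add: h_def)
      then have "y \<notin> cube u k" using cube[of y] k hrho by auto
      then have "G S u y \<le> exit_sum (cube u k) u (\<lambda>v. G S v y)"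
        using uc by (intro first_exit_outside) auto
      then show ?thesis by (simp add: mult.assoc mult_right_mono)
    qed simp
  qed
  also have "\<dots> = (\<Sum>\<^sub>\<infinity>e\<in>out_edges S.
      exit_sum (cube u k) u (\<lambda>v. G S v (fst e) * (b * (if s * snd e $ i < c then 1 else 0))))"
    by (simp only: exit_sum_multc case_prod_unfold)
  also have "\<dots> = exit_sum (cube u k) u ?B"
    unfolding exit_sum_infsum by (simp add: exit_sum_def[of S] case_prod_unfold mult.assoc)
  also have "\<dots> \<le> face_mass u k ?f * 0 + of_nat (2 * CARD('d) - 1) * face_mass u k ?f * ennreal (2 * q ^ n)"
  proof (rule exit_sum_cube_le[OF f])
    fix z assume "face_ind u k ?f z = 1"
    then have "z \<notin> S" using k by (simp add: face S)
    then show "?B z \<le> 0" by (simp add: exit_sum_def two_point_outside case_prod_unfold)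
  next
    fix y z assume yz: "(y, z) \<in> out_edges (cube u k)" and nf: "face_ind u k ?f z \<noteq> 1"
    have y: "y \<in> cube u k" and adj: "nn_adj y z" using yz by (auto simp: out_edges_def)
    have "\<bar>y $ i - z $ i\<bar> \<le> 1" "\<bar>y $ j - z $ j\<bar> \<le> 1" using adj by (auto intro: nn_adj_level)
    moreover have "\<bar>y $ i - u $ i\<bar> \<le> int k" "\<bar>y $ j - u $ j\<bar> \<le> int k"
      using y by (simp_all add: cube_def)
    ultimately have "\<bar>z $ i - u $ i\<bar> \<le> int k + 1" "\<bar>z $ j - u $ j\<bar> \<le> int k + 1"
      by linarith+
    then have z: "\<bar>h z - h u\<bar> \<le> rho u" "\<bar>rho z - rho u\<bar> \<le> rho u"
      using lev[of z] k by (simp_all add: h_def rho_def)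
    have "rho z \<noteq> 0" using nf k by (simp add: face)
    then have rz: "1 \<le> rho z" "rho z \<le> 2 * rho u" using z by linarith+
    \<comment> \<open>One scale is consumed: \<open>rho\<close> at most doubles while the height
      drops by at most \<open>rho u\<close>, and
      \<open>(2 * 2 ^ n - 1) - 1 = (2 ^ n - 1) * 2\<close>.\<close>
    have "(2 ^ n - 1) * rho z \<le> (2 ^ n - 1) * (2 * rho u)"
      using rz pow1 by (intro mult_left_mono) linarith+
    also have "\<dots> = (2 * 2 ^ n - 1) * rho u - rho u" by (simp add: algebra_simps)
    also have "\<dots> \<le> h z" using hu z by linarith
    finally have "(2 ^ n - 1) * rho z \<le> h z" .
    then show "?B z \<le> ennreal (2 * q ^ n)"
      using rz by (intro Suc.IH) (simp_all add: rho_def h_def)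
  qed
  also have "\<dots> \<le> ennreal q * ennreal (2 * q ^ n)"
    using face_mass_le[OF f] by (simp add: mult_right_mono)
  also have "\<dots> = ennreal (2 * q ^ Suc n)" using q by (simp add: ennreal_mult[symmetric] mult_ac)
  finally show ?case .
qed

text \<open>The mirror \<open>z $ j = 1 - a\<close> is at distance \<open>p\<close> from
  \<open>u\<close>, and the quarter-spaces \<open>S\<close> and \<open>S'\<close> adjoin it from its
  two sides. Exits through the side land on the mirror, where the reflection is the identity, so
  both quarter-spaces give the same side contribution. The walk from \<open>u\<close> pays for exits
  through the bottom, the one from the mirror image pays the error of the reversed
  inequality.\<close>

lemma reflected_comparison:
  fixes i j :: 'd and u x :: "int ^ 'd"
  assumes ij: "i \<noteq> j" and s: "\<bar>s\<bar> = 1" and p: "1 \<le> p"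
    and x: "s * x $ i < c" and c0: "c0 < c"
    and u: "(2 ^ n - 1) * p \<le> s * u $ i - c"
    and M: "\<And>v. c - 1 \<le> s * v $ i \<Longrightarrow> G (hs i s c0) v x \<le> ennreal M" and M0: "0 \<le> M"
  shows "G (hs i s c0) u x \<le> G (hs i s c0) (u + axis j (2 * p)) x + ennreal ((2 * q ^ n + lam * (2 * err)) * M)"
proof -
  define a where "a = - (u $ j) - p + 1"
  define S where "S = hs_Inter {(i, s, c), (j, -1, a)}"
  define S' where "S' = hs_Inter {(i, s, c), (j, 1, 2 - a)}"
  define T where "T = lattice_sym (\<lambda>k. if k = j then -1 else 1) id (axis j (2 - 2 * a) :: int ^ 'd)"
  let ?f = "\<lambda>v. G (hs i s c0) v x"
  have bij: "bij T" unfolding T_def by (rule bij_lattice_sym) auto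
  have adj: "nn_adj (T y) (T z) \<longleftrightarrow> nn_adj y z" for y z
    unfolding T_def by (rule lattice_sym(2)) auto
  have T: "T y $ k = (if k = j then 2 - 2 * a - y $ j else y $ k)" for y k
    by (simp add: T_def lattice_sym_def axis_def)
  have TT: "T (T y) = y" for y by (simp add: vec_eq_iff T)
  have Tu: "T u = u + axis j (2 * p)" by (simp add: vec_eq_iff T axis_def a_def)
  have S: "v \<in> S \<longleftrightarrow> c \<le> s * v $ i \<and> a \<le> - (v $ j)" for v by (simp add: S_def hs_Inter_def hs_def)
  have S': "v \<in> S' \<longleftrightarrow> c \<le> s * v $ i \<and> 2 - a \<le> v $ j" for v by (simp add: S'_def hs_Inter_def hs_def)
  have TS: "T ` S = S'"
  proof (intro equalityI subsetI)
    fix v assume "v \<in> S'"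
    then have "T v \<in> S" using ij by (auto simp: S S' T)
    then show "v \<in> T ` S" using TT by (metis imageI)
  qed (use ij in \<open>auto simp: S S' T\<close>)
  have "(2 ^ n - 1) * p \<ge> 0" using p by simp
  then have "c \<le> s * u $ i" using u by linarith
  then have uS: "u \<in> S" using p by (simp add: S a_def)
  have xS: "x \<notin> S" using x by (simp add: S)
  have "?f u \<le> exit_sum S u ?f" by (rule first_exit_outside[OF uS xS])
  also have "\<dots> \<le> exit_sum S u (\<lambda>z. (if z $ j = 1 - a then ?f z else 0) +
      (if s * z $ i < c then 1 else 0) * ennreal M)"
  proof (rule exit_sum_mono_edges)
    fix y z assume yz: "(y, z) \<in> out_edges S"
    have y: "y \<in> S" and z: "z \<notin> S" and a: "nn_adj y z" using yz by (auto simp: out_edges_def)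
    have "\<bar>y $ i - z $ i\<bar> \<le> 1" "\<bar>y $ j - z $ j\<bar> \<le> 1" using a by (auto intro: nn_adj_level)
    moreover have "\<bar>s * y $ i - s * z $ i\<bar> = \<bar>y $ i - z $ i\<bar>"
      using s by (simp add: right_diff_distrib[symmetric] abs_mult)
    \<comment> \<open>A bottom exit lands on the level \<open>c - 1\<close>, hence the range of
      heights on which \<open>M\<close> is a bound.\<close>
    ultimately have "z $ j = 1 - a \<or> s * z $ i < c \<and> c - 1 \<le> s * z $ i"
      using y z unfolding S by linarith
    then show "?f z \<le> (if z $ j = 1 - a then ?f z else 0) + (if s * z $ i < c then 1 else 0) * ennreal M"
      using M[of z] by auto
  qed
  also have "\<dots> = exit_sum S u (\<lambda>z. if z $ j = 1 - a then ?f z else 0) +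
      exit_sum S u (\<lambda>z. if s * z $ i < c then 1 else 0) * ennreal M"
    by (simp only: exit_sum_add exit_sum_multc)
  also have "\<dots> \<le> (?f (T u) + ennreal (lam * (2 * err)) * ennreal M) + ennreal (2 * q ^ n) * ennreal M"
  proof (intro add_mono mult_right_mono)
    have "exit_sum S u (\<lambda>z. if s * z $ i < c then 1 else 0) \<le> ennreal (2 * q ^ n)"
      unfolding S_def by (rule bottom_exit_le[OF ij s]) (use p u in \<open>simp_all add: a_def\<close>)
    then show "exit_sum S u (\<lambda>z. if s * z $ i < c then 1 else 0) \<le> ennreal (2 * q ^ n)" .
    have "exit_sum S u (\<lambda>z. if z $ j = 1 - a then ?f z else 0) =
        exit_sum S u (\<lambda>z. if T z $ j = 1 - a then ?f (T z) else 0)"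
    proof -
      have "T z = z" if "z $ j = 1 - a" for z using that by (simp add: vec_eq_iff T)
      moreover have "T z $ j = 1 - a \<longleftrightarrow> z $ j = 1 - a" for z by (auto simp: T)
      ultimately have "(\<lambda>z. if z $ j = 1 - a then ?f z else 0) =
          (\<lambda>z. if T z $ j = 1 - a then ?f (T z) else 0)" by auto
      then show ?thesis by simp
    qed
    also have "\<dots> = exit_sum S' (T u) (\<lambda>z. if z $ j = 1 - a then ?f z else 0)"
      unfolding TS[symmetric] by (rule exit_sum_image[OF bij adj, symmetric])
    also have "\<dots> \<le> exit_sum S' (T u) ?f" by (rule exit_sum_mono) auto
    also have "\<dots> \<le> ?f (T u) + ennreal lam * loop_error S' (T u) * ennreal M"
    proof (rule first_exit_reversed)
      show "S' \<subseteq> hs i s c0" using c0 by (auto simp: S' hs_def)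
      show "?f v \<le> ennreal M" if "v \<in> S'" for v using that by (intro M) (simp add: S')
    qed
    also have "\<dots> \<le> ?f (T u) + ennreal lam * ennreal (real 2 * err) * ennreal M"
    proof (intro add_left_mono mult_right_mono mult_left_mono)
      have "card {(i, s, c), (j, 1, 2 - a)} = 2" using ij by (simp add: card_insert_if)
      moreover have "loop_error S' (T u) \<le> ennreal (real (card {(i, s, c), (j, 1, 2 - a)}) * err)"
        unfolding S'_def by (rule loop_error_le) (use s in auto)
      ultimately show "loop_error S' (T u) \<le> ennreal (real 2 * err)" by (simp only:)
    qed auto
    also have "ennreal lam * ennreal (real 2 * err) = ennreal (lam * (2 * err))"
      using lam err_nonneg by (simp add: ennreal_mult)
    finally show "exit_sum S u (\<lambda>z. if z $ j = 1 - a then ?f z else 0) \<le>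
      ?f (T u) + ennreal (lam * (2 * err)) * ennreal M" .
  qed simp
  also have "\<dots> = ?f (T u) + (ennreal (lam * (2 * err)) * ennreal M + ennreal (2 * q ^ n) * ennreal M)"
    by (rule add.assoc)
  also have "ennreal (lam * (2 * err)) * ennreal M + ennreal (2 * q ^ n) * ennreal M =
      ennreal ((2 * q ^ n + lam * (2 * err)) * M)"
  proof -
    have 1: "0 \<le> lam * (2 * err)" "0 \<le> 2 * q ^ n" using lam err_nonneg q by auto
    then have "ennreal (lam * (2 * err)) * ennreal M + ennreal (2 * q ^ n) * ennreal M =
        ennreal (lam * (2 * err) * M + 2 * q ^ n * M)"
      using M0 by (simp only: ennreal_mult[symmetric] ennreal_plus mult_nonneg_nonneg)
    then show ?thesis by (simp add: algebra_simps)
  qed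
  finally show ?thesis by (simp only: Tu)
qed

text \<open>One reflection for each coordinate in \<open>J\<close>. None of them changes the height
  \<open>s * u $ i\<close>, so the same lower bound on it serves every time. Moving by twice the
  distance to a mirror makes the shifts even.\<close>

lemma shifted_comparison:
  fixes i :: 'd and u x :: "int ^ 'd" and \<kappa> :: "'d \<Rightarrow> nat"
  assumes s: "\<bar>s\<bar> = 1" and x: "s * x $ i < c" and c0: "c0 < c"
    and u: "(2 ^ n - 1) * int N \<le> s * u $ i - c"
    and M: "\<And>v. c - 1 \<le> s * v $ i \<Longrightarrow> G (hs i s c0) v x \<le> ennreal M" and M0: "0 \<le> M"
    and J: "finite J" "i \<notin> J" and \<kappa>: "\<And>j. j \<in> J \<Longrightarrow> 1 \<le> \<kappa> j \<and> \<kappa> j \<le> N"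
  shows "G (hs i s c0) u x \<le> G (hs i s c0) (u + (\<chi> j. if j \<in> J then 2 * int (\<kappa> j) else 0)) x +
    of_nat (card J) * ennreal ((2 * q ^ n + lam * (2 * err)) * M)"
  using J \<kappa>
proof (induction J rule: finite_induct)
  case empty
  have "(\<chi> j. if j \<in> ({} :: 'd set) then 2 * int (\<kappa> j) else 0) = (0 :: int ^ 'd)" by (simp add: vec_eq_iff)
  then show ?case by simp
next
  case (insert j J)
  let ?v = "u + (\<chi> j. if j \<in> J then 2 * int (\<kappa> j) else 0)"
  let ?E = "ennreal ((2 * q ^ n + lam * (2 * err)) * M)"
  have ij: "i \<noteq> j" and iJ: "i \<notin> J" using insert by auto
  have "(2 ^ n - 1) * int (\<kappa> j) \<le> (2 ^ n - 1) * int N"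
    using insert.prems by (intro mult_left_mono) auto
  also have "\<dots> \<le> s * ?v $ i - c" using u iJ by simp
  finally have "G (hs i s c0) ?v x \<le> G (hs i s c0) (?v + axis j (2 * int (\<kappa> j))) x + ?E"
    using insert.prems by (intro reflected_comparison[OF ij s _ x c0 _ M M0]) auto
  moreover have "?v + axis j (2 * int (\<kappa> j)) = u + (\<chi> k. if k \<in> insert j J then 2 * int (\<kappa> k) else 0)"
    using insert.hyps by (auto simp: vec_eq_iff axis_def)
  ultimately have "G (hs i s c0) ?v x \<le>
      G (hs i s c0) (u + (\<chi> k. if k \<in> insert j J then 2 * int (\<kappa> k) else 0)) x + ?E" by simp
  moreover have "G (hs i s c0) u x \<le> G (hs i s c0) ?v x + of_nat (card J) * ?E"
    using insert by auto
  ultimately have "G (hs i s c0) u x \<le>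
      (G (hs i s c0) (u + (\<chi> k. if k \<in> insert j J then 2 * int (\<kappa> k) else 0)) x + ?E) + of_nat (card J) * ?E"
    by (meson add_right_mono order_trans)
  then show ?case using insert.hyps by (simp add: algebra_simps)
qed

text \<open>The comparison is averaged over \<open>N ^ (CARD('d) - 1)\<close> shifts of
  \<open>u\<close>. These are distinct points of one level, and their values add up to at most
  \<open>A\<close>, since \<open>x\<close> is on the boundary. Hence \<open>C\<close> enters only
  through the error term, with a factor that \<open>t\<close> and \<open>lam\<close> make
  small.\<close>

lemma boundary_point_improved:
  fixes i :: 'd and u x :: "int ^ 'd"
  assumes s: "\<bar>s\<bar> = 1" and x: "s * x $ i = c0" and u: "s * u $ i = c0 + int n"
    and n: "1 \<le> n" and N: "1 \<le> N" "(2 ^ t - 1) * N \<le> n div 2"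
  shows "G (hs i s c0) u x \<le> ennreal (A / real N ^ (CARD('d) - 1) +
    real (CARD('d) - 1) * ((2 * q ^ t + lam * (2 * err)) * (C * 4 ^ (CARD('d) - 1) / (real n + 1) ^ (CARD('d) - 1))))"
proof -
  let ?D = "CARD('d) - 1"
  define M where "M = C * 4 ^ ?D / (real n + 1) ^ ?D"
  have M0: "0 \<le> M" using AC by (simp add: M_def)
  \<comment> \<open>One half of the height lies below \<open>c\<close> and keeps all values above
    \<open>c\<close> of the order of the bound at distance \<open>n\<close>; the other half is room
    for the \<open>t\<close> scales.\<close>
  define c where "c = c0 + int (n - n div 2)"
  have c: "c0 < c" using n by (simp add: c_def)
  have M: "G (hs i s c0) v x \<le> ennreal M" if v: "c - 1 \<le> s * v $ i" for v
  proof -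
    have c0v: "c0 \<le> s * v $ i" using c v by simp
    have "G (hs i s c0) v x \<le> ennreal (C / (real_of_int (s * v $ i - c0) + 1) ^ ?D)"
      by (rule boundary_point_le[OF s x c0v])
    also have "C / (real_of_int (s * v $ i - c0) + 1) ^ ?D \<le> C / ((real n + 1) / 4) ^ ?D"
    proof (intro divide_left_mono power_mono AC)
      have "int (n - n div 2) \<le> s * v $ i - c0 + 1" using v by (simp add: c_def)
      then have "real_of_int (int (n - n div 2)) \<le> real_of_int (s * v $ i - c0) + 1"
        by (metis of_int_1 of_int_add of_int_le_iff)
      \<comment> \<open>The factor 4 absorbs the rounding: for \<open>n = 2\<close> the left side is
        3 and \<open>n - n div 2\<close> is 1.\<close>
      moreover have "n + 1 \<le> 4 * (n - n div 2)" using n by presburger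
      then have "real (n + 1) \<le> real (4 * (n - n div 2))" by (rule of_nat_mono)
      ultimately show le: "(real n + 1) / 4 \<le> real_of_int (s * v $ i - c0) + 1"
        by (simp del: of_nat_diff_if)
      show "0 < (real_of_int (s * v $ i - c0) + 1) ^ ?D * ((real n + 1) / 4) ^ ?D"
        using le by (intro mult_pos_pos zero_less_power) auto
    qed auto
    also have "C / ((real n + 1) / 4) ^ ?D = M" by (simp add: M_def power_divide)
    finally show ?thesis by (simp add: ennreal_leI)
  qed
  define E where "E = (2 * q ^ t + lam * (2 * err)) * M"
  have E0: "0 \<le> E" using M0 q lam err_nonneg by (simp add: E_def)
  let ?J = "UNIV - {i}"
  define K where "K = Pi\<^sub>E ?J (\<lambda>_. {1..N})"
  define sh where "sh \<kappa> = u + (\<chi> j. if j \<in> ?J then 2 * int (\<kappa> j) else 0)" for \<kappa>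
  have finK: "finite K" unfolding K_def by (intro finite_PiE) auto
  have cardJ: "card ?J = ?D" by (simp add: card_Diff_singleton)
  have cardK: "card K = N ^ ?D" unfolding K_def by (subst card_PiE) (simp_all add: cardJ)
  have "int ((2 ^ t - 1) * N) \<le> int (n div 2)" using N(2) by (simp only: of_nat_le_iff)
  then have ut: "(2 ^ t - 1) * int N \<le> s * u $ i - c" by (simp add: u c_def of_nat_diff)
  have each: "G (hs i s c0) u x \<le> G (hs i s c0) (sh \<kappa>) x + of_nat ?D * ennreal E" if "\<kappa> \<in> K" for \<kappa>
    unfolding sh_def E_def cardJ[symmetric]
    by (rule shifted_comparison[OF s _ c ut M M0]) (use that x c in \<open>auto simp: K_def PiE_iff\<close>)
  have "of_nat (N ^ ?D) * G (hs i s c0) u x = (\<Sum>\<kappa>\<in>K. G (hs i s c0) u x)" by (simp add: cardK)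
  also have "\<dots> \<le> (\<Sum>\<kappa>\<in>K. G (hs i s c0) (sh \<kappa>) x + of_nat ?D * ennreal E)"
    by (rule sum_mono) (rule each)
  also have "\<dots> = (\<Sum>\<^sub>\<infinity>\<kappa>\<in>K. G (hs i s c0) x (sh \<kappa>)) + of_nat (N ^ ?D) * (of_nat ?D * ennreal E)"
    using finK by (simp add: sum.distrib cardK two_point_sym[of _ _ _ x])
  also have "(\<Sum>\<^sub>\<infinity>\<kappa>\<in>K. G (hs i s c0) x (sh \<kappa>)) \<le> (\<Sum>\<^sub>\<infinity>v\<in>{v. s * v $ i = c0 + int n}. G (hs i s c0) x v)"
  proof (rule infsum_ennreal_inj_le[where h = sh])
    show "inj_on sh K"
    proof (rule inj_onI)
      fix \<kappa> \<kappa>' assume k: "\<kappa> \<in> K" "\<kappa>' \<in> K" and eq: "sh \<kappa> = sh \<kappa>'"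
      show "\<kappa> = \<kappa>'"
      proof (rule PiE_ext[OF k[unfolded K_def]])
        fix j assume "j \<in> ?J"
        moreover have "sh \<kappa> $ j = sh \<kappa>' $ j" using eq by simp
        ultimately show "\<kappa> j = \<kappa>' j" by (simp add: sh_def)
      qed
    qed
    show "sh ` K \<subseteq> {v. s * v $ i = c0 + int n}" using u by (auto simp: sh_def)
  qed simp
  also have "(\<Sum>\<^sub>\<infinity>v\<in>{v. s * v $ i = c0 + int n}. G (hs i s c0) x v) \<le> ennreal A"
    by (rule level_sum_from_boundary_le[OF s x])
  finally have "of_nat (N ^ ?D) * G (hs i s c0) u x \<le> ennreal A + of_nat (N ^ ?D) * (of_nat ?D * ennreal E)"
    by (simp add: add_right_mono)
  then have "ennreal (1 / real N ^ ?D) * (of_nat (N ^ ?D) * G (hs i s c0) u x) \<le>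
      ennreal (1 / real N ^ ?D) * (ennreal A + of_nat (N ^ ?D) * (of_nat ?D * ennreal E))"
    by (rule mult_left_mono) simp
  moreover have one: "ennreal (1 / real N ^ ?D) * of_nat (N ^ ?D) = 1"
  proof -
    have "ennreal (1 / real N ^ ?D) * of_nat (N ^ ?D) = ennreal (1 / real N ^ ?D * real (N ^ ?D))"
      unfolding ennreal_of_nat_eq_real_of_nat by (rule ennreal_mult[symmetric]) auto
    then show ?thesis using N by simp
  qed
  ultimately have "G (hs i s c0) u x \<le> ennreal (1 / real N ^ ?D) * ennreal A + of_nat ?D * ennreal E"
    by (simp only: mult.assoc[symmetric] distrib_left one mult_1_left)
  also have "\<dots> = ennreal (1 / real N ^ ?D * A + real ?D * E)"
    unfolding ennreal_of_nat_eq_real_of_nat using AC E0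
    by (simp only: ennreal_mult[symmetric] ennreal_plus mult_nonneg_nonneg of_nat_0_le_iff
        divide_nonneg_nonneg zero_le_one zero_le_power)
  also have "1 / real N ^ ?D * A + real ?D * E = A / real N ^ ?D + real ?D * ((2 * q ^ t + lam * (2 * err)) * M)"
    by (simp add: E_def)
  finally show ?thesis by (simp only: M_def)
qed

end

section \<open>The bootstrap in \<open>\<beta>\<close>\<close>

context wsaw begin

lemma exit_mass_singleton_le:
  fixes x :: "int ^ 'd::finite"
  shows "exit_sum {x} x (\<lambda>_. 1) \<le> ennreal (2 * real CARD('d) * \<beta>)"
proof -
  have "exit_sum {x} x (\<lambda>_. 1) \<le> (\<Sum>\<^sub>\<infinity>(j, s)\<in>UNIV \<times> {1, -1}. \<Sum>\<^sub>\<infinity>(u, z)\<in>{(x, x + axis j s)}. G {x} x u * b * 1)"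
    unfolding exit_sum_def case_prod_unfold
  proof (rule infsum_ennreal_UN_le)
    show "out_edges {x} \<subseteq> (\<Union>i\<in>UNIV \<times> {1, -1}. {(x, x + axis (fst i) (snd i))})"
      by (force simp: out_edges_def nn_adj_iff abs_one_cases)
  qed
  also have "\<dots> = (\<Sum>\<^sub>\<infinity>f\<in>(UNIV :: 'd set) \<times> {1, -1::int}. b)"
    by (simp add: G_singleton case_prod_unfold)
  also have "\<dots> = ennreal (2 * real CARD('d) * \<beta>)"
    using beta by (simp add: card_faces ennreal_of_nat_eq_real_of_nat ennreal_mult)
  finally show ?thesis .
qed

text \<open>Cutting at the first step gives \<open>chi \<le> 1 + chi / 2\<close>, which bounds a
  finite \<open>chi\<close> by 2. Near \<beta> = 0 this replaces the bound on boundary sums by an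
  exit mass divided by \<beta>.\<close>

lemma susceptibility_le_2:
  assumes fin: "susceptibility TYPE('d::finite) lam \<beta> < \<infinity>" and small: "\<beta> \<le> 1 / (4 * real CARD('d))"
  shows "susceptibility TYPE('d) lam \<beta> \<le> 2"
proof -
  define chi where "chi = susceptibility TYPE('d) lam \<beta>"
  have "chi = (\<Sum>\<^sub>\<infinity>y::int ^ 'd. G UNIV 0 y)" by (simp add: chi_def susceptibility_def)
  also have "\<dots> \<le> (\<Sum>\<^sub>\<infinity>y::int ^ 'd. G {0} 0 y + exit_sum {0} 0 (\<lambda>z. G UNIV z y))"
    by (intro infsum_ennreal_mono first_exit) simp
  also have "\<dots> = (\<Sum>\<^sub>\<infinity>y::int ^ 'd. G {0} 0 y) + (\<Sum>\<^sub>\<infinity>y::int ^ 'd. exit_sum {0} 0 (\<lambda>z. G UNIV z y))"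
    by (rule infsum_add) (auto intro: nonneg_summable_on_complete)
  also have "(\<Sum>\<^sub>\<infinity>y::int ^ 'd. G {0} 0 y) = (\<Sum>\<^sub>\<infinity>y\<in>{0::int ^ 'd}. G {0} 0 y)"
    by (rule infsum_cong_neutral) (auto simp: two_point_outside)
  also have "\<dots> = 1" by (simp add: G_singleton)
  also have "(\<Sum>\<^sub>\<infinity>y::int ^ 'd. exit_sum {0} 0 (\<lambda>z. G UNIV z y)) = exit_sum {0} (0::int ^ 'd) (\<lambda>z. 1 * chi)"
    by (simp only: exit_sum_infsum susceptibility_from chi_def mult_1_left)
  also have "\<dots> = exit_sum {0} (0::int ^ 'd) (\<lambda>_. 1) * chi" by (rule exit_sum_multc)
  also have "\<dots> \<le> ennreal (1 / 2) * chi"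
  proof (rule mult_right_mono)
    have "2 * real CARD('d) * \<beta> \<le> 1 / 2" using small by (simp add: field_simps)
    then show "exit_sum {0} (0::int ^ 'd) (\<lambda>_. 1) \<le> ennreal (1 / 2)"
      using exit_mass_singleton_le[of "0::int ^ 'd"] ennreal_leI order_trans by blast
  qed simp
  finally have *: "chi \<le> 1 + ennreal (1 / 2) * chi" by (simp add: add_left_mono)
  obtain r where r: "chi = ennreal r" "0 \<le> r" using fin by (cases chi) (auto simp: chi_def)
  have "ennreal (1 + 1 / 2 * r) = ennreal 1 + ennreal (1 / 2 * r)" using r by (intro ennreal_plus) auto
  also have "ennreal (1 / 2 * r) = ennreal (1 / 2) * ennreal r" using r by (intro ennreal_mult) auto
  finally have eq: "ennreal (1 + 1 / 2 * r) = 1 + ennreal (1 / 2) * ennreal r" by simp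
  have "ennreal r \<le> ennreal (1 + 1 / 2 * r)" unfolding eq using * r by (simp only:)
  then have "r \<le> 1 + 1 / 2 * r" using r by (subst (asm) ennreal_le_iff) auto
  then have "r \<le> 2" by simp
  then show ?thesis using r by (simp add: chi_def[symmetric] ennreal_leI flip: ennreal_numeral)
qed

end

section \<open>Dependence on \<beta>\<close>

lemma power_times_geometric_bounded:
  fixes r :: real
  assumes "0 \<le> r" "r < 1"
  shows "\<exists>B>0. \<forall>n. (real n + 1) ^ p * r ^ n \<le> B"
  using assms
proof (induction p arbitrary: r)
  case 0
  then show ?case by (intro exI[of _ 1]) (simp add: power_le_one)
next
  case (Suc p)
  \<comment> \<open>Half of the geometric decay is spent on one factor \<open>n + 1\<close>, the
    other half on the induction hypothesis.\<close>
  define t where "t = sqrt r"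
  have t: "0 \<le> t" "t < 1" "r = t * t" using Suc.prems by (auto simp: t_def)
  obtain B where B: "B > 0" "\<And>n. (real n + 1) ^ p * t ^ n \<le> B" using Suc.IH[OF t(1,2)] by blast
  have lin: "(real n + 1) * t ^ n \<le> 1 / (1 - t)" for n
  proof -
    have "(real n + 1) * t ^ n = (\<Sum>k<Suc n. t ^ n)" by simp
    also have "\<dots> \<le> (\<Sum>k<Suc n. t ^ k)" using t by (intro sum_mono power_decreasing) auto
    also have "\<dots> \<le> (\<Sum>k. t ^ k)" using t by (intro sum_le_suminf summable_geometric) auto
    also have "\<dots> = 1 / (1 - t)" using t by (intro suminf_geometric) auto
    finally show ?thesis .
  qed
  have "(real n + 1) ^ Suc p * r ^ n \<le> (1 / (1 - t)) * B" for n
  proof -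
    have "(real n + 1) ^ Suc p * r ^ n = ((real n + 1) * t ^ n) * ((real n + 1) ^ p * t ^ n)"
      by (simp add: t(3) power_mult_distrib)
    also have "\<dots> \<le> (1 / (1 - t)) * B" using lin B t by (intro mult_mono) auto
    finally show ?thesis .
  qed
  moreover have "0 < (1 / (1 - t)) * B" using B t by simp
  ultimately show ?case by blast
qed

lemma paths_length_ge:
  assumes "\<gamma> \<in> paths \<Lambda> x y"
  shows "\<bar>x $ i - y $ i\<bar> \<le> int (num_edges \<gamma>)"
proof -
  have "successively nn_adj \<gamma> \<Longrightarrow> \<gamma> \<noteq> [] \<Longrightarrow> \<bar>hd \<gamma> $ i - last \<gamma> $ i\<bar> \<le> int (length \<gamma> - 1)" for \<gamma> :: "(int ^ 'a) list"
  proof (induction \<gamma> rule: induct_list012)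
    case (3 v w \<gamma>)
    then have "\<bar>v $ i - w $ i\<bar> \<le> 1" by (auto intro: nn_adj_level)
    moreover have "\<bar>w $ i - last (w # \<gamma>) $ i\<bar> \<le> int (length \<gamma>)" using 3 by simp
    ultimately show ?case by simp
  qed auto
  then show ?thesis using assms by (auto simp: paths_def num_edges_def)
qed

text \<open>The derivative of \<open>\<beta> ^ n\<close> is at most \<open>n * c ^ (n - 1)\<close>,
  and the room between \<open>c\<close> and \<open>\<beta>1\<close> absorbs \<open>n\<close> and any
  fixed power of \<open>n + 1\<close> into \<open>\<beta>1 ^ n\<close>. A path has at least as many
  edges as its endpoints differ in coordinate \<open>i\<close>, so the increment decays at any
  polynomial rate. \<open>L\<close> is uniform in \<open>lam\<close>, the domain and the
  endpoints.\<close>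

lemma two_point_lipschitz:
  assumes \<beta>: "0 \<le> c" "c < \<beta>1"
  shows "\<exists>L>0. \<forall>lam \<beta> \<beta>' \<Lambda> (x :: int ^ 'd::finite) y i. 0 \<le> lam \<longrightarrow> lam \<le> 1 \<longrightarrow> 0 \<le> \<beta> \<longrightarrow> \<beta> \<le> \<beta>' \<longrightarrow> \<beta>' \<le> c \<longrightarrow>
    two_point lam \<beta>' \<Lambda> x y \<le> two_point lam \<beta> \<Lambda> x y +
      ennreal ((\<beta>' - \<beta>) * L / (real_of_int \<bar>x $ i - y $ i\<bar> + 1) ^ p) * two_point lam \<beta>1 \<Lambda> x y"
proof -
  define r where "r = c / \<beta>1"
  have r: "0 \<le> r" "r < 1" and b1: "0 < \<beta>1" using \<beta> by (auto simp: r_def)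
  obtain B where B: "B > 0" "\<And>n. (real n + 1) ^ Suc p * r ^ n \<le> B"
    using power_times_geometric_bounded[OF r] by blast
  define L where "L = 2 ^ p * B / \<beta>1"
  have L: "0 < L" using B b1 by (simp add: L_def)
  have key: "real n * c ^ (n - 1) * (real n + 1) ^ p \<le> L * \<beta>1 ^ n" for n
  proof (cases n)
    case 0 then show ?thesis using L by simp
  next
    case (Suc m)
    have "real n + 1 \<le> 2 * (real m + 1)" using Suc by simp
    then have "(real n + 1) ^ p \<le> (2 * (real m + 1)) ^ p" by (intro power_mono) auto
    then have "real n * c ^ (n - 1) * (real n + 1) ^ p \<le> real n * c ^ (n - 1) * (2 * (real m + 1)) ^ p"
      using \<beta> by (intro mult_left_mono) auto
    also have "\<dots> = 2 ^ p * ((real m + 1) ^ Suc p * r ^ m) * \<beta>1 ^ m"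
      unfolding power_mult_distrib using b1 Suc by (simp add: r_def power_divide)
    also have "\<dots> \<le> 2 ^ p * B * \<beta>1 ^ m"
      using B b1 by (intro mult_right_mono mult_left_mono) auto
    also have "\<dots> = L * \<beta>1 ^ n" using b1 Suc by (simp add: L_def)
    finally show ?thesis .
  qed
  have "two_point lam \<beta>' \<Lambda> x y \<le> two_point lam \<beta> \<Lambda> x y +
      ennreal ((\<beta>' - \<beta>) * L / (real_of_int \<bar>x $ i - y $ i\<bar> + 1) ^ p) * two_point lam \<beta>1 \<Lambda> x y"
    if lam: "0 \<le> lam" "lam \<le> 1" and bb: "0 \<le> \<beta>" "\<beta> \<le> \<beta>'" "\<beta>' \<le> c"
    for lam \<beta> \<beta>' \<Lambda> and x y :: "int ^ 'd" and i
  proof -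
    let ?w = "\<lambda>\<beta> \<gamma>. ennreal (\<beta> ^ num_edges \<gamma> * path_weight lam \<gamma>)"
    let ?d = "real_of_int \<bar>x $ i - y $ i\<bar> + 1"
    let ?k = "ennreal ((\<beta>' - \<beta>) * L / ?d ^ p)"
    have "?w \<beta>' \<gamma> \<le> ?w \<beta> \<gamma> + ?k * ?w \<beta>1 \<gamma>" if g: "\<gamma> \<in> paths \<Lambda> x y" for \<gamma>
    proof -
      define n where "n = num_edges \<gamma>"
      have pw: "0 \<le> path_weight lam \<gamma>" using lam by (rule path_weight_nonneg)
      have dn: "?d \<le> real n + 1" "0 < ?d" using paths_length_ge[OF g, of i] by (simp_all add: n_def)
      have "\<beta>' ^ n - \<beta> ^ n = (\<beta>' - \<beta>) * (\<Sum>k<n. \<beta> ^ (n - Suc k) * \<beta>' ^ k)"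
        by (rule power_diff_sumr2)
      also have "\<dots> \<le> (\<beta>' - \<beta>) * (\<Sum>k<n. c ^ (n - 1))"
      proof (intro mult_left_mono sum_mono)
        fix k assume k: "k \<in> {..<n}"
        have "\<beta> ^ (n - Suc k) * \<beta>' ^ k \<le> c ^ (n - Suc k) * c ^ k"
          using bb \<beta> by (intro mult_mono power_mono) auto
        also have "\<dots> = c ^ (n - 1)" using k by (simp flip: power_add)
        finally show "\<beta> ^ (n - Suc k) * \<beta>' ^ k \<le> c ^ (n - 1)" .
      qed (use bb in auto)
      also have "\<dots> = (\<beta>' - \<beta>) * (real n * c ^ (n - 1))" by simp
      also have "\<dots> \<le> (\<beta>' - \<beta>) * (L / ?d ^ p * \<beta>1 ^ n)"
      proof (rule mult_left_mono)
        have "real n * c ^ (n - 1) * ?d ^ p \<le> real n * c ^ (n - 1) * (real n + 1) ^ p"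
          using dn \<beta> by (intro mult_left_mono power_mono) auto
        also have "\<dots> \<le> L * \<beta>1 ^ n" by (rule key)
        finally show "real n * c ^ (n - 1) \<le> L / ?d ^ p * \<beta>1 ^ n" using dn by (simp add: field_simps)
      qed (use bb in auto)
      finally have "\<beta>' ^ n \<le> \<beta> ^ n + (\<beta>' - \<beta>) * L / ?d ^ p * \<beta>1 ^ n" by simp
      then have "\<beta>' ^ n * path_weight lam \<gamma> \<le> (\<beta> ^ n + (\<beta>' - \<beta>) * L / ?d ^ p * \<beta>1 ^ n) * path_weight lam \<gamma>"
        using pw by (rule mult_right_mono)
      also have "\<dots> = \<beta> ^ n * path_weight lam \<gamma> + ((\<beta>' - \<beta>) * L / ?d ^ p) * (\<beta>1 ^ n * path_weight lam \<gamma>)"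
        by (simp add: algebra_simps)
      finally have "?w \<beta>' \<gamma> \<le> ennreal (\<beta> ^ n * path_weight lam \<gamma> + ((\<beta>' - \<beta>) * L / ?d ^ p) * (\<beta>1 ^ n * path_weight lam \<gamma>))"
        by (simp only: n_def[symmetric] ennreal_leI)
      also have "\<dots> = ?w \<beta> \<gamma> + ?k * ?w \<beta>1 \<gamma>"
      proof -
        have 1: "0 \<le> \<beta> ^ n * path_weight lam \<gamma>" using bb pw by simp
        have 2: "0 \<le> (\<beta>' - \<beta>) * L / ?d ^ p" using bb L dn by simp
        have 3: "0 \<le> \<beta>1 ^ n * path_weight lam \<gamma>" using b1 pw by simp
        show ?thesis unfolding n_def[symmetric]
          by (simp only: ennreal_mult[OF 2 3, symmetric] ennreal_plus[OF 1 mult_nonneg_nonneg[OF 2 3], symmetric])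
      qed
      finally show ?thesis .
    qed
    then have "two_point lam \<beta>' \<Lambda> x y \<le> (\<Sum>\<^sub>\<infinity>\<gamma>\<in>paths \<Lambda> x y. ?w \<beta> \<gamma> + ?k * ?w \<beta>1 \<gamma>)"
      unfolding two_point_def by (rule infsum_ennreal_mono)
    also have "\<dots> = two_point lam \<beta> \<Lambda> x y + (\<Sum>\<^sub>\<infinity>\<gamma>\<in>paths \<Lambda> x y. ?k * ?w \<beta>1 \<gamma>)"
      unfolding two_point_def by (rule infsum_add) (auto intro: nonneg_summable_on_complete)
    also have "(\<Sum>\<^sub>\<infinity>\<gamma>\<in>paths \<Lambda> x y. ?k * ?w \<beta>1 \<gamma>) = ?k * two_point lam \<beta>1 \<Lambda> x y"
      unfolding two_point_def by (rule infsum_ennreal_cmult)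
    finally show ?thesis .
  qed
  then show ?thesis using L by blast
qed

lemma two_point_mono_beta:
  assumes "0 \<le> lam" "lam \<le> 1" "0 \<le> \<beta>" "\<beta> \<le> \<beta>'"
  shows "two_point lam \<beta> \<Lambda> x y \<le> two_point lam \<beta>' \<Lambda> x y"
  unfolding two_point_def using assms
  by (intro infsum_ennreal_mono ennreal_leI mult_right_mono power_mono path_weight_nonneg) auto

lemma susceptibility_mono_beta:
  assumes "0 \<le> lam" "lam \<le> 1" "0 \<le> \<beta>" "\<beta> \<le> \<beta>'"
  shows "susceptibility D lam \<beta> \<le> susceptibility D lam \<beta>'"
  unfolding susceptibility_def by (intro infsum_ennreal_mono two_point_mono_beta assms)

text \<open>Finite partial sums are polynomials in \<beta>, hence continuous, and the infinite sum
  is their supremum. The map \<open>f\<close> extracts the path from an index that may also carry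
  its endpoint.\<close>

lemma infsum_paths_left_limit:
  fixes f :: "'a \<Rightarrow> 'b list"
  assumes lam: "0 \<le> lam" "lam \<le> 1" and \<beta>: "0 < \<beta>"
    and le: "\<And>\<beta>'. 0 \<le> \<beta>' \<Longrightarrow> \<beta>' < \<beta> \<Longrightarrow>
      (\<Sum>\<^sub>\<infinity>a\<in>S. ennreal (\<beta>' ^ num_edges (f a) * path_weight lam (f a))) \<le> ennreal c"
  shows "(\<Sum>\<^sub>\<infinity>a\<in>S. ennreal (\<beta> ^ num_edges (f a) * path_weight lam (f a))) \<le> ennreal c"
proof (rule infsum_ennreal_leI)
  fix F assume F: "finite F" "F \<subseteq> S"
  \<comment> \<open>\<open>ennreal\<close> sends a negative \<open>c\<close> to 0, so the comparison
    of reals is made with \<open>max 0 c\<close>.\<close>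
  have max0: "ennreal (max 0 c) = ennreal c" by (simp add: max_def ennreal_neg)
  let ?g = "\<lambda>\<beta>. \<Sum>a\<in>F. \<beta> ^ num_edges (f a) * path_weight lam (f a)"
  have sum_eq: "(\<Sum>a\<in>F. ennreal (\<beta>' ^ num_edges (f a) * path_weight lam (f a))) = ennreal (?g \<beta>')"
    if "0 \<le> \<beta>'" for \<beta>'
    using that lam by (intro sum_ennreal) (simp add: path_weight_nonneg)
  have "?g \<beta>' \<le> max 0 c" if "0 < \<beta>'" "\<beta>' < \<beta>" for \<beta>'
  proof -
    have "ennreal (?g \<beta>') \<le> (\<Sum>\<^sub>\<infinity>a\<in>S. ennreal (\<beta>' ^ num_edges (f a) * path_weight lam (f a)))"
      unfolding sum_eq[OF less_imp_le[OF that(1)], symmetric]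
      using infsum_ennreal_mono_set[OF F(2)] unfolding infsum_finite[OF F(1)] .
    also have "\<dots> \<le> ennreal (max 0 c)"
      using le[of \<beta>'] that by (simp add: max0)
    finally show ?thesis by (simp add: ennreal_le_iff)
  qed
  moreover have "(?g \<longlongrightarrow> ?g \<beta>) (at_left \<beta>)"
    by (intro tendsto_intros)
  moreover have "eventually (\<lambda>\<beta>'. \<beta>' \<in> {0<..<\<beta>}) (at_left \<beta>)"
    using \<beta> by (rule eventually_at_left_real)
  ultimately have "?g \<beta> \<le> max 0 c"
    by (intro tendsto_upperbound[where f = ?g and F = "at_left \<beta>"]) (auto elim: eventually_mono)
  then show "(\<Sum>a\<in>F. ennreal (\<beta> ^ num_edges (f a) * path_weight lam (f a))) \<le> ennreal c"
    unfolding sum_eq[OF less_imp_le[OF \<beta>]] by (metis ennreal_leI max0)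
qed

section \<open>Closing the bootstrap\<close>

lemma (in wsaw) half_space_boundsI:
  assumes "\<And>(i::'d::finite) s c x. \<bar>s\<bar> = 1 \<Longrightarrow> (\<Sum>\<^sub>\<infinity>y\<in>{y. s * y $ i = c}. G (hs i s c) x y) \<le> ennreal A"
    and "\<And>(i::'d) s c x y. \<bar>s\<bar> = 1 \<Longrightarrow> s * y $ i = c \<Longrightarrow> c \<le> s * x $ i \<Longrightarrow>
        G (hs i s c) x y \<le> ennreal (C / (real_of_int (s * x $ i - c) + 1) ^ (CARD('d) - 1))"
  shows "half_space_bounds (D :: 'd itself) A C"
  using assms by (auto simp: half_space_bounds_def)

text \<open>Each boundary point has an exit edge of weight \<beta>, so for \<beta> above
  \<open>1 / (4 * d)\<close>, with \<open>d\<close> the dimension, an exit mass of at most 2 gives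
  the sum bound \<open>8 * d\<close>. In the pointwise bound \<open>C0\<close> is four times what
  the averaged term needs, and the error takes at most \<open>(C0 + 1) / 4 \<le> C0 / 2\<close>;
  together they stay below \<open>C0\<close>.\<close>

lemma (in small_wsaw) half_space_bounds_improved:
  fixes C0 :: real and t :: nat
  assumes A: "A = 8 * real CARD('d) + 1" and C: "C = C0 + 1"
    and C0: "C0 = 4 * A * 2 ^ ((t + 4) * (CARD('d) - 1))"
    and t: "real (CARD('d) - 1) * 4 ^ (CARD('d) - 1) * (2 * q ^ t) \<le> 1 / 8"
    and l: "real (CARD('d) - 1) * 4 ^ (CARD('d) - 1) * (lam * (2 * err)) \<le> 1 / 8"
  shows "half_space_bounds D (8 * real CARD('d)) C0"
proof -
  let ?D = "CARD('d) - 1"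
  have A0: "0 < A" using A by simp
  have d: "1 \<le> real CARD('d)" using dim by simp
  have bsum: "(\<Sum>\<^sub>\<infinity>y\<in>{y. s * y $ i = c}. G (hs i s c) x y) \<le> ennreal (8 * real CARD('d))"
    if s: "\<bar>s\<bar> = 1" for i :: 'd and s c x
  proof (cases "\<beta> \<le> 1 / (4 * real CARD('d))")
    case True
    have "(\<Sum>\<^sub>\<infinity>y\<in>{y. s * y $ i = c}. G (hs i s c) x y) \<le> (\<Sum>\<^sub>\<infinity>y. G UNIV x y)"
      by (rule order_trans[OF infsum_ennreal_mono_set[OF subset_UNIV]])
         (intro infsum_ennreal_mono two_point_mono_set, simp)
    also have "\<dots> \<le> 2" unfolding susceptibility_from by (rule susceptibility_le_2[OF fin True])
    also have "2 = ennreal 2" by simp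
    also have "\<dots> \<le> ennreal (8 * real CARD('d))" by (rule ennreal_leI) (use d in linarith)
    finally show ?thesis .
  next
    case False
    have ex: "exit_sum (hs i s c) x (\<lambda>_. 1) \<le> ennreal 2"
    proof -
      have le4d: "exit_sum (hs_Inter {(i, s, c)}) x (\<lambda>_. 1) \<le> ennreal (1 + 1 / real (4 * CARD('d)))"
        using s dim by (intro exit_mass_hs_Inter) auto
      have "1 \<le> 4 * real CARD('d)" using d by linarith
      then have "1 / real (4 * CARD('d)) \<le> 1" by (simp add: divide_le_eq_1)
      then have "ennreal (1 + 1 / real (4 * CARD('d))) \<le> ennreal 2" by (intro ennreal_leI) simp
      then show ?thesis using order_trans[OF le4d] by (simp add: hs_Inter_def)
    qed
    have "(\<Sum>\<^sub>\<infinity>y\<in>{y. s * y $ i = c}. G (hs i s c) x y) * b = (\<Sum>\<^sub>\<infinity>y\<in>{y. s * y $ i = c}. G (hs i s c) x y * b)"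
      by (rule infsum_ennreal_multc[symmetric])
    also have "\<dots> \<le> exit_sum (hs i s c) x (\<lambda>_. 1)"
      unfolding exit_sum_def
    proof (rule infsum_ennreal_inj_le[where h = "\<lambda>y. (y, y - axis i s)"])
      show "(\<lambda>y. (y, y - axis i s)) ` {y. s * y $ i = c} \<subseteq> out_edges (hs i s c)"
      proof clarify
        fix y :: "int ^ 'd" assume y: "c = s * y $ i"
        have "nn_adj y (y - axis i s)" unfolding nn_adj_iff
          using s by (intro exI[of _ i] exI[of _ "- s"]) (auto simp: vec_eq_iff axis_def)
        moreover have "s * (y - axis i s) $ i = c - 1"
          using s y by (auto simp: axis_def abs_one_cases)
        ultimately show "(y, y - axis i s) \<in> out_edges (hs i s (s * y $ i))"
          using y by (simp add: out_edges_def hs_def)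
      qed
    qed (auto simp: inj_on_def)
    finally have le: "(\<Sum>\<^sub>\<infinity>y\<in>{y. s * y $ i = c}. G (hs i s c) x y) * b \<le> ennreal 2"
      using ex by simp
    have d4: "0 < 1 / (4 * real CARD('d))" by simp
    have b0: "0 < \<beta>" using False d4 by linarith
    moreover have "1 / \<beta> \<le> 1 / (1 / (4 * real CARD('d)))"
      using False d4 b0 by (intro divide_left_mono) auto
    ultimately have b0: "0 < \<beta>" "1 / \<beta> \<le> 4 * real CARD('d)" by simp_all
    have "(\<Sum>\<^sub>\<infinity>y\<in>{y. s * y $ i = c}. G (hs i s c) x y) * b * ennreal (1 / \<beta>) \<le> ennreal 2 * ennreal (4 * real CARD('d))"
      using le b0 by (intro mult_mono ennreal_leI) auto
    moreover have "b * ennreal (1 / \<beta>) = 1" using b0 by (simp add: ennreal_mult[symmetric])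
    moreover have "ennreal 2 * ennreal (4 * real CARD('d)) = ennreal (8 * real CARD('d))"
      by (subst ennreal_mult[symmetric]) auto
    ultimately show ?thesis by (simp only: mult.assoc mult_1_right)
  qed
  show ?thesis
  proof (rule half_space_boundsI)
    fix i :: 'd and s c :: int and x y :: "int ^ 'd" assume s: "\<bar>s\<bar> = 1" and y: "s * y $ i = c" and x: "c \<le> s * x $ i"
    define n where "n = nat (s * x $ i - c)"
    have n: "s * x $ i = c + int n" "real_of_int (s * x $ i - c) = real n" using x by (simp_all add: n_def)
    have C01: "1 \<le> C0" using C0 A by (simp add: one_le_power mult_ge1_I)
    show "G (hs i s c) x y \<le> ennreal (C0 / (real_of_int (s * x $ i - c) + 1) ^ ?D)"
    \<comment> \<open>At distances too short for \<open>t\<close> scales the sum bound alone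
      suffices: \<open>C0\<close> contains the power \<open>2 ^ (t + 4)\<close> for this
      purpose.\<close>
    proof (cases "n < 2 ^ (t + 2)")
      case True
      have "G (hs i s c) x y \<le> (\<Sum>\<^sub>\<infinity>y\<in>{y. s * y $ i = c}. G (hs i s c) x y)"
        using y by (intro infsum_ennreal_member_le) simp
      also have "\<dots> \<le> ennreal A" by (rule boundary_sum_le[OF s])
      also have "A \<le> C0 / (real n + 1) ^ ?D"
      proof -
        have "real (n + 1) \<le> real (2 ^ (t + 2))" using True by (intro of_nat_mono) simp
        also have "\<dots> \<le> 2 ^ (t + 4)" by (simp add: power_add)
        finally have "(real n + 1) ^ ?D \<le> (2 ^ (t + 4)) ^ ?D" by (intro power_mono) auto
        also have "\<dots> = 2 ^ ((t + 4) * ?D)" by (rule power_mult[symmetric])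
        finally have "A * (real n + 1) ^ ?D \<le> A * 2 ^ ((t + 4) * ?D)" using A0 by simp
        also have "\<dots> \<le> C0" using A0 by (simp add: C0)
        finally show ?thesis by (simp add: field_simps)
      qed
      finally show ?thesis using n by (simp add: ennreal_leI)
    next
      case False
      \<comment> \<open>The averaging box is so small that \<open>t\<close> doublings starting from
        its size fit into half of the height.\<close>
      define N where "N = n div 2 ^ (t + 2)"
      have N1: "1 \<le> N" using False by (simp add: N_def div_greater_zero_iff Suc_le_eq)
      have Nn: "N * 2 ^ (t + 2) \<le> n" by (simp add: N_def)
      have "2 ^ t * N * 4 \<le> n" using Nn by (simp add: power_add mult_ac)
      then have "2 ^ t * N \<le> n div 2" by linarith
      then have tN: "(2 ^ t - 1) * N \<le> n div 2" by (simp add: diff_mult_distrib)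
      have "(1::nat) \<le> 2 ^ (t + 2)" by simp
      then have n1: "1 \<le> n" using False by linarith
      have "n < (N + 1) * 2 ^ (t + 2)" unfolding N_def
        using dividend_less_div_times[of "2 ^ (t + 2)" n] by (simp only: distrib_right mult_1_left) simp
      also have "\<dots> \<le> (4 * N) * 2 ^ (t + 2)" using N1 by (intro mult_right_mono) auto
      also have "\<dots> = N * 2 ^ (t + 4)" by (simp add: power_add)
      finally have "real (n + 1) \<le> real (N * 2 ^ (t + 4))" by (intro of_nat_mono) simp
      then have nN: "(real n + 1) / 2 ^ (t + 4) \<le> real N" by (simp add: field_simps)
      have "G (hs i s c) x y \<le> ennreal (A / real N ^ ?D +
         real ?D * ((2 * q ^ t + lam * (2 * err)) * (C * 4 ^ ?D / (real n + 1) ^ ?D)))"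
        by (rule boundary_point_improved[OF s y n(1) n1 N1 tN])
      also have "\<dots> \<le> ennreal (C0 / (real n + 1) ^ ?D)"
      proof (rule ennreal_leI)
        let ?X = "(real n + 1) ^ ?D"
        have X: "0 < ?X" by simp
        have "((real n + 1) / 2 ^ (t + 4)) ^ ?D \<le> real N ^ ?D" using nN by (intro power_mono) auto
        then have "A / real N ^ ?D \<le> A / ((real n + 1) / 2 ^ (t + 4)) ^ ?D"
          using A0 N1 by (intro divide_left_mono mult_pos_pos zero_less_power) auto
        also have "\<dots> = C0 / 4 / ?X" by (simp add: C0 power_divide power_mult)
        finally have 1: "A / real N ^ ?D \<le> C0 / 4 / ?X" .
        have "real ?D * ((2 * q ^ t + lam * (2 * err)) * (C * 4 ^ ?D / ?X)) =
          (real ?D * 4 ^ ?D * (2 * q ^ t) + real ?D * 4 ^ ?D * (lam * (2 * err))) * (C / ?X)"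
        proof -
          have "a * ((x + y) * (c * f / X)) = (a * f * x + a * f * y) * (c / X)" for a x y c f X :: real
            by (simp add: algebra_simps add_divide_distrib)
          then show ?thesis by blast
        qed
        also have "\<dots> \<le> (1 / 8 + 1 / 8) * (C / ?X)"
          using t l C C01 by (intro mult_right_mono add_mono) auto
        also have "\<dots> \<le> C0 / 2 / ?X" using C C01 by (simp add: field_simps)
        finally have "A / real N ^ ?D + real ?D * ((2 * q ^ t + lam * (2 * err)) * (C * 4 ^ ?D / ?X)) \<le>
          C0 / 4 / ?X + C0 / 2 / ?X" using 1 by linarith
        also have "\<dots> \<le> C0 / ?X" using C01 by (simp add: field_simps)
        finally show "A / real N ^ ?D + real ?D * ((2 * q ^ t + lam * (2 * err)) * (C * 4 ^ ?D / ?X)) \<le> C0 / ?X" .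
      qed
      finally show ?thesis using n by simp
    qed
  qed (use bsum in blast)
qed

text \<open>The susceptibility at \<open>\<beta>1\<close> dominates both the boundary sums and the
  single values there, so both constants grow by at most \<open>(\<beta>' - \<beta>) * L\<close>. As
  \<open>L\<close> is chosen before \<open>A\<close> and \<open>C\<close>, the same step length can
  be used again after each improvement.\<close>

lemma half_space_bounds_step:
  fixes D :: "'d::finite itself"
  assumes lam: "0 \<le> lam" "lam \<le> 1" and c: "0 \<le> c" "c < \<beta>1"
    and fin: "susceptibility TYPE('d) lam \<beta>1 < \<infinity>"
  shows "\<exists>L>0. \<forall>\<beta> \<beta>' A C. 0 \<le> A \<longrightarrow> 0 \<le> C \<longrightarrow> 0 \<le> \<beta> \<longrightarrow> \<beta> \<le> \<beta>' \<longrightarrow> \<beta>' \<le> c \<longrightarrow> (\<beta>' - \<beta>) * L \<le> 1 \<longrightarrow>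
    wsaw.half_space_bounds lam \<beta> D A C \<longrightarrow> wsaw.half_space_bounds lam \<beta>' D (A + 1) (C + 1)"
proof -
  let ?D = "CARD('d) - 1"
  obtain L0 where L0: "L0 > 0" and lip: "\<And>\<beta> \<beta>' \<Lambda> (x :: int ^ 'd) y i. 0 \<le> \<beta> \<Longrightarrow> \<beta> \<le> \<beta>' \<Longrightarrow> \<beta>' \<le> c \<Longrightarrow>
    two_point lam \<beta>' \<Lambda> x y \<le> two_point lam \<beta> \<Lambda> x y +
      ennreal ((\<beta>' - \<beta>) * L0 / (real_of_int \<bar>x $ i - y $ i\<bar> + 1) ^ ?D) * two_point lam \<beta>1 \<Lambda> x y"
    using two_point_lipschitz[OF c, of ?D] lam by blast
  interpret W1: wsaw lam \<beta>1 using lam c by unfold_locales auto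
  obtain X where X: "susceptibility TYPE('d) lam \<beta>1 = ennreal X" "0 \<le> X"
    using fin by (cases "susceptibility TYPE('d) lam \<beta>1") auto
  define L where "L = L0 * (X + 1)"
  have L: "0 < L" using L0 X by (simp add: L_def)
  have step: "wsaw.half_space_bounds lam \<beta>' D (A + 1) (C + 1)"
    if AC: "0 \<le> A" "0 \<le> C" and \<beta>: "0 \<le> \<beta>" "\<beta> \<le> \<beta>'" "\<beta>' \<le> c" "(\<beta>' - \<beta>) * L \<le> 1"
      and hyp: "wsaw.half_space_bounds lam \<beta> D A C" for \<beta> \<beta>' A C
  proof -
    interpret W: wsaw lam \<beta> using lam \<beta> by unfold_locales auto
    interpret W': wsaw lam \<beta>' using lam \<beta> by unfold_locales auto
    define e where "e = (\<beta>' - \<beta>) * L0"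
    have e0: "0 \<le> e" using \<beta> L0 by (simp add: e_def)
    have "e * X \<le> (\<beta>' - \<beta>) * L" unfolding e_def L_def mult.assoc
      using \<beta> L0 X by (intro mult_left_mono) auto
    then have eX: "e * X \<le> 1" using \<beta> by linarith
    have sum1: "(\<Sum>\<^sub>\<infinity>y\<in>Y. two_point lam \<beta>1 \<Lambda> x y) \<le> ennreal X" for x :: "int ^ 'd" and Y \<Lambda>
    proof -
      have "(\<Sum>\<^sub>\<infinity>y\<in>Y. two_point lam \<beta>1 \<Lambda> x y) \<le> (\<Sum>\<^sub>\<infinity>y. two_point lam \<beta>1 UNIV x y)"
        by (rule order_trans[OF infsum_ennreal_mono_set[OF subset_UNIV]])
           (intro infsum_ennreal_mono two_point_mono_set, simp)
      then show ?thesis by (simp add: W1.susceptibility_from X)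
    qed
    have pt1: "two_point lam \<beta>1 \<Lambda> x y \<le> ennreal X" for x y :: "int ^ 'd" and \<Lambda>
      using sum1[of \<Lambda> x "{y}"] by simp
    show ?thesis
    proof (rule W'.half_space_boundsI)
      fix i :: 'd and s c' :: int and x :: "int ^ 'd" assume s: "\<bar>s\<bar> = 1"
      let ?Y = "{y. s * y $ i = c'}" and ?H = "hs i s c'"
      have "(\<Sum>\<^sub>\<infinity>y\<in>?Y. two_point lam \<beta>' ?H x y) \<le>
          (\<Sum>\<^sub>\<infinity>y\<in>?Y. two_point lam \<beta> ?H x y + ennreal e * two_point lam \<beta>1 ?H x y)"
      proof (rule infsum_ennreal_mono)
        fix y
        have "1 \<le> (real_of_int \<bar>x $ i - y $ i\<bar> + 1) ^ ?D" by (rule one_le_power) simp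
        then have "e / (real_of_int \<bar>x $ i - y $ i\<bar> + 1) ^ ?D \<le> e / 1"
          using e0 by (intro divide_left_mono) auto
        then have "ennreal (e / (real_of_int \<bar>x $ i - y $ i\<bar> + 1) ^ ?D) * two_point lam \<beta>1 ?H x y \<le>
            ennreal e * two_point lam \<beta>1 ?H x y"
          by (intro mult_right_mono ennreal_leI) auto
        then show "two_point lam \<beta>' ?H x y \<le> two_point lam \<beta> ?H x y + ennreal e * two_point lam \<beta>1 ?H x y"
          using lip[OF \<beta>(1-3), of ?H x y i] unfolding e_def by (meson add_left_mono order_trans)
      qed
      also have "\<dots> = (\<Sum>\<^sub>\<infinity>y\<in>?Y. two_point lam \<beta> ?H x y) + (\<Sum>\<^sub>\<infinity>y\<in>?Y. ennreal e * two_point lam \<beta>1 ?H x y)"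
        by (rule infsum_add) (auto intro: nonneg_summable_on_complete)
      also have "(\<Sum>\<^sub>\<infinity>y\<in>?Y. ennreal e * two_point lam \<beta>1 ?H x y) = ennreal e * (\<Sum>\<^sub>\<infinity>y\<in>?Y. two_point lam \<beta>1 ?H x y)"
        by (rule infsum_ennreal_cmult)
      also have "(\<Sum>\<^sub>\<infinity>y\<in>?Y. two_point lam \<beta> ?H x y) + ennreal e * (\<Sum>\<^sub>\<infinity>y\<in>?Y. two_point lam \<beta>1 ?H x y) \<le>
          ennreal A + ennreal e * ennreal X"
        using hyp s by (intro add_mono mult_left_mono sum1) (auto simp: W.half_space_bounds_def)
      also have "\<dots> = ennreal (A + e * X)"
        using AC e0 X by (simp add: ennreal_mult)
      also have "\<dots> \<le> ennreal (A + 1)" using eX by (intro ennreal_leI) simp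
      finally show "(\<Sum>\<^sub>\<infinity>y\<in>?Y. two_point lam \<beta>' ?H x y) \<le> ennreal (A + 1)" .
    next
      fix i :: 'd and s c' :: int and x y :: "int ^ 'd" assume s: "\<bar>s\<bar> = 1" and y: "s * y $ i = c'" and x: "c' \<le> s * x $ i"
      let ?H = "hs i s c'"
      let ?X = "(real_of_int (s * x $ i - c') + 1) ^ ?D"
      have "\<bar>x $ i - y $ i\<bar> = \<bar>s * x $ i - s * y $ i\<bar>"
        using s by (simp add: right_diff_distrib[symmetric] abs_mult)
      then have dist: "\<bar>x $ i - y $ i\<bar> = s * x $ i - c'" using y x by simp
      have X0: "0 < ?X"
      proof -
        have "0 \<le> real_of_int (s * x $ i - c')" using x by (subst of_int_0_le_iff) simp
        then show ?thesis by (intro zero_less_power) linarith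
      qed
      have "two_point lam \<beta>' ?H x y \<le> two_point lam \<beta> ?H x y +
          ennreal ((\<beta>' - \<beta>) * L0 / (real_of_int \<bar>x $ i - y $ i\<bar> + 1) ^ ?D) * two_point lam \<beta>1 ?H x y"
        by (rule lip[OF \<beta>(1-3)])
      also have "\<dots> = two_point lam \<beta> ?H x y + ennreal (e / ?X) * two_point lam \<beta>1 ?H x y"
        by (simp only: dist e_def)
      also have "\<dots> \<le> ennreal (C / ?X) + ennreal (e / ?X) * ennreal X"
        using hyp s x y by (intro add_mono mult_left_mono pt1) (auto simp: W.half_space_bounds_def)
      also have "\<dots> = ennreal (C / ?X + e / ?X * X)"
        using AC e0 X X0 by (simp only: ennreal_mult[symmetric] ennreal_plus[symmetric]
            divide_nonneg_pos mult_nonneg_nonneg)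
      also have "C / ?X + e / ?X * X = (C + e * X) / ?X" by (simp add: add_divide_distrib)
      also have "ennreal \<dots> \<le> ennreal ((C + 1) / ?X)"
        using eX X0 by (intro ennreal_leI divide_right_mono) auto
      finally show "two_point lam \<beta>' ?H x y \<le> ennreal ((C + 1) / ?X)" .
    qed
  qed
  then show ?thesis using L by blast
qed

lemma half_space_bounds_zero:
  fixes D :: "'d::finite itself"
  assumes lam: "0 \<le> lam" "lam \<le> 1" and AC: "1 \<le> A" "1 \<le> C"
  shows "wsaw.half_space_bounds lam 0 D A C"
proof -
  interpret wsaw lam 0 using lam by unfold_locales auto
  have G0: "G \<Lambda> x y \<le> (if x = y then 1 else 0)" for \<Lambda> and x y :: "int ^ 'd"
  proof -
    have "G \<Lambda> x y \<le> G {x} x y + exit_sum {x} x (\<lambda>z. G \<Lambda> z y)" by (rule first_exit) simp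
    also have "exit_sum {x} x (\<lambda>z. G \<Lambda> z y) = 0" by (simp add: exit_sum_def case_prod_unfold)
    finally show ?thesis by (auto simp: G_singleton two_point_outside)
  qed
  show ?thesis
  proof (rule half_space_boundsI)
    fix i :: 'd and s c :: int and x :: "int ^ 'd"
    have "(\<Sum>\<^sub>\<infinity>y\<in>{y. s * y $ i = c}. G (hs i s c) x y) \<le> (\<Sum>\<^sub>\<infinity>y. if x = y then 1 else 0)"
      by (rule order_trans[OF infsum_ennreal_mono_set[OF subset_UNIV]])
         (intro infsum_ennreal_mono G0)
    also have "\<dots> = (\<Sum>\<^sub>\<infinity>y\<in>{x}. 1)" by (rule infsum_cong_neutral) auto
    also have "\<dots> = ennreal 1" by simp
    also have "\<dots> \<le> ennreal A" using AC by (intro ennreal_leI) simp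
    finally show "(\<Sum>\<^sub>\<infinity>y\<in>{y. s * y $ i = c}. G (hs i s c) x y) \<le> ennreal A" .
  next
    fix i :: 'd and s c :: int and x y :: "int ^ 'd" assume "s * y $ i = c"
    then show "G (hs i s c) x y \<le> ennreal (C / (real_of_int (s * x $ i - c) + 1) ^ (CARD('d) - 1))"
      using G0[of "hs i s c" x y] AC by (cases "x = y") (auto intro: order_trans simp flip: ennreal_1)
  qed
qed

text \<open>Starting from \<beta> = 0, each step raises the two constants by at most 1, and the
  improvement brings them back. The number of steps depends on \<open>\<beta>1\<close>;
  \<open>C\<close> and \<open>lam0\<close> do not.\<close>

lemma half_space_bounds_subcritical:
  fixes D :: "'d::finite itself"
  assumes dim: "CARD('d) > 4"
  shows "\<exists>C lam0. 1 \<le> C \<and> 0 < lam0 \<and> (\<forall>lam \<beta> \<beta>1. 0 \<le> lam \<longrightarrow> lam \<le> 1 \<longrightarrow> lam < lam0 \<longrightarrow> 0 \<le> \<beta> \<longrightarrow> \<beta> < \<beta>1 \<longrightarrow>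
    susceptibility TYPE('d) lam \<beta>1 < \<infinity> \<longrightarrow> wsaw.half_space_bounds lam \<beta> D (8 * real CARD('d)) C)"
proof -
  let ?d = "real CARD('d)" and ?D = "CARD('d) - 1"
  define q where "q = 1 - 1 / real (4 * CARD('d))"
  have d: "1 \<le> ?d" using dim by linarith
  have D0: "0 < real ?D" using dim by simp
  have "q < 1" by (simp add: q_def)
  moreover have "0 < 1 / (16 * real ?D * 4 ^ ?D)" using D0 by simp
  ultimately obtain t where "q ^ t < 1 / (16 * real ?D * 4 ^ ?D)"
    using real_arch_pow_inv by blast
  then have t: "real ?D * 4 ^ ?D * (2 * q ^ t) \<le> 1 / 8"
    using D0 by (simp add: field_simps)
  define A where "A = 8 * ?d + 1"
  define C where "C = 4 * A * 2 ^ ((t + 4) * ?D)"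
  have A1: "1 \<le> A" using d by (simp add: A_def)
  have "1 * 1 \<le> (4 * A) * 2 ^ ((t + 4) * ?D)" using A1 by (intro mult_mono) auto
  then have C1: "1 \<le> C" by (simp add: C_def)
  \<comment> \<open>The value of \<open>err\<close> for the weakened bounds \<open>A\<close> and
    \<open>C + 1\<close> that hold just before each improvement.\<close>
  define E where "E = 4 * A ^ 5 * (C + 1)"
  have E0: "0 < E" using A1 C1 by (simp add: E_def)
  \<comment> \<open>The first bound yields the condition \<open>small\<close> of
    \<open>small_wsaw\<close>, the second makes the reversal error in the reflection argument at
    most 1/8.\<close>
  define lam0 where "lam0 = min (1 / (8 * ?d ^ 2 * E)) (1 / (16 * real ?D * 4 ^ ?D * E))"
  have lam0: "0 < lam0" using d D0 E0 by (auto simp: lam0_def)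
  have main: "wsaw.half_space_bounds lam \<beta> D (8 * ?d) C"
    if lam: "0 \<le> lam" "lam \<le> 1" "lam < lam0" and \<beta>: "0 \<le> \<beta>" "\<beta> < \<beta>1"
      and fin: "susceptibility TYPE('d) lam \<beta>1 < \<infinity>" for lam \<beta> \<beta>1
  proof -
    have l1: "lam * real (2 * CARD('d)) * E \<le> 1 / real (4 * CARD('d))"
    proof -
      have "lam \<le> 1 / (8 * ?d ^ 2 * E)" using lam by (simp add: lam0_def)
      then have "lam * (2 * ?d * E) \<le> 1 / (8 * ?d ^ 2 * E) * (2 * ?d * E)"
        using d E0 by (intro mult_right_mono) auto
      also have "\<dots> = 1 / (4 * ?d)" using d E0 by (simp add: power2_eq_square)
      finally show ?thesis by (simp add: mult_ac)
    qed
    have l2: "real ?D * 4 ^ ?D * (lam * (2 * E)) \<le> 1 / 8"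
    proof -
      have "lam \<le> 1 / (16 * real ?D * 4 ^ ?D * E)" using lam by (simp add: lam0_def)
      then have "lam * (real ?D * 4 ^ ?D * 2 * E) \<le> 1 / (16 * real ?D * 4 ^ ?D * E) * (real ?D * 4 ^ ?D * 2 * E)"
        using D0 E0 by (intro mult_right_mono) auto
      also have "\<dots> = 1 / 8" using D0 E0 by simp
      finally show ?thesis by (simp add: mult_ac)
    qed
    have improve: "wsaw.half_space_bounds lam \<beta>' D (8 * ?d) C"
      if "0 \<le> \<beta>'" "\<beta>' \<le> \<beta>" and hyp: "wsaw.half_space_bounds lam \<beta>' D A (C + 1)" for \<beta>'
    proof -
      have fin': "susceptibility TYPE('d) lam \<beta>' < \<infinity>"
        using susceptibility_mono_beta[of lam \<beta>' \<beta>1 "TYPE('d)"] lam that \<beta> fin by (auto intro: le_less_trans)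
      interpret W: wsaw lam \<beta>' using lam that by unfold_locales auto
      interpret B: bounded_wsaw lam \<beta>' A "C + 1" D
        using A1 C1 hyp dim by unfold_locales auto
      have err: "B.err = E" by (simp add: B.err_def E_def)
      interpret S: small_wsaw lam \<beta>' A "C + 1" D
        using fin' l1 by unfold_locales (auto simp: err)
      have q: "S.q = q" by (simp add: S.q_def q_def)
      show ?thesis
        by (rule S.half_space_bounds_improved[where t = t, unfolded q err, OF A_def refl C_def t l2])
    qed
    obtain L where L: "L > 0" and step: "\<And>\<beta>a \<beta>b A C. 0 \<le> A \<Longrightarrow> 0 \<le> C \<Longrightarrow> 0 \<le> \<beta>a \<Longrightarrow> \<beta>a \<le> \<beta>b \<Longrightarrow> \<beta>b \<le> \<beta> \<Longrightarrow>
       (\<beta>b - \<beta>a) * L \<le> 1 \<Longrightarrow> wsaw.half_space_bounds lam \<beta>a D A C \<Longrightarrow> wsaw.half_space_bounds lam \<beta>b D (A + 1) (C + 1)"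
      using half_space_bounds_step[OF lam(1,2) \<beta> fin, of D] by blast
    obtain m :: nat where m: "\<beta> * L < real m" using reals_Archimedean2 by blast
    have m0: "0 < real m" using m \<beta> L by (meson le_less_trans less_imp_le mult_nonneg_nonneg)
    have "wsaw.half_space_bounds lam (\<beta> * real k / real m) D (8 * ?d) C" if "k \<le> m" for k
      using that
    proof (induction k)
      case 0
      then show ?case using half_space_bounds_zero[OF lam(1,2), of "8 * ?d" C D] d C1 by simp
    next
      case (Suc k)
      let ?a = "\<beta> * real k / real m" and ?b = "\<beta> * real (Suc k) / real m"
      have b: "?b \<le> \<beta>"
        using Suc.prems \<beta> m0 by (simp add: divide_le_eq mult_left_mono del: of_nat_Suc)
      have ab: "?a \<le> ?b" using \<beta> m0 by (intro divide_right_mono mult_left_mono) auto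
      have "(?b - ?a) * L = \<beta> * L / real m" by (simp add: algebra_simps add_divide_distrib)
      also have "\<dots> \<le> 1" using m m0 by simp
      finally have small: "(?b - ?a) * L \<le> 1" .
      have "wsaw.half_space_bounds lam ?b D (8 * ?d + 1) (C + 1)"
        using Suc C1 d \<beta> m0 by (intro step[OF _ _ _ ab b small]) auto
      then show ?case using b \<beta> m0 by (intro improve) (auto simp: A_def)
    qed
    from this[of m] show ?thesis using m0 by simp
  qed
  show ?thesis using C1 lam0 main by blast
qed

lemma half_space_bounds_critical:
  fixes D :: "'d::finite itself"
  assumes lam: "0 \<le> lam" "lam \<le> 1" and A: "1 \<le> A" "1 \<le> C" and \<beta>: "0 \<le> \<beta>" "ereal \<beta> \<le> crit_beta TYPE('d) lam"
    and sub: "\<And>\<beta>' \<beta>1. 0 \<le> \<beta>' \<Longrightarrow> \<beta>' < \<beta>1 \<Longrightarrow> susceptibility TYPE('d) lam \<beta>1 < \<infinity> \<Longrightarrow>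
      wsaw.half_space_bounds lam \<beta>' D A C"
  shows "wsaw.half_space_bounds lam \<beta> D A C"
proof (cases "\<beta> = 0")
  case True then show ?thesis using half_space_bounds_zero[OF lam A] by simp
next
  case False
  then have \<beta>0: "0 < \<beta>" using \<beta> by simp
  interpret W: wsaw lam \<beta> using lam \<beta> by unfold_locales auto
  have below: "wsaw.half_space_bounds lam \<beta>' D A C" if "0 \<le> \<beta>'" "\<beta>' < \<beta>" for \<beta>'
  proof -
    have "ereal \<beta>' < crit_beta TYPE('d) lam" using that \<beta> by (meson ereal_less(2) less_ereal.simps(1) less_le_trans)
    then obtain \<beta>1 where "\<beta>' < \<beta>1" "susceptibility TYPE('d) lam \<beta>1 < \<infinity>"
      unfolding crit_beta_def less_Sup_iff by auto
    then show ?thesis using sub that by blast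
  qed
  show ?thesis
  proof (rule W.half_space_boundsI)
    fix i :: 'd and s c :: int and x :: "int ^ 'd" assume s: "\<bar>s\<bar> = 1"
    let ?Y = "{y. s * y $ i = c}"
    have eq: "(\<Sum>\<^sub>\<infinity>y\<in>?Y. two_point lam \<beta>' (hs i s c) x y) =
        (\<Sum>\<^sub>\<infinity>p\<in>Sigma ?Y (paths (hs i s c) x). ennreal (\<beta>' ^ num_edges (snd p) * path_weight lam (snd p)))" for \<beta>'
      unfolding two_point_def by (subst infsum_ennreal_Sigma[symmetric]) (simp add: case_prod_unfold)
    show "(\<Sum>\<^sub>\<infinity>y\<in>?Y. two_point lam \<beta> (hs i s c) x y) \<le> ennreal A"
      unfolding eq
    proof (rule infsum_paths_left_limit[OF lam \<beta>0])
      fix \<beta>' assume b: "0 \<le> \<beta>'" "\<beta>' < \<beta>"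
      interpret W': wsaw lam \<beta>' using lam b by unfold_locales auto
      show "(\<Sum>\<^sub>\<infinity>p\<in>Sigma ?Y (paths (hs i s c) x). ennreal (\<beta>' ^ num_edges (snd p) * path_weight lam (snd p))) \<le> ennreal A"
        using below[OF b] s unfolding eq[symmetric] W'.half_space_bounds_def by blast
    qed
  next
    fix i :: 'd and s c :: int and x y :: "int ^ 'd" assume s: "\<bar>s\<bar> = 1" "s * y $ i = c" "c \<le> s * x $ i"
    let ?B = "C / (real_of_int (s * x $ i - c) + 1) ^ (CARD('d) - 1)"
    have "(\<Sum>\<^sub>\<infinity>\<gamma>\<in>paths (hs i s c) x y. ennreal (\<beta> ^ num_edges (id \<gamma>) * path_weight lam (id \<gamma>))) \<le> ennreal ?B"
    proof (rule infsum_paths_left_limit[OF lam \<beta>0])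
      fix \<beta>' assume b: "0 \<le> \<beta>'" "\<beta>' < \<beta>"
      interpret W': wsaw lam \<beta>' using lam b by unfold_locales auto
      have "two_point lam \<beta>' (hs i s c) x y \<le> ennreal ?B"
        using below[OF b] s unfolding W'.half_space_bounds_def by blast
      then show "(\<Sum>\<^sub>\<infinity>\<gamma>\<in>paths (hs i s c) x y. ennreal (\<beta>' ^ num_edges (id \<gamma>) * path_weight lam (id \<gamma>))) \<le> ennreal ?B"
        by (simp add: two_point_def)
    qed
    then show "two_point lam \<beta> (hs i s c) x y \<le> ennreal ?B" by (simp add: two_point_def)
  qed
qed

section \<open>Exponential decay\<close>

context wsaw begin

text \<open>Leaving a cube brings the walk at most \<open>k + 1\<close> closer to \<open>x\<close>
  in coordinate \<open>j\<close> and costs the factor \<open>e\<close>. The last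
  \<open>\<rho>\<close> units of distance are not crossed, so that a bound \<open>c\<close> valid
  only at distance at least \<open>\<rho>\<close> can end the iteration.\<close>

lemma iterated_cube_exit:
  fixes f :: "int ^ 'd::finite \<Rightarrow> ennreal" and x :: "int ^ 'd"
  assumes s: "\<bar>s\<bar> = 1"
    and exit: "\<And>u. x \<notin> cube u k \<Longrightarrow> f u \<le> exit_sum (cube u k) u f"
    and mass: "\<And>u :: int ^ 'd. exit_sum (cube u k) u (\<lambda>_. 1) \<le> ennreal e"
    and e: "0 \<le> e" and \<rho>: "0 \<le> \<rho>"
    and bnd: "\<And>v. \<rho> \<le> s * (v $ j - x $ j) \<Longrightarrow> f v \<le> ennreal c" and c: "0 \<le> c"
  shows "\<rho> + int m * (int k + 1) \<le> s * (u $ j - x $ j) \<Longrightarrow> f u \<le> ennreal (e ^ m * c)"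
proof (induction m arbitrary: u)
  case 0 then show ?case using bnd by simp
next
  case (Suc m)
  have far: "int k + 1 \<le> s * (u $ j - x $ j)"
  proof -
    have "0 \<le> int m * (int k + 1)" by simp
    moreover have "int (Suc m) * (int k + 1) = int m * (int k + 1) + (int k + 1)"
      by (simp add: algebra_simps)
    ultimately show ?thesis using Suc.prems \<rho> by linarith
  qed
  have "\<bar>x $ j - u $ j\<bar> = \<bar>s * (u $ j - x $ j)\<bar>" using s by (simp add: abs_mult)
  then have "x \<notin> cube u k" using far by (auto simp: cube_def intro!: exI[of _ j])
  then have "f u \<le> exit_sum (cube u k) u f" by (rule exit)
  also have "\<dots> \<le> exit_sum (cube u k) u (\<lambda>z. 1 * ennreal (e ^ m * c))"
  proof (rule exit_sum_mono_edges)
    fix y z assume "(y, z) \<in> out_edges (cube u k)"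
    then have "\<bar>y $ j - u $ j\<bar> \<le> int k" "\<bar>y $ j - z $ j\<bar> \<le> 1"
      by (auto simp: out_edges_def cube_def intro: nn_adj_level)
    then have "s * (u $ j - x $ j) - (int k + 1) \<le> s * (z $ j - x $ j)"
      using s by (auto simp: abs_one_cases)
    then have "\<rho> + int m * (int k + 1) \<le> s * (z $ j - x $ j)"
      using Suc.prems by (simp add: algebra_simps)
    then show "f z \<le> 1 * ennreal (e ^ m * c)" using Suc.IH by simp
  qed
  also have "\<dots> = exit_sum (cube u k) u (\<lambda>_. 1) * ennreal (e ^ m * c)" by (rule exit_sum_multc)
  also have "\<dots> \<le> ennreal e * ennreal (e ^ m * c)" by (intro mult_right_mono mass) simp
  also have "\<dots> = ennreal (e ^ Suc m * c)" using e c by (simp add: ennreal_mult[symmetric] mult_ac)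
  finally show ?case .
qed

text \<open>For \<open>k = 1\<close> the iteration above only gives the rate \<open>exp (- r / k)\<close> without any room for the
  polynomial factor; only one face out of \<open>2 d\<close> leads two steps closer to \<open>x\<close>, which improves
  the rate to \<open>1 / 3 < exp (- 1)\<close>.\<close>

lemma iterated_unit_cube_exit:
  fixes f :: "int ^ 'd::finite \<Rightarrow> ennreal" and x :: "int ^ 'd"
  assumes dim: "5 \<le> CARD('d)" and s: "\<bar>s\<bar> = 1"
    and exit: "\<And>u. x \<notin> cube u 1 \<Longrightarrow> f u \<le> exit_sum (cube u 1) u f"
    and mass: "\<And>u :: int ^ 'd. exit_sum (cube u 1) u (\<lambda>_. 1) \<le> ennreal (exp (- 2))"
    and bnd: "\<And>v. 0 \<le> s * (v $ j - x $ j) \<Longrightarrow> f v \<le> ennreal c" and c: "0 \<le> c"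
  shows "int n \<le> s * (u $ j - x $ j) \<Longrightarrow> f u \<le> ennreal (3 * c * (1 / 3) ^ n)"
proof (induction n arbitrary: u rule: less_induct)
  case (less n)
  show ?case
  proof (cases "n < 2")
    case True
    have "f u \<le> ennreal c" using less.prems by (intro bnd) simp
    \<comment> \<open>The leading 3 is there for \<open>n = 1\<close>.\<close>
    also have "\<dots> \<le> ennreal (3 * c * (1 / 3) ^ n)"
      using True c by (intro ennreal_leI) (auto simp: less_2_cases_iff)
    finally show ?thesis .
  next
    case False
    then obtain m where m: "n = Suc (Suc m)" by (metis add_2_eq_Suc le_Suc_ex not_less)
    let ?f = "(j, - s)" and ?d = "real CARD('d)"
    have f: "?f \<in> UNIV \<times> {1, -1}" using s by auto
    have "\<bar>x $ j - u $ j\<bar> = \<bar>s * (u $ j - x $ j)\<bar>" using s by (simp add: abs_mult)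
    then have "x \<notin> cube u 1" using less.prems m by (auto simp: cube_def intro!: exI[of _ j])
    then have "f u \<le> exit_sum (cube u 1) u f" by (rule exit)
    also have "\<dots> \<le> face_mass u 1 ?f * ennreal (3 * c * (1 / 3) ^ m) +
        of_nat (2 * CARD('d) - 1) * face_mass u 1 ?f * ennreal (3 * c * (1 / 3) ^ Suc m)"
    proof (rule exit_sum_cube_le[OF f])
      fix z assume "face_ind u 1 ?f z = 1"
      then have "s * (z $ j - u $ j) = - 2" by (simp add: face_ind_def split: if_splits)
      then have "int m \<le> s * (z $ j - x $ j)" using less.prems m by (simp add: algebra_simps)
      then show "f z \<le> ennreal (3 * c * (1 / 3) ^ m)" using m by (intro less.IH) auto
    next
      fix y z assume yz: "(y, z) \<in> out_edges (cube u 1)" and nf: "face_ind u 1 ?f z \<noteq> 1"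
      have "\<bar>y $ j - u $ j\<bar> \<le> 1" "\<bar>y $ j - z $ j\<bar> \<le> 1"
        using yz by (auto simp: out_edges_def cube_def intro: nn_adj_level)
      then have "- 2 \<le> s * (z $ j - u $ j)" using s by (auto simp: abs_one_cases)
      moreover have "s * (z $ j - u $ j) \<noteq> - 2" using nf by (simp add: face_ind_def split: if_splits)
      ultimately have "- 1 \<le> s * (z $ j - u $ j)" by linarith
      then have "int (Suc m) \<le> s * (z $ j - x $ j)" using less.prems m by (simp add: algebra_simps)
      then show "f z \<le> ennreal (3 * c * (1 / 3) ^ Suc m)" using m by (intro less.IH) auto
    qed
    also have "\<dots> \<le> ennreal (3 * c * (1 / 3) ^ n)"
    proof -
      have total: "of_nat (2 * CARD('d)) * face_mass u 1 ?f \<le> ennreal (exp (- 2))"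
        using mass face_mass_total[OF f] by simp
      have "face_mass u 1 ?f \<noteq> \<infinity>"
      proof
        assume "face_mass u 1 ?f = \<infinity>"
        then have "(\<infinity>::ennreal) \<le> ennreal (exp (- 2))"
          using total by (simp add: ennreal_mult_top)
        then show False by (simp add: top_unique)
      qed
      then obtain \<mu> where \<mu>: "face_mass u 1 ?f = ennreal \<mu>" "0 \<le> \<mu>" by (cases "face_mass u 1 ?f") auto
      have "ennreal (2 * ?d * \<mu>) \<le> ennreal (exp (- 2))"
        using total \<mu> by (simp add: ennreal_mult ennreal_of_nat_eq_real_of_nat)
      then have "2 * ?d * \<mu> \<le> exp (- 2)" by (subst (asm) ennreal_le_iff) auto
      also have "exp (- 2 :: real) \<le> 1 / 4"
      proof -
        have "2 * 2 \<le> exp 1 * exp (1::real)" by (intro mult_mono) (use exp_ge_add_one_self[of 1] in auto)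
        then have "4 \<le> exp (2::real)" by (simp flip: exp_add)
        then show ?thesis by (simp add: exp_minus field_simps)
      qed
      finally have \<mu>2: "?d * \<mu> \<le> 1 / 8" by simp
      \<comment> \<open>The induction hypothesis exceeds the goal by a factor 9 on the face towards
        \<open>x\<close> and by 3 on the others. From \<open>?d * \<mu> \<le> 1 / 8\<close> and
        \<open>?d \<ge> 5\<close> the weighted sum is at most 9/10.\<close>
      have "5 * \<mu> \<le> ?d * \<mu>" using dim \<mu> by (intro mult_right_mono) auto
      then have le1: "9 * \<mu> + (2 * ?d - 1) * \<mu> * 3 \<le> 1" using \<mu>2 by (simp add: algebra_simps)
      let ?P = "(1 / 3 :: real) ^ n"
      have P: "(1 / 3) ^ m = 9 * ?P" "(1 / 3) ^ Suc m = 3 * ?P" by (simp_all add: m)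
      have nn: "0 \<le> 2 * ?d - 1" using dim by simp
      have "face_mass u 1 ?f * ennreal (3 * c * (1 / 3) ^ m) +
          of_nat (2 * CARD('d) - 1) * face_mass u 1 ?f * ennreal (3 * c * (1 / 3) ^ Suc m) =
          ennreal \<mu> * ennreal (3 * c * (9 * ?P)) + ennreal (2 * ?d - 1) * ennreal \<mu> * ennreal (3 * c * (3 * ?P))"
        using dim by (simp only: P \<mu> ennreal_of_nat_eq_real_of_nat) (simp add: of_nat_diff)
      also have "\<dots> = ennreal (\<mu> * (3 * c * (9 * ?P)) + (2 * ?d - 1) * \<mu> * (3 * c * (3 * ?P)))"
        using \<mu>(2) c nn by (simp only: ennreal_mult[symmetric] ennreal_plus mult_nonneg_nonneg
            zero_le_power zero_le_numeral divide_nonneg_nonneg zero_le_one)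
      also have "\<mu> * (3 * c * (9 * ?P)) + (2 * ?d - 1) * \<mu> * (3 * c * (3 * ?P)) =
          (9 * \<mu> + (2 * ?d - 1) * \<mu> * 3) * (3 * c * ?P)" by (simp add: algebra_simps)
      also have "ennreal \<dots> \<le> ennreal (1 * (3 * c * ?P))"
        using le1 c by (intro ennreal_leI mult_right_mono) auto
      finally show ?thesis by simp
    qed
    finally show ?thesis .
  qed
qed

end

text \<open>Since \<open>exp 1 < 3\<close>, the decay of \<open>(exp 1 / 3) ^ n\<close> absorbs any
  fixed power of \<open>n\<close>.\<close>

lemma one_third_power_le:
  "\<exists>K>0. \<forall>n. (1 / 3 :: real) ^ n \<le> K / real (max 1 n) ^ p * exp (- real n)"
proof -
  obtain K where K: "K > 0" "\<And>n. (real n + 1) ^ p * (exp 1 / 3 :: real) ^ n \<le> K"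
    using power_times_geometric_bounded[of "exp 1 / 3"] e_less_272 by auto
  have "(1 / 3 :: real) ^ n \<le> K / real (max 1 n) ^ p * exp (- real n)" for n
  proof -
    have "real (max 1 n) ^ p * (exp 1 / 3) ^ n \<le> (real n + 1) ^ p * (exp 1 / 3) ^ n"
      by (intro mult_right_mono power_mono) auto
    also have "\<dots> \<le> K" by (rule K)
    finally have "(exp 1 / 3) ^ n \<le> K / real (max 1 n) ^ p"
      by (subst pos_le_divide_eq) (simp_all add: mult.commute less_max_iff_disj)
    then have "(exp 1 / 3) ^ n * exp (- real n) \<le> K / real (max 1 n) ^ p * exp (- real n)"
      by (rule mult_right_mono) simp
    moreover have "(exp 1 / 3) ^ n * exp (- real n) = (1 / 3) ^ n"
      by (simp add: power_divide exp_minus flip: exp_of_nat_mult)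
    ultimately show ?thesis by simp
  qed
  then show ?thesis using K by blast
qed

section \<open>Decay at the scale of the sharp length\<close>

context wsaw begin

lemma lattice_box_eq_cube: "lattice_box k = (cube 0 k :: (int ^ 'd::finite) set)"
  by (auto simp: lattice_box_def cube_def sup_norm_def)

lemma cube_exit_mass_eq_phi:
  fixes u :: "int ^ 'd::finite"
  shows "exit_sum (cube u k) u (\<lambda>_. 1) = phi lam \<beta> (lattice_box k :: (int ^ 'd) set)"
proof -
  obtain j :: 'd where True by simp
  have f: "(j, 1) \<in> UNIV \<times> {1, -1::int}" by simp
  have "exit_sum (cube u k) u (\<lambda>_. 1) = exit_sum (cube 0 k) (0 :: int ^ 'd) (\<lambda>_. 1)"
    using face_mass_total[OF f, of u k] face_mass_total[OF f, of "0 :: int ^ 'd" k] face_mass_eq[OF f f, of u k 0] by simp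
  then show ?thesis
    by (simp add: exit_sum_def phi_def out_edges_def lattice_box_eq_cube)
qed

text \<open>For \<open>k \<ge> 2\<close> the cubes cross about three quarters of the distance, and
  the polynomial bound is applied over the remaining quarter. Each cube gains
  \<open>exp (- 2)\<close> over a distance \<open>k + 1 \<le> 3 / 2 * k\<close>, which exactly makes
  up for the quarter that is not crossed. For \<open>k = 1\<close> the distance is
  \<open>2 * k\<close> and nothing is left, hence the separate estimate. The function
  \<open>f\<close> stands for the two-point function of the lattice or of a half-space.\<close>

lemma exp_decay_bound:
  fixes f :: "int ^ 'd::finite \<Rightarrow> ennreal" and x :: "int ^ 'd"
  assumes dim: "5 \<le> CARD('d)" and s: "\<bar>s\<bar> = 1"
    and exit: "\<And>k u. x \<notin> cube u k \<Longrightarrow> f u \<le> exit_sum (cube u k) u f"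
    and C: "0 \<le> C"
    and bnd: "\<And>v n. s * (v $ j - x $ j) = int n \<Longrightarrow> f v \<le> ennreal (C / real (max 1 n) ^ p)"
    and K: "0 < K" "\<And>n. (1 / 3 :: real) ^ n \<le> K / real (max 1 n) ^ p * exp (- real n)"
    and u: "s * (u $ j - x $ j) = int r"
  shows "f u \<le> ennreal (C * (3 * K + 4 ^ p * exp 2 + 1) / real (max 1 r) ^ p *
    exp_decay (real r) (sharp_length TYPE('d) lam \<beta>))"
proof -
  define X where "X = C / real (max 1 r) ^ p"
  have X0: "0 \<le> X" using C by (simp add: X_def)
  have K0: "0 \<le> 3 * K" "0 \<le> (4::real) ^ p * exp 2" using K by auto
  let ?S = "{enat k | k. 1 \<le> k \<and> phi lam \<beta> (lattice_box k :: (int ^ 'd) set) \<le> ennreal (exp (- 2))}"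
  have goal: "f u \<le> ennreal (X * (3 * K + 4 ^ p * exp 2 + 1) * exp_decay (real r) (sharp_length TYPE('d) lam \<beta>))"
  proof (cases "sharp_length TYPE('d) lam \<beta>")
    case infinity
    have "f u \<le> ennreal (X * 1)" using bnd[OF u] by (simp add: X_def)
    also have "\<dots> \<le> ennreal (X * (3 * K + 4 ^ p * exp 2 + 1))"
      using X0 K0 by (intro ennreal_leI mult_left_mono) auto
    finally show ?thesis using infinity by (simp add: exp_decay_def)
  next
    case (enat k)
    have "?S \<noteq> {}"
    proof
      assume "?S = {}"
      then have "sharp_length TYPE('d) lam \<beta> = \<infinity>"
        unfolding sharp_length_def by (simp only: Inf_enat_def) simp
      then show False using enat by simp
    qed
    then obtain l where l: "l \<in> ?S" unfolding ex_in_conv[symmetric] by (elim exE)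
    have "sharp_length TYPE('d) lam \<beta> \<in> ?S"
      unfolding sharp_length_def by (rule wellorder_InfI[OF l])
    then have "enat k \<in> ?S" by (simp only: enat)
    then have k: "1 \<le> k" and phi: "phi lam \<beta> (lattice_box k :: (int ^ 'd) set) \<le> ennreal (exp (- 2))"
      by auto
    have mass: "exit_sum (cube v k) v (\<lambda>_. 1) \<le> ennreal (exp (- 2))" for v :: "int ^ 'd"
      unfolding cube_exit_mass_eq_phi by (rule phi)
    have "f u \<le> ennreal (X * (3 * K + 4 ^ p * exp 2 + 1) * exp (- real r / real k))"
    proof (cases "k = 1")
      case True
      have "f u \<le> ennreal (3 * C * (1 / 3) ^ r)"
      proof (rule iterated_unit_cube_exit[OF dim s exit])
        show "exit_sum (cube v 1) v (\<lambda>_. 1) \<le> ennreal (exp (- 2))" for v :: "int ^ 'd"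
          using mass True by simp
        show "f v \<le> ennreal C" if v: "0 \<le> s * (v $ j - x $ j)" for v
        proof -
          obtain n where n: "s * (v $ j - x $ j) = int n" by (rule nonneg_int_cases[OF v])
          have "1 \<le> real (max 1 n) ^ p" by (rule one_le_power) simp
          then have "C / real (max 1 n) ^ p \<le> C / 1" using C by (intro divide_left_mono) auto
          then show ?thesis using bnd[OF n] by (simp add: ennreal_leI order_trans)
        qed
      qed (use C u in auto)
      also have "3 * C * (1 / 3) ^ r \<le> 3 * C * (K / real (max 1 r) ^ p * exp (- real r))"
        using C by (intro mult_left_mono K) auto
      also have "\<dots> = X * (3 * K) * exp (- real r)" by (simp add: X_def)
      also have "\<dots> \<le> X * (3 * K + 4 ^ p * exp 2 + 1) * exp (- real r)"
        using X0 K0 by (intro mult_right_mono mult_left_mono) auto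
      finally show ?thesis using True by (simp add: ennreal_leI)
    next
      case False
      then have k2: "2 \<le> k" using k by simp
      define m where "m = (3 * r) div (4 * (k + 1))"
      have m1: "m * (4 * (k + 1)) \<le> 3 * r" by (simp add: m_def)
      have m2: "3 * r < (m + 1) * (4 * (k + 1))"
        unfolding m_def using dividend_less_div_times[of "4 * (k + 1)" "3 * r"]
        by (simp only: distrib_right mult_1_left) simp
      define \<rho> where "\<rho> = r - m * (k + 1)"
      have \<rho>: "int \<rho> + int m * (int k + 1) = int r" "r \<le> 4 * \<rho>"
      proof -
        have le: "4 * (m * (k + 1)) \<le> 3 * r" using m1 by (simp add: algebra_simps)
        then have "m * (k + 1) \<le> r" by linarith
        then have "\<rho> + m * (k + 1) = r" by (simp add: \<rho>_def)
        then have "int (\<rho> + m * (k + 1)) = int r" by (rule arg_cong)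
        then show "int \<rho> + int m * (int k + 1) = int r" by (simp add: algebra_simps)
        show "r \<le> 4 * \<rho>" using le by (simp add: \<rho>_def diff_mult_distrib2)
      qed
      have "f u \<le> ennreal (exp (- 2) ^ m * (X * 4 ^ p))"
      proof (rule iterated_cube_exit[OF s exit mass])
        show "int \<rho> + int m * (int k + 1) \<le> s * (u $ j - x $ j)" using \<rho> u by simp
        show "f v \<le> ennreal (X * 4 ^ p)" if v: "int \<rho> \<le> s * (v $ j - x $ j)" for v
        proof -
          obtain n where n: "s * (v $ j - x $ j) = int n" by (rule nonneg_int_cases[OF order_trans[OF of_nat_0_le_iff v]])
          have "\<rho> \<le> n" using v n by simp
          then have "real (max 1 r) \<le> 4 * real (max 1 n)" using \<rho>(2) by simp
          then have "real (max 1 r) ^ p \<le> (4 * real (max 1 n)) ^ p" by (intro power_mono) auto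
          then have "real (max 1 r) ^ p \<le> 4 ^ p * real (max 1 n) ^ p" by (simp only: power_mult_distrib)
          moreover have "0 < real (max 1 m)" for m :: nat by (simp add: less_max_iff_disj)
          then have "0 < real (max 1 r) ^ p" "0 < 4 ^ p * real (max 1 n) ^ p"
            by (intro mult_pos_pos zero_less_power; simp)+
          ultimately have "C * 4 ^ p / (4 ^ p * real (max 1 n) ^ p) \<le> C * 4 ^ p / real (max 1 r) ^ p"
            using C by (intro divide_left_mono mult_pos_pos[of "_ ^ _"]) (simp_all add: less_max_iff_disj)
          then have "C / real (max 1 n) ^ p \<le> X * 4 ^ p" unfolding X_def by simp
          then show ?thesis using bnd[OF n] by (meson ennreal_leI order_trans)
        qed
      qed (use X0 in auto)
      also have "exp (- 2) ^ m * (X * 4 ^ p) \<le> (exp 2 * exp (- real r / real k)) * (X * 4 ^ p)"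
      proof (rule mult_right_mono)
        \<comment> \<open>Rounding down in \<open>m\<close> loses at most one cube, which is the
          constant \<open>exp 2\<close>.\<close>
        have "real r / real k \<le> 2 * real m + 2"
        proof -
          have "real (3 * r) \<le> real ((m + 1) * (4 * (k + 1)))" using m2 by (intro of_nat_mono) simp
          then have "3 * real r \<le> 4 * (real m + 1) * (real k + 1)" by (simp add: algebra_simps)
          also have "\<dots> \<le> 4 * (real m + 1) * (3 / 2 * real k)"
            using k2 by (intro mult_left_mono) auto
          finally have "real r \<le> (2 * real m + 2) * real k" by (simp add: algebra_simps)
          then show ?thesis using k2 by (simp add: divide_le_eq)
        qed
        then have "exp (real m * (- 2)) \<le> exp (2 + (- real r / real k))"
          by (subst exp_le_cancel_iff) simp
        then show "exp (- 2 :: real) ^ m \<le> exp 2 * exp (- real r / real k)"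
          by (simp only: exp_add exp_of_nat_mult)
      qed (use X0 in auto)
      also have "\<dots> = X * (4 ^ p * exp 2) * exp (- real r / real k)" by simp
      also have "\<dots> \<le> X * (3 * K + 4 ^ p * exp 2 + 1) * exp (- real r / real k)"
        using X0 K0 by (intro mult_right_mono mult_left_mono) auto
      finally show ?thesis by (simp add: ennreal_leI)
    qed
    then show ?thesis using enat by (simp add: exp_decay_def)
  qed
  then show ?thesis by (simp add: X_def)
qed

end

theorem theorem1p1:
  fixes i :: "'d::finite"
  assumes "CARD('d) > 4"
  shows "\<exists>C::real. \<exists>lam0::real. C > 0 \<and> lam0 > 0 \<and>
    (\<forall>lam::real. 0 \<le> lam \<and> lam \<le> 1 \<and> lam < lam0 \<longrightarrow>
      (\<forall>\<beta>::real. 0 \<le> \<beta> \<and> ereal \<beta> \<le> crit_beta TYPE('d) lam \<longrightarrow>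
        (\<forall>x::int ^ 'd.
          two_point lam \<beta> UNIV 0 x
            \<le> ennreal (C / real_of_int (max 1 (sup_norm x)) ^ (CARD('d) - 2)
                * exp_decay (real_of_int (sup_norm x)) (sharp_length TYPE('d) lam \<beta>)) \<and>
          two_point lam \<beta> (half_space i) 0 x
            \<le> ennreal (C / real_of_int (max 1 \<bar>x $ i\<bar>) ^ (CARD('d) - 1)
                * exp_decay (real_of_int \<bar>x $ i\<bar>) (sharp_length TYPE('d) lam \<beta>)))))"
proof -
  let ?d = "CARD('d)"
  define A where "A = 8 * real ?d"
  have dm: "5 \<le> ?d" using assms by simp
  have A1: "1 \<le> A" using dm by (simp add: A_def)
  obtain C0 lam0 where C0: "1 \<le> C0" and lam0: "0 < lam0"
    and sub: "\<And>lam \<beta> \<beta>1. 0 \<le> lam \<Longrightarrow> lam \<le> 1 \<Longrightarrow> lam < lam0 \<Longrightarrow> 0 \<le> \<beta> \<Longrightarrow> \<beta> < \<beta>1 \<Longrightarrow>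
      susceptibility TYPE('d) lam \<beta>1 < \<infinity> \<Longrightarrow> wsaw.half_space_bounds lam \<beta> TYPE('d) A C0"
    using half_space_bounds_subcritical[OF assms, of "TYPE('d)"] unfolding A_def by blast
  obtain K1 where K1: "0 < K1" "\<And>n. (1 / 3 :: real) ^ n \<le> K1 / real (max 1 n) ^ (?d - 2) * exp (- real n)"
    using one_third_power_le by blast
  obtain K2 where K2: "0 < K2" "\<And>n. (1 / 3 :: real) ^ n \<le> K2 / real (max 1 n) ^ (?d - 1) * exp (- real n)"
    using one_third_power_le by blast
  define C1 where "C1 = 2 * A * C0 * (3 * K1 + 4 ^ (?d - 2) * exp 2 + 1)"
  define C2 where "C2 = C0 * (3 * K2 + 4 ^ (?d - 1) * exp 2 + 1)"
  have C12: "0 \<le> C1" "0 \<le> C2" using A1 C0 K1 K2 by (simp_all add: C1_def C2_def)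
  have dec: "0 \<le> exp_decay r L" for r L by (simp add: exp_decay_def split: enat.split)
  have "two_point lam \<beta> UNIV 0 x
      \<le> ennreal ((C1 + C2 + 1) / real_of_int (max 1 (sup_norm x)) ^ (?d - 2)
        * exp_decay (real_of_int (sup_norm x)) (sharp_length TYPE('d) lam \<beta>))" (is ?full)
    and "two_point lam \<beta> (half_space i) 0 x
      \<le> ennreal ((C1 + C2 + 1) / real_of_int (max 1 \<bar>x $ i\<bar>) ^ (?d - 1)
        * exp_decay (real_of_int \<bar>x $ i\<bar>) (sharp_length TYPE('d) lam \<beta>))" (is ?half)
    if lm: "0 \<le> lam" "lam \<le> 1" "lam < lam0" and \<beta>: "0 \<le> \<beta>" "ereal \<beta> \<le> crit_beta TYPE('d) lam"
    for lam \<beta> and x :: "int ^ 'd"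
  proof -
    interpret wsaw lam \<beta> using lm \<beta> by unfold_locales auto
    have hyp: "half_space_bounds TYPE('d) A C0"
      by (rule half_space_bounds_critical[OF lm(1,2) A1 C0 \<beta> sub[OF lm]])
    interpret bounded_wsaw lam \<beta> A C0 "TYPE('d)"
      using hyp A1 C0 assms by unfold_locales auto
    show ?full
    proof -
      \<comment> \<open>The bulk bound holds in every coordinate; the one that realises the norm is
        taken.\<close>
      have "sup_norm x \<in> range (\<lambda>j. \<bar>x $ j\<bar>)" unfolding sup_norm_def by (rule Max_in) auto
      then obtain j where j: "sup_norm x = \<bar>x $ j\<bar>" by auto
      \<comment> \<open>The endpoint \<open>x\<close> is held fixed and the walk starts at 0, so the
        sign is chosen to make \<open>s * (0 - x $ j)\<close> the distance.\<close>
      define s :: int where "s = (if 0 \<le> x $ j then - 1 else 1)"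
      define r where "r = nat \<bar>x $ j\<bar>"
      have s: "\<bar>s\<bar> = 1" by (simp add: s_def)
      have "G UNIV 0 x \<le> ennreal (2 * A * C0 * (3 * K1 + 4 ^ (?d - 2) * exp 2 + 1) / real (max 1 r) ^ (?d - 2) *
          exp_decay (real r) (sharp_length TYPE('d) lam \<beta>))"
      proof (rule exp_decay_bound[OF dm s _ _ _ K1, where f = "\<lambda>u. G UNIV u x" and x = x and j = j and u = 0])
        show "G UNIV u x \<le> exit_sum (cube u k) u (\<lambda>u. G UNIV u x)" if "x \<notin> cube u k" for k u
          using that by (intro first_exit_outside) (auto simp: cube_def)
        show "G UNIV v x \<le> ennreal (2 * A * C0 / real (max 1 n) ^ (?d - 2))"
          if n: "s * (v $ j - x $ j) = int n" for v n
        proof -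
          have "int n = \<bar>v $ j - x $ j\<bar>" using n s by (metis abs_mult abs_of_nat mult_1_left)
          then have dist: "real_of_int \<bar>v $ j - x $ j\<bar> = real n" by (metis of_int_of_nat_eq)
          have "2 * A * C0 / (real n + 1) ^ (?d - 2) \<le> 2 * A * C0 / real (max 1 n) ^ (?d - 2)"
            using A1 C0 by (intro divide_left_mono power_mono mult_pos_pos zero_less_power) auto
          then show ?thesis using bulk_le[of v x j] unfolding dist by (meson ennreal_leI order_trans)
        qed
        show "s * ((0 :: int ^ 'd) $ j - x $ j) = int r" by (simp add: s_def r_def)
      qed (use A1 C0 in auto)
      also have "\<dots> = ennreal (C1 / real (max 1 r) ^ (?d - 2) * exp_decay (real r) (sharp_length TYPE('d) lam \<beta>))"
        by (simp add: C1_def)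
      also have "\<dots> \<le> ennreal ((C1 + C2 + 1) / real (max 1 r) ^ (?d - 2) * exp_decay (real r) (sharp_length TYPE('d) lam \<beta>))"
        using C12 by (intro ennreal_leI mult_right_mono divide_right_mono dec) auto
      also have "real (max 1 r) = real_of_int (max 1 (int r))" by (simp add: max_def)
      also have "real r = real_of_int (int r)" by simp
      also have "int r = sup_norm x" by (simp add: j r_def)
      finally show ?thesis .
    qed
    show ?half
    proof (cases "0 \<le> x $ i")
      case False
      then show ?thesis by (simp add: two_point_outside half_space_def)
    next
      case True
      define r where "r = nat (x $ i)"
      have hs: "half_space i = hs i 1 0" by (simp add: half_space_def hs_def)
      \<comment> \<open>Read backwards, the path runs from \<open>x\<close> to the boundary point 0,
        so the pointwise half-space bound applies to every intermediate starting point.\<close>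
      have "G (hs i 1 0) x 0 \<le> ennreal (C0 * (3 * K2 + 4 ^ (?d - 1) * exp 2 + 1) / real (max 1 r) ^ (?d - 1) *
          exp_decay (real r) (sharp_length TYPE('d) lam \<beta>))"
      proof (rule exp_decay_bound[OF dm _ _ _ _ K2, where f = "\<lambda>u. G (hs i 1 0) u 0" and x = 0 and j = i and s = 1 and u = x])
        show "G (hs i 1 0) u 0 \<le> exit_sum (cube u k) u (\<lambda>u. G (hs i 1 0) u 0)" if "0 \<notin> cube u k" for k u
          using that by (intro first_exit_outside) (auto simp: cube_def)
        show "G (hs i 1 0) v 0 \<le> ennreal (C0 / real (max 1 n) ^ (?d - 1))"
          if n: "1 * (v $ i - (0 :: int ^ 'd) $ i) = int n" for v n
        proof -
          have "G (hs i 1 0) v 0 \<le> ennreal (C0 / (real_of_int (1 * v $ i - 0) + 1) ^ (?d - 1))"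
            using n by (intro boundary_point_le) auto
          also have "real_of_int (1 * v $ i - 0) = real n" using n by simp
          also have "C0 / (real n + 1) ^ (?d - 1) \<le> C0 / real (max 1 n) ^ (?d - 1)"
            using C0 by (intro divide_left_mono power_mono mult_pos_pos zero_less_power) auto
          finally show ?thesis by (simp add: ennreal_leI)
        qed
        show "1 * (x $ i - (0 :: int ^ 'd) $ i) = int r" using True by (simp add: r_def)
      qed (use C0 in auto)
      also have "\<dots> = ennreal (C2 / real (max 1 r) ^ (?d - 1) * exp_decay (real r) (sharp_length TYPE('d) lam \<beta>))"
        by (simp add: C2_def)
      also have "\<dots> \<le> ennreal ((C1 + C2 + 1) / real (max 1 r) ^ (?d - 1) * exp_decay (real r) (sharp_length TYPE('d) lam \<beta>))"
        using C12 by (intro ennreal_leI mult_right_mono divide_right_mono dec) auto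
      also have "real (max 1 r) = real_of_int (max 1 (int r))" by (simp add: max_def)
      also have "real r = real_of_int (int r)" by simp
      also have "int r = \<bar>x $ i\<bar>" using True by (simp add: r_def)
      finally show ?thesis by (simp only: hs two_point_sym[of _ _ _ 0])
    qed
  qed
  then show ?thesis using C12 lam0 by (intro exI[of _ "C1 + C2 + 1"] exI[of _ lam0]) auto
qed

end
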